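(* Let $q\ge 6$ be a prime power. Let $\bar{\mathcal C}$ be an $\mathbb F_q$-conic in an $\mathbb F_q$-subplane $\bar\pi$ of $\mathrm{PG}(2,q^3)$ that is tangent to $\ell_\infty$, and let $\bar T=\ell_\infty\cap\bar\pi$. In the exact-at-infinity Bruck-Bose representation in $\mathrm{PG}(6,q)$ we have the following. 1. If $\bar T\in\bar{\mathcal C}$, then $\bar{\mathcal C}^+\cap\ell_\infty=\{\bar T,\bar Q\}$ for some $\bar Q\ne\bar T$. The pointset of $[\mathcal C]$ consists of the spread plane $[T]$ and a 4-dimensional normal rational curve $\mathcal N_4$. Further, $\mathcal N_4^\star\cap\Sigma_\infty^\star$ consists of one real point (that is, a point over $\mathbb F_q$) of $[T]$, and the points $Q,Q^q,Q^{q^2}$. 2. Otherwise $\bar T\notin\bar{\mathcal C}$, and $\bar{\mathcal C}^+$ meets $\ell_\infty$ in two points $\bar P,\bar Q$, possibly repeated, possibly in the quadratic extension. In this case $\mathcal V([\mathcal C])$ is a 6-dimensional normal rational curve $\mathcal N_6$ of $\mathrm{PG}(6,q)$. Further, $\mathcal N_6^\star$ meets $\Sigma_\infty^\star$ in six points $\{P,P^q,P^{q^2},Q,Q^q,Q^{q^2}\}$, where $P,Q\in g$, possibly repeated, or possibly in the extension $g^{\star\star}\setminus g$ (the intersection then being that of $\mathcal N_6^{\star\star}$ with $\Sigma_\infty^{\star\star}$), in which case $Q=P^{q^3}$.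
   Context: **$\mathbb F_q$-conics.** An $\mathbb F_q$-subplane of $\mathrm{PG}(2,q^3)$ is a subplane of order $q$; it is secant, tangent or exterior to a line if it meets it in $q+1$, $1$ or $0$ points. An $\mathbb F_q$-conic is a non-degenerate conic of an $\mathbb F_q$-subplane. For an $\mathbb F_q$-conic $\bar{\mathcal C}$, $\bar{\mathcal C}^{+}$ is the unique non-degenerate conic of $\mathrm{PG}(2,q^3)$ containing it, and $\bar{\mathcal C}^{++}$ the unique non-degenerate conic of $\mathrm{PG}(2,q^6)$ containing $\bar{\mathcal C}^+$ (if $\bar{\mathcal C}^+\cap\ell_\infty=\emptyset$, the points $\bar P,\bar Q$ are the intersections of $\bar{\mathcal C}^{++}$ with the extension of $\ell_\infty$ to $\mathrm{PG}(2,q^6)$). A line $\ell_\infty$ of $\mathrm{PG}(2,q^3)$ is fixed as line at infinity. **Normal rational curves.** An $r$-dimensional normal rational curve in $\mathrm{PG}(n,q)$ is a set of points lying in an $r$-space and projectively equivalent to $\{(1,\theta,\dots,\theta^r):\theta\in\mathbb F_q\}\cup\{(0,\dots,0,1)\}$; it extends naturally to a normal rational curve over extension fields. **Conjugacy.** For an $\mathbb F_q$-subplane $\bar\pi$, $\bar{\mathsf c}_\pi$ is the collineation $\bar X\mapsto B\bar X^q$ ($B\in\mathrm{GL}(3,q^3)$) of $\mathrm{PG}(2,q^3)$ that has order 3 and fixes $\bar\pi$ pointwise; the same formula defines it on $\mathrm{PG}(2,q^6)$, where it has order 6. **Bose representation.** Embed $\mathrm{PG}(8,q)\subset\mathrm{PG}(8,q^3)\subset\mathrm{PG}(8,q^6)$;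 $X^q$ is obtained by raising coordinates to the $q$-th power. For a subspace or variety $\mathcal K$ given over $\mathbb F_q$ (including normal rational curves), $\mathcal K^\star$ and $\mathcal K^{\star\star}$ denote its extensions to $\mathbb F_{q^3}$ and $\mathbb F_{q^6}$; for a subspace $\Sigma$ of $\mathrm{PG}(8,q^3)$, $\Sigma^{\star\star}$ is its extension to $\mathrm{PG}(8,q^6)$. Let $\Gamma$ be a plane of $\mathrm{PG}(8,q^3)$ disjoint from $\mathrm{PG}(8,q)$ such that $\Gamma,\Gamma^q,\Gamma^{q^2}$ span $\mathrm{PG}(8,q^3)$. The planes $[\![X]\!]=\langle X,X^q,X^{q^2}\rangle\cap\mathrm{PG}(8,q)$, $X\in\Gamma$, form a regular 2-spread of $\mathrm{PG}(8,q)$. Identify $\mathrm{PG}(2,q^3)$ with $\Gamma$ (and $\mathrm{PG}(2,q^6)$ with $\Gamma^{\star\star}$) by a linear isomorphism, $\bar X\leftrightarrow X$; dropping the bar denotes the corresponding object in $\Gamma$ or $\Gamma^{\star\star}$. **Scroll-planes.** For $X\in\Gamma^{\star\star}$, the $\pi$-scroll-plane is $(\!(X)\!)_\pi=\langle X,(X^{\mathsf c_\pi^5})^q,(X^{\mathsf c_\pi^4})^{q^2}\rangle$. **Exact-at-infinity Bruck-Bose representation.** Let $g\subset\Gamma$ be the line corresponding to $\ell_\infty$, $\Sigma_\infty=\langle g,g^q,g^{q^2}\rangle\cap\mathrm{PG}(8,q)$ (a 5-space), and $\Sigma_{6,q}\cong\mathrm{PG}(6,q)$ a 6-space of $\mathrm{PG}(8,q)$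 containing $\Sigma_\infty$ as its hyperplane at infinity. The planes $[\![X]\!]$, $X\in g$, form a regular 2-spread $\mathcal S$ of $\Sigma_\infty$, with transversal lines $g,g^q,g^{q^2}$; its elements are the spread planes. For a point $\bar X$ let $[X]=[\![X]\!]\cap\Sigma_{6,q}$: a point of $\Sigma_{6,q}\setminus\Sigma_\infty$ if $\bar X\notin\ell_\infty$, the spread plane $[\![X]\!]$ if $\bar X\in\ell_\infty$. $[\mathcal C]$ is the set of points lying in the $[X]$, $\bar X\in\bar{\mathcal C}$. **Varieties.** It is known that the pointset of $\{[\![X]\!]:X\in\mathcal C\}$ is an intersection $\mathcal V([\![\mathcal C]\!])$ of nine quadrics of $\mathrm{PG}(8,q)$, that $\mathcal V([\![\mathcal C]\!])^\star$ is the set of points on the planes $(\!(X)\!)_\pi$, $X\in\mathcal C^+$, and $\mathcal V([\![\mathcal C]\!])^{\star\star}$ is the set of points on the planes $(\!(X)\!)_\pi$, $X\in\mathcal C^{++}$. Put $\mathcal V([\mathcal C])=\mathcal V([\![\mathcal C]\!])\cap\Sigma_{6,q}$ (its pointset is $[\mathcal C]$). *)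

theory Defs
  imports "HOL-Analysis.Analysis" "HOL-Computational_Algebra.Polynomial"
    "HOL-Number_Theory.Prime_Powers"
begin

text \<open>
  One finite field type of cardinality \<open>q ^ 6\<close> serves as ambient field, and the fields of order
  \<open>q\<close> and \<open>q ^ 3\<close> are its subfields \<open>GF q\<close> and \<open>GF (q ^ 3)\<close>.  A projective point is a
  one-dimensional subspace of a coordinate space over the ambient field; it belongs to \<open>PG K\<close> if it
  is spanned by a vector with coordinates in \<open>K\<close>.  Hence \<open>PG (GF q)\<close>, \<open>PG (GF (q ^ 3))\<close> and
  \<open>PG (GF (q ^ 6))\<close> are literally nested, and subspaces, conics and curves over a subfield are sets
  of such points.
\<close>

definition GF :: "nat \<Rightarrow> 'a::field set" where
  "GF m = {x. x ^ m = x}"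

definition rational :: "'a::field set \<Rightarrow> ('a ^ 'n) set" where
  "rational K = {v. \<forall>i. v $ i \<in> K}"

definition rational_mat :: "'a::field set \<Rightarrow> ('a ^ 'm ^ 'n) set" where
  "rational_mat K = {A. \<forall>i j. A $ i $ j \<in> K}"

definition PG :: "'a::field set \<Rightarrow> ('a ^ 'n) set set" where
  "PG K = {vec.span {v} | v. v \<in> rational K \<and> v \<noteq> 0}"

text \<open>
  The \<open>K\<close>-points of the span of a set of points.  For \<open>S\<close> a subspace over a smaller field this is
  the extension of \<open>S\<close> to \<open>K\<close>; for \<open>S\<close> not defined over \<open>K\<close> it is the intersection of the span
  of \<open>S\<close> with \<open>PG K\<close>.
\<close>

definition pspan :: "'a::field set \<Rightarrow> ('a ^ 'n) set set \<Rightarrow> ('a ^ 'n) set set" where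
  "pspan K S = {X \<in> PG K. X \<subseteq> vec.span (\<Union>S)}"

definition proj_subspace :: "'a::field set \<Rightarrow> nat \<Rightarrow> ('a ^ 'n) set set \<Rightarrow> bool" where
  "proj_subspace K d S \<longleftrightarrow> S \<subseteq> PG K \<and> pspan K S = S \<and> vec.dim (\<Union>S) = d + 1"

definition frob :: "nat \<Rightarrow> ('a::field ^ 'n) set \<Rightarrow> ('a ^ 'n) set" where
  "frob m X = (\<lambda>v. \<chi> i. (v $ i) ^ m) ` X"

definition mat_image :: "'a::field ^ 'm ^ 'n \<Rightarrow> ('a ^ 'm) set \<Rightarrow> ('a ^ 'n) set" where
  "mat_image A X = (\<lambda>v. A *v v) ` X"


section \<open>Subplanes and conics\<close>

text \<open>
  A set of points of the plane over \<open>K\<close> that, with the lines of the plane meeting it in at least two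
  points, forms a projective plane of order \<open>m\<close>.
\<close>

definition subplane :: "'a::field set \<Rightarrow> nat \<Rightarrow> ('a ^ 3) set set \<Rightarrow> bool" where
  "subplane K m \<pi> \<longleftrightarrow> \<pi> \<subseteq> PG K \<and>
     (\<forall>L. proj_subspace K 1 L \<and> card (L \<inter> \<pi>) \<ge> 2 \<longrightarrow> card (L \<inter> \<pi>) = m + 1) \<and>
     (\<forall>L M. proj_subspace K 1 L \<and> card (L \<inter> \<pi>) \<ge> 2 \<and>
            proj_subspace K 1 M \<and> card (M \<inter> \<pi>) \<ge> 2 \<longrightarrow> L \<inter> M \<inter> \<pi> \<noteq> {}) \<and>
     (\<exists>S \<subseteq> \<pi>. card S = 4 \<and> (\<forall>L. proj_subspace K 1 L \<longrightarrow> card (S \<inter> L) \<le> 2))"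

definition quad_form :: "'a::field ^ 3 ^ 3 \<Rightarrow> 'a ^ 3 \<Rightarrow> 'a" where
  "quad_form M x = (\<Sum>i\<in>UNIV. \<Sum>j\<in>UNIV. M $ i $ j * x $ i * x $ j)"

text \<open>
  Non-degeneracy means that there is no singular point: a point of the conic at which the polar form
  vanishes identically.  This is the right notion in characteristic 2 too; \<open>M\<close> is not required
  to be symmetric, so every quadratic form is covered.
\<close>

definition nondeg_conic :: "'a::field set \<Rightarrow> ('a ^ 3) set set \<Rightarrow> bool" where
  "nondeg_conic K D \<longleftrightarrow> (\<exists>M \<in> rational_mat K.
     \<not> (\<exists>v \<in> rational K. v \<noteq> 0 \<and> quad_form M v = 0 \<and>
          (\<forall>w \<in> rational K. quad_form M (v + w) - quad_form M v - quad_form M w = 0)) \<and>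
     D = {X \<in> PG K. \<forall>x\<in>X. quad_form M x = 0})"

text \<open>
  Non-degenerate conics of a subplane \<open>\<pi>\<close> of order \<open>q\<close> are taken with respect to homogeneous
  coordinates over \<open>GF q\<close> on \<open>\<pi>\<close>, that is, a homography carrying \<open>PG (GF q)\<close> onto \<open>\<pi>\<close>.
\<close>

definition Fq_conic :: "nat \<Rightarrow> ('a::field ^ 3) set set \<Rightarrow> ('a ^ 3) set set \<Rightarrow> bool" where
  "Fq_conic q \<pi> C \<longleftrightarrow> subplane (GF (q ^ 3)) q \<pi> \<and>
     (\<exists>A D. A \<in> rational_mat (GF (q ^ 3)) \<and> invertible A \<and> nondeg_conic (GF q) D \<and>
        \<pi> = mat_image A ` PG (GF q) \<and> C = mat_image A ` D)"

text \<open>The conic over \<open>K\<close> is unique as soon as \<open>C\<close> has five points, no three collinear.\<close>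

definition conic_ext :: "'a::field set \<Rightarrow> ('a ^ 3) set set \<Rightarrow> ('a ^ 3) set set" where
  "conic_ext K C = (THE D. nondeg_conic K D \<and> C \<subseteq> D)"

definition conic_plus :: "nat \<Rightarrow> ('a::field ^ 3) set set \<Rightarrow> ('a ^ 3) set set" where
  "conic_plus q C = conic_ext (GF (q ^ 3)) C"

definition conic_plusplus :: "nat \<Rightarrow> ('a::field ^ 3) set set \<Rightarrow> ('a ^ 3) set set" where
  "conic_plusplus q C = conic_ext (GF (q ^ 6)) (conic_plus q C)"


section \<open>Normal rational curves\<close>

text \<open>
  An \<open>r\<close>-dimensional normal rational curve is given by a basis \<open>b 0, \<dots>, b r\<close> of an \<open>r\<close>-space with
  respect to which it has the standard parametrisation.  If \<open>b\<close> is defined over \<open>GF q\<close>, then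
  \<open>nrc (GF q) r b\<close> is the curve and \<open>nrc K r b\<close> its extension to \<open>K\<close>.  The basis is kept as data
  because a set of only \<open>r + 2\<close> points (\<open>r = 6\<close>, \<open>q = 7\<close>) does not determine its extension.
\<close>

definition nrc_basis :: "'a::field set \<Rightarrow> nat \<Rightarrow> (nat \<Rightarrow> 'a ^ 'n) \<Rightarrow> bool" where
  "nrc_basis K r b \<longleftrightarrow>
     (\<forall>i\<le>r. b i \<in> rational K) \<and> inj_on b {..r} \<and> vec.independent (b ` {..r})"

definition nrc_point :: "nat \<Rightarrow> (nat \<Rightarrow> 'a::field ^ 'n) \<Rightarrow> 'a \<Rightarrow> ('a ^ 'n) set" where
  "nrc_point r b \<theta> = vec.span {\<Sum>i\<le>r. \<theta> ^ i *s b i}"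

definition nrc :: "'a::field set \<Rightarrow> nat \<Rightarrow> (nat \<Rightarrow> 'a ^ 'n) \<Rightarrow> ('a ^ 'n) set set" where
  "nrc K r b = nrc_point r b ` K \<union> {vec.span {b r}}"

definition hyperplane :: "'a::field ^ 'n \<Rightarrow> ('a ^ 'n) set" where
  "hyperplane h = {x. (\<Sum>i\<in>UNIV. h $ i * x $ i) = 0}"

text \<open>
  The points in which the curve meets a hyperplane, with their multiplicities: roots of the binary
  form of degree \<open>r\<close> obtained by substituting the parametrisation into the linear form, the
  parameter at infinity having as multiplicity the drop in degree.
\<close>

definition nrc_section :: "nat \<Rightarrow> (nat \<Rightarrow> 'a::field ^ 'n) \<Rightarrow> 'a ^ 'n \<Rightarrow> ('a ^ 'n) set multiset" where
  "nrc_section r b h =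
     (let p = (\<Sum>i\<le>r. monom (\<Sum>j\<in>UNIV. h $ j * b i $ j) i)
      in image_mset (nrc_point r b) (proots p)
         + replicate_mset (r - degree p) (vec.span {b r}))"


section \<open>Bose representation\<close>

text \<open>
  The matrix \<open>J\<close> is the linear isomorphism from the plane over \<open>GF (q ^ 3)\<close> onto \<open>\<Gamma>\<close>; it also
  identifies the plane over \<open>GF (q ^ 6)\<close> with the extension of \<open>\<Gamma>\<close>.
\<close>

definition bose_plane :: "nat \<Rightarrow> 'a::field ^ 3 ^ 9 \<Rightarrow> ('a ^ 9) set set \<Rightarrow> bool" where
  "bose_plane q J \<Gamma> \<longleftrightarrow>
     proj_subspace (GF (q ^ 3)) 2 \<Gamma> \<and>
     \<Gamma> \<inter> PG (GF q) = {} \<and>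
     pspan (GF (q ^ 3)) (\<Gamma> \<union> frob q ` \<Gamma> \<union> frob (q ^ 2) ` \<Gamma>) = PG (GF (q ^ 3)) \<and>
     J \<in> rational_mat (GF (q ^ 3)) \<and> inj (\<lambda>v. J *v v) \<and>
     mat_image J ` PG (GF (q ^ 3)) = \<Gamma>"

definition bose_element :: "nat \<Rightarrow> ('a::field ^ 9) set \<Rightarrow> ('a ^ 9) set set" where
  "bose_element q X = pspan (GF q) {X, frob q X, frob (q ^ 2) X}"

definition bb_element ::
    "nat \<Rightarrow> 'a::field ^ 3 ^ 9 \<Rightarrow> ('a ^ 9) set set \<Rightarrow> ('a ^ 3) set \<Rightarrow> ('a ^ 9) set set" where
  "bb_element q J \<Sigma>6 X = bose_element q (mat_image J X) \<inter> \<Sigma>6"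

definition bb_set ::
    "nat \<Rightarrow> 'a::field ^ 3 ^ 9 \<Rightarrow> ('a ^ 9) set set \<Rightarrow> ('a ^ 3) set set \<Rightarrow> ('a ^ 9) set set" where
  "bb_set q J \<Sigma>6 C = (\<Union>X\<in>C. bb_element q J \<Sigma>6 X)"

definition conj_map :: "nat \<Rightarrow> 'a::field ^ 3 ^ 3 \<Rightarrow> ('a ^ 3) set \<Rightarrow> ('a ^ 3) set" where
  "conj_map q B X = mat_image B (frob q X)"

definition conjugacy :: "nat \<Rightarrow> ('a::field ^ 3) set set \<Rightarrow> 'a ^ 3 ^ 3 \<Rightarrow> bool" where
  "conjugacy q \<pi> B \<longleftrightarrow> B \<in> rational_mat (GF (q ^ 3)) \<and> invertible B \<and>
     (\<forall>X\<in>\<pi>. conj_map q B X = X) \<and>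
     (\<forall>X\<in>PG (GF (q ^ 3)). (conj_map q B ^^ 3) X = X) \<and>
     (\<exists>X\<in>PG (GF (q ^ 3)). conj_map q B X \<noteq> X)"

text \<open>The \<open>K\<close>-points of the scroll-plane of a point of the plane over \<open>K\<close>.\<close>

definition scroll_plane :: "nat \<Rightarrow> 'a::field ^ 3 ^ 9 \<Rightarrow> 'a ^ 3 ^ 3 \<Rightarrow> 'a set \<Rightarrow>
    ('a ^ 3) set \<Rightarrow> ('a ^ 9) set set" where
  "scroll_plane q J B K X =
     pspan K {mat_image J X,
              frob q (mat_image J ((conj_map q B ^^ 5) X)),
              frob (q ^ 2) (mat_image J ((conj_map q B ^^ 4) X))}"

text \<open>
  The Bose representation of a conic is an intersection of quadrics over \<open>GF q\<close>; the points of
  its extension to \<open>GF (q ^ 3)\<close> or \<open>GF (q ^ 6)\<close> are those on the scroll-planes of the points of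
  the extended conic.  These are cut with the extension of the 6-space \<open>\<Sigma>6\<close>; the points over
  \<open>GF q\<close> form \<open>bb_set\<close>.
\<close>

definition bb_variety_star :: "nat \<Rightarrow> 'a::field ^ 3 ^ 9 \<Rightarrow> 'a ^ 3 ^ 3 \<Rightarrow> ('a ^ 9) set set \<Rightarrow>
    ('a ^ 3) set set \<Rightarrow> ('a ^ 9) set set" where
  "bb_variety_star q J B \<Sigma>6 C =
     (\<Union>X\<in>conic_plus q C. scroll_plane q J B (GF (q ^ 3)) X) \<inter> pspan (GF (q ^ 3)) \<Sigma>6"

definition bb_variety_starstar :: "nat \<Rightarrow> 'a::field ^ 3 ^ 9 \<Rightarrow> 'a ^ 3 ^ 3 \<Rightarrow> ('a ^ 9) set set \<Rightarrow>
    ('a ^ 3) set set \<Rightarrow> ('a ^ 9) set set" where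
  "bb_variety_starstar q J B \<Sigma>6 C =
     (\<Union>X\<in>conic_plusplus q C. scroll_plane q J B (GF (q ^ 6)) X) \<inter> pspan (GF (q ^ 6)) \<Sigma>6"

end

theory Submission
  imports Defs
begin

text \<open>
  Choose coordinates in which the subplane is \<open>PG (GF q)\<close> and the conic is
  \<open>\<nu>(\<theta>) = (1, \<theta>, \<theta> ^ 2)\<close>, with the tangency point at \<open>\<theta> = \<infinity>\<close> if it lies on the conic.  The
  conjugacy of the subplane becomes the Frobenius map, and since \<open>\<Gamma>\<close> and its conjugates are
  complementary, \<open>GF q\<close>-points of the Bose space are triples \<open>(u, u ^ q, u ^ (q ^ 2))\<close>.  If
  \<open>a \<cdot> u = 0\<close> is the line at infinity, suitably scaled, the 6-space consists of the triples
  \<open>(u0, u1, u2)\<close> with \<open>a \<cdot> u0 = a ^ q \<cdot> u1 = a ^ (q ^ 2) \<cdot> u2\<close>.  A triple of multiples of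
  \<open>\<nu>(\<theta>)\<close> satisfies this iff it is proportional to \<open>(f1 f2 \<nu>, f2 f0 \<nu>, f0 f1 \<nu>)\<close>, where
  \<open>f0(\<theta>) = a \<cdot> \<nu>(\<theta>)\<close> and \<open>f1\<close>, \<open>f2\<close> are its conjugates; they have no common roots because two
  conjugates of the line at infinity meet only in the tangency point.  This curve has degree
  \<open>2 deg f0 + 2\<close>, which is 4 or 6 according as the tangency point is on the conic or not, and its
  points at infinity other than \<open>\<theta> = \<infinity>\<close> are given by the roots of \<open>f0 f1 f2\<close>.
\<close>

section \<open>Finite fields\<close>

text \<open>Nothing can be computed before the conic is parametrised, so a \<open>GF q\<close>-point
  on it is needed even when the tangency point is not one; Chevalley--Warning supplies it. The
  ambient order \<open>q ^ 6\<close> is chosen because that field is quadratic over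
  \<open>GF (q ^ 3)\<close> and so contains the roots of f0. The scaling of \<open>a\<close> is
  dictated by the 6-space: for a \<open>GF q\<close>-point of it off infinity, given by a triple
  starting with u, \<open>a\<close> is divided by its value at u, and its conjugates are then
  normalised with it. The obstacle is to show that the 5 or 7 coefficient vectors of the curve are
  independent. A relation among them is read as a linear functional on polynomials of degree at most
  4 or 6. It kills X^j times a product of two distinct conjugates of f0, for j at most 2. The three
  conjugates lie pairwise independent in the plane of forms vanishing at the tangency point, so
  their three mutual products span all products of two such forms, and these are killed too. If the
  tangency point is off the conic, the two factors are then stripped off one after the
  other.\<close>

lemma finite_field_pow_card:
  fixes x :: "'a :: {field, finite}"
  shows "x ^ CARD('a) = x"
proof (cases "x = 0")
  case False
  have "bij_betw ((*) x) (UNIV - {0}) (UNIV - {0})"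
    by (rule bij_betwI[where g = "\<lambda>y. y / x"]) (use False in auto)
  then have "\<Prod>(UNIV - {0}) = (\<Prod>y\<in>UNIV - {0}. x * y)"
    by (rule prod.reindex_bij_betw[symmetric])
  also have "\<dots> = x ^ (CARD('a) - 1) * \<Prod>(UNIV - {0})"
    by (simp add: prod.distrib card_Diff_singleton)
  finally have "x ^ (CARD('a) - 1) = 1"
    by simp
  then have "x ^ Suc (CARD('a) - 1) = x"
    by (simp only: power_Suc mult_1_right)
  then show ?thesis
    using finite_UNIV_card_ge_0[where 'a = 'a] by simp
qed (simp add: finite_UNIV_card_ge_0)

text \<open>Translation by 1 permutes the field, so the sum of all elements does not change when
  \<open>CARD('a)\<close> copies of 1 are added to it.\<close>

lemma CHAR_dvd_card:
  "CHAR('a :: {field, finite}) dvd CARD('a)"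
proof -
  have "(\<Sum>x\<in>UNIV. x) = (\<Sum>x\<in>UNIV. x + 1 :: 'a)"
    by (rule sum.reindex_bij_witness[of _ "\<lambda>x. x + 1" "\<lambda>x. x - 1"]) auto
  then have "of_nat CARD('a) = (0 :: 'a)"
    by (simp add: sum.distrib)
  then show ?thesis
    by (simp add: of_nat_eq_0_iff_char_dvd)
qed

lemma poly_X_pow_minus_X:
  fixes m :: nat
  assumes "m > 1"
  shows "degree (monom 1 m - monom 1 1 :: 'a::{field,finite} poly) = m"
    and "monom 1 m - monom 1 1 \<noteq> (0 :: 'a poly)"
proof -
  show "degree (monom 1 m - monom 1 1 :: 'a poly) = m"
    using assms degree_add_eq_left[of "- monom 1 1" "monom 1 m :: 'a poly"]
    by (simp add: degree_monom_eq)
  with assms show "monom 1 m - monom 1 1 \<noteq> (0 :: 'a poly)"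
    by auto
qed

text \<open>A divisor of \<open>X ^ CARD('a) - X\<close> inherits the property of having as many roots as its degree.\<close>

lemma card_GF:
  assumes "m > 1" and "m - 1 dvd CARD('a) - 1"
  shows "card (GF m :: 'a::{field,finite} set) = m"
proof -
  define N where "N = CARD('a)"
  have N: "N > 1"
    unfolding N_def by (metis One_nat_def card_1_singleton_iff finite_UNIV_card_ge_0 UNIV_I
        less_one linorder_neqE_nat nat_neq_iff not_less_zero singletonD zero_neq_one finite)
  obtain k where k: "N - 1 = (m - 1) * k"
    using assms(2) unfolding N_def by blast
  define P where "P n = (monom 1 n - monom 1 1 :: 'a poly)" for n
  \<comment> \<open>The quotient of X^(N - 1) - 1 by X^(m - 1) - 1, a geometric series because m - 1
    divides N - 1; it is the cofactor of \<open>P m\<close> in \<open>P N\<close>.\<close>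
  define R where "R = (\<Sum>i<k. monom 1 ((m - 1) * i) :: 'a poly)"
  have "R = (\<Sum>i<k. monom 1 (m - 1) ^ i)"
    by (simp add: R_def monom_power)
  then have "(monom 1 (m - 1) - 1) * R = monom 1 (m - 1) ^ k - (1 :: 'a poly)"
    by (simp only: power_diff_1_eq)
  then have "monom 1 1 * ((monom 1 (m - 1) - 1) * R) = monom 1 1 * (monom 1 (N - 1) - (1 :: 'a poly))"
    by (simp only: monom_power k power_one)
  moreover have "monom 1 1 * (monom 1 (n - 1) - 1) = P n" if "n > 1" for n
    using that by (simp add: P_def algebra_simps mult_monom)
  ultimately have eq: "P m * R = P N"
    using assms(1) N by (metis mult.assoc)
  have R: "R \<noteq> 0"
    using eq poly_X_pow_minus_X(2)[OF N] unfolding P_def by auto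
  have dR: "N = m + degree R"
    using eq degree_mult_eq[of "P m" R] R poly_X_pow_minus_X[OF N] poly_X_pow_minus_X[OF assms(1)]
    unfolding P_def by metis
  have "UNIV \<subseteq> {x. poly (P m) x = 0} \<union> {x. poly R x = 0}"
  proof
    fix x :: 'a
    have "poly (P N) x = 0"
      by (simp add: P_def poly_monom finite_field_pow_card N_def)
    then show "x \<in> {x. poly (P m) x = 0} \<union> {x. poly R x = 0}"
      unfolding eq[symmetric] by auto
  qed
  then have "N \<le> card ({x. poly (P m) x = 0} \<union> {x. poly R x = 0})"
    unfolding N_def by (rule card_mono[rotated]) simp
  also have "\<dots> \<le> card {x. poly (P m) x = 0} + card {x. poly R x = 0}"
    by (rule card_Un_le)
  finally have "m \<le> card {x. poly (P m) x = 0}"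
    using card_poly_roots_bound[OF R] dR by simp
  moreover have "card {x. poly (P m) x = 0} \<le> m"
    using card_poly_roots_bound[OF poly_X_pow_minus_X(2)[OF assms(1)]] poly_X_pow_minus_X(1)[OF assms(1)]
    unfolding P_def by metis
  moreover have "{x. poly (P m) x = 0} = GF m"
    by (auto simp: P_def poly_monom GF_def)
  ultimately show ?thesis
    by simp
qed

lemma quadratic_roots:
  fixes s n :: "'a::field"
  assumes "x * x - s * x + n = 0" and "y * y - s * y + n = 0"
  shows "y = x \<or> y = s - x"
proof -
  have "(y - x) * (y - (s - x)) = (y * y - s * y + n) - (x * x - s * x + n)"
    by (simp add: algebra_simps)
  with assms have "(y - x) * (y - (s - x)) = 0"
    by simp
  then show ?thesis
    by auto
qed

text \<open>
  The pairs \<open>(s, n)\<close> over the subfield give \<open>m ^ 2\<close> monic quadratics, of which \<open>m\<close> are squares of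
  linear polynomials.  Every element of the subfield is a root of \<open>m\<close> of them and every other
  element is a root of at least one, hence there are at least \<open>2 * m ^ 2 - m\<close> roots altogether and no
  quadratic can have fewer than its share.
\<close>

lemma quadratic_splits:
  fixes s n :: "'a::{field,finite}"
  assumes card: "CARD('a) = m ^ 2" and cm: "card (GF m :: 'a set) = m"
    and add: "\<And>x y :: 'a. (x + y) ^ m = x ^ m + y ^ m"
    and s: "s \<in> GF m" and n: "n \<in> GF m"
  shows "\<exists>x. x * x - s * x + n = 0"
proof (rule ccontr)
  assume no: "\<nexists>x. x * x - s * x + n = 0"
  define k where "k = (GF m :: 'a set)"
  define r where "r z = {x. x * x - fst z * x + snd z = 0}" for z :: "'a \<times> 'a"
  have cm': "card k = m"
    using cm by (simp add: k_def)
  have mm: "(x ^ m) ^ m = x" for x :: 'a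
    using finite_field_pow_card[of x] card by (simp add: power2_eq_square power_mult)
  have "(x - y :: 'a) ^ m + y ^ m = x ^ m" for x y
    by (subst add[symmetric]) simp
  then have diff: "(x - y :: 'a) ^ m = x ^ m - y ^ m" for x y
    by (metis add_diff_cancel_right')
  have kd: "x - y \<in> k" and kp: "x + y \<in> k" and km: "x * y \<in> k" if "x \<in> k" "y \<in> k" for x y
    using that by (auto simp: k_def GF_def add diff power_mult_distrib)
  have r2: "card (r z) \<le> 2" for z
  proof (cases "r z = {}")
    case False
    then obtain x where "x \<in> r z" by auto
    then have "r z \<subseteq> {x, fst z - x}"
      using quadratic_roots[of x "fst z" "snd z"] by (auto simp: r_def)
    then have "card (r z) \<le> card {x, fst z - x}"
      by (rule card_mono[rotated]) simp
    also have "\<dots> \<le> 2"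
      by (simp add: card_insert_le_m1)
    finally show ?thesis .
  qed simp
  \<comment> \<open>The squares (X - x)^2. Distinct \<open>x\<close> give distinct squares in
    characteristic 2 as well, where only the constant term separates them.\<close>
  define D where "D = (\<lambda>x. (x + x, x * x)) ` k"
  have "inj_on (\<lambda>x. (x + x, x * x)) k"
  proof
    fix x y :: 'a assume "(x + x, x * x) = (y + y, y * y)"
    then have "x + x = y + y" "x * x = y * y" by auto
    have "(x - y) * (x - y) = x * x - y * (x + x) + y * y"
      by (simp add: algebra_simps)
    also have "\<dots> = y * y - y * (y + y) + y * y"
      by (simp only: \<open>x + x = y + y\<close> \<open>x * x = y * y\<close>)
    also have "\<dots> = 0"
      by (simp add: algebra_simps)
    finally show "x = y" by simp
  qed
  then have cD: "card D = m"
    by (simp add: D_def card_image cm')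
  have rD: "card (r z) \<le> 1" if "z \<in> D" for z
  proof -
    obtain x where z: "z = (x + x, x * x)"
      using \<open>z \<in> D\<close> by (auto simp: D_def)
    have "y = x" if "y \<in> r z" for y
      using that quadratic_roots[of x "x + x" "x * x" y] by (auto simp: r_def z algebra_simps)
    then have "r z \<subseteq> {x}" by blast
    then show ?thesis
      using card_mono[of "{x}" "r z"] by simp
  qed
  define Z where "Z = (SIGMA z:k \<times> k. r z)"
  have "card Z = (\<Sum>z\<in>k \<times> k. card (r z))"
    unfolding Z_def by (rule card_SigmaI) auto
  also have "\<dots> = (\<Sum>z\<in>k \<times> k - {(s, n)}. card (r z))"
    using s n no by (subst sum.remove[of _ "(s, n)"]) (auto simp: k_def r_def)
  also have "\<dots> \<le> (\<Sum>z\<in>k \<times> k - {(s, n)}. if z \<in> D then 1 else 2)"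
    by (rule sum_mono) (use r2 rD in auto)
  \<comment> \<open>A quadratic without roots is not a square, so leaving it out lowers the bound by
    the full weight 2.\<close>
  also have "(s, n) \<notin> D"
  proof
    assume "(s, n) \<in> D"
    then obtain x where "s = x + x" "n = x * x" by (auto simp: D_def)
    then have "x * x - s * x + n = 0" by (simp add: algebra_simps)
    with no show False by blast
  qed
  then have "(\<Sum>z\<in>k \<times> k - {(s, n)}. if z \<in> D then 1 else 2 :: nat) + 2
      = (\<Sum>z\<in>k \<times> k. if z \<in> D then 1 else 2)"
    using s n by (subst (2) sum.remove[of _ "(s, n)"]) (auto simp: k_def)
  moreover have "(\<Sum>z\<in>k \<times> k. if z \<in> D then 1 else 2 :: nat) + m = 2 * (m * m)"
  proof -
    have "D \<subseteq> k \<times> k"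
      unfolding D_def using kp km by blast
    then have "(\<Sum>z\<in>k \<times> k. if z \<in> D then 1 else 2 :: nat) + (\<Sum>z\<in>k \<times> k. if z \<in> D then 1 else 0)
        = (\<Sum>z\<in>k \<times> k. 2)"
      unfolding sum.distrib[symmetric] by (intro sum.cong) auto
    moreover have "(\<Sum>z\<in>k \<times> k. if z \<in> D then 1 else 0 :: nat) = m"
      using \<open>D \<subseteq> k \<times> k\<close> cD by (simp add: sum.If_cases Int_absorb1)
    ultimately show ?thesis
      by (simp add: card_cartesian_product cm')
  qed
  ultimately have upper: "card Z + 2 + m \<le> 2 * (m * m)"
    by linarith
  \<comment> \<open>With a root \<open>x\<close> in the subfield, the trace \<open>y\<close> is free
    and determines the constant term; outside the subfield, the second root is taken to be the
    conjugate \<open>x ^ m\<close>.\<close>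
  define Z1 where "Z1 = (\<lambda>(x, y). ((y, y * x - x * x), x)) ` (k \<times> k)"
  define Z2 where "Z2 = (\<lambda>x. ((x + x ^ m, x * x ^ m), x)) ` (- k)"
  have "card Z1 = m * m"
    unfolding Z1_def by (subst card_image) (auto simp: inj_on_def card_cartesian_product cm')
  moreover have "card Z2 = m * m - m"
    unfolding Z2_def by (subst card_image)
      (auto simp: inj_on_def Compl_eq_Diff_UNIV card_Diff_subset cm' card power2_eq_square)
  moreover have "Z1 \<inter> Z2 = {}"
    by (auto simp: Z1_def Z2_def)
  moreover have "Z1 \<subseteq> Z" "Z2 \<subseteq> Z"
    by (auto simp: Z1_def Z2_def Z_def r_def kd km algebra_simps)
       (auto simp: k_def GF_def add power_mult_distrib mm algebra_simps)
  ultimately have "m * m + (m * m - m) \<le> card Z"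
    using card_Un_disjoint[of Z1 Z2] card_mono[of Z "Z1 \<union> Z2"] by simp
  with upper show False
    by simp
qed

section \<open>Points\<close>

abbreviation pt :: "'a::field ^ 'n \<Rightarrow> ('a ^ 'n) set" where
  "pt v \<equiv> vec.span {v}"

lemma mem_pt_iff: "w \<in> pt v \<longleftrightarrow> (\<exists>c. w = c *s v)"
  by (auto simp: vec.span_singleton)

lemma pt_scale: "c \<noteq> 0 \<Longrightarrow> pt (c *s v) = pt v"
  using vec.span_image_scale[of "{v}" "\<lambda>_. c"] by simp

lemma pt_eq_iff: "v \<noteq> 0 \<Longrightarrow> pt v = pt w \<longleftrightarrow> (\<exists>c. c \<noteq> 0 \<and> w = c *s v)"
proof
  assume "v \<noteq> 0" "pt v = pt w"
  then have "w \<in> pt v"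
    using vec.span_base[of w "{w}"] by simp
  then obtain c where c: "w = c *s v"
    by (auto simp: mem_pt_iff)
  have "c \<noteq> 0"
  proof
    assume "c = 0"
    then have "v \<in> pt 0"
      using c \<open>pt v = pt w\<close> vec.span_base[of v "{v}"] by simp
    with \<open>v \<noteq> 0\<close> show False
      by (simp add: mem_pt_iff)
  qed
  with c show "\<exists>c. c \<noteq> 0 \<and> w = c *s v" by blast
qed (auto simp: pt_scale)

lemma pt_subset_iff: "vec.subspace S \<Longrightarrow> pt v \<subseteq> S \<longleftrightarrow> v \<in> S"
  by (meson empty_subsetI insert_subset subset_trans vec.span_minimal vec.span_superset)

lemma mat_image_pt: "mat_image A (pt v) = pt (A *v v)"
proof -
  have "mat_image A (pt v) = (\<lambda>w. A *v w) ` range (\<lambda>c. c *s v)"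
    by (simp add: mat_image_def vec.span_singleton)
  also have "\<dots> = range (\<lambda>c. c *s (A *v v))"
    by (simp add: image_image vec.scale)
  finally show ?thesis
    by (simp add: vec.span_singleton)
qed

lemma PG_iff: "X \<in> PG K \<longleftrightarrow> (\<exists>v. v \<in> rational K \<and> v \<noteq> 0 \<and> X = pt v)"
  by (auto simp: PG_def)

lemma pspan_iff:
  "X \<in> pspan K S \<longleftrightarrow> (\<exists>v. v \<in> rational K \<and> v \<noteq> 0 \<and> X = pt v \<and> v \<in> vec.span (\<Union>S))"
  unfolding pspan_def PG_iff using pt_subset_iff[OF vec.subspace_span] by blast

definition nu :: "'a::field \<Rightarrow> 'a ^ 3" where
  "nu \<theta> = vector [1, \<theta>, \<theta> ^ 2]"

definition e3 :: "'a::field ^ 3" where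
  "e3 = vector [0, 0, 1]"

lemma nu_component [simp]: "nu \<theta> $ 1 = 1" "nu \<theta> $ 2 = \<theta>" "nu \<theta> $ 3 = \<theta> ^ 2"
  and e3_component [simp]: "e3 $ 1 = 0" "e3 $ 2 = 0" "e3 $ 3 = 1"
  by (simp_all add: nu_def e3_def)

lemma vec3_eq_iff: "v = w \<longleftrightarrow> v $ 1 = w $ 1 \<and> v $ 2 = w $ 2 \<and> v $ 3 = (w $ 3 :: 'a)"
  for v w :: "'a ^ 3"
  by (simp add: vec_eq_iff forall_3)

lemma rational3_iff: "v \<in> rational K \<longleftrightarrow> v $ 1 \<in> K \<and> v $ 2 \<in> K \<and> v $ 3 \<in> K"
  for v :: "'a::field ^ 3"
  by (simp add: rational_def forall_3)

lemma nu_nonzero [simp]: "nu \<theta> \<noteq> 0" and e3_nonzero [simp]: "e3 \<noteq> 0"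
  by (auto simp: vec3_eq_iff)

definition dot :: "'a::field ^ 3 \<Rightarrow> 'a ^ 3 \<Rightarrow> 'a" where
  "dot a u = a $ 1 * u $ 1 + a $ 2 * u $ 2 + a $ 3 * u $ 3"

lemma dot_linear [simp]:
  "dot a (u + v) = dot a u + dot a v" "dot a (u - v) = dot a u - dot a v"
  "dot a (c *s u) = c * dot a u" "dot (c *s a) u = c * dot a u" "dot a 0 = 0"
  "dot (a + b) u = dot a u + dot b u"
  by (simp_all add: dot_def algebra_simps)

definition cross :: "'a::field ^ 3 \<Rightarrow> 'a ^ 3 \<Rightarrow> 'a ^ 3" where
  "cross a b = vector [a $ 2 * b $ 3 - a $ 3 * b $ 2, a $ 3 * b $ 1 - a $ 1 * b $ 3,
     a $ 1 * b $ 2 - a $ 2 * b $ 1]"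

lemma cross_component [simp]:
  "cross a b $ 1 = a $ 2 * b $ 3 - a $ 3 * b $ 2"
  "cross a b $ 2 = a $ 3 * b $ 1 - a $ 1 * b $ 3"
  "cross a b $ 3 = a $ 1 * b $ 2 - a $ 2 * b $ 1"
  by (simp_all add: cross_def)

lemma dot_cross [simp]: "dot (cross a b) a = 0" "dot (cross a b) b = 0"
  "dot a (cross a b) = 0" "dot b (cross a b) = 0"
  by (simp_all add: dot_def algebra_simps)

lemma cross_eq_0_imp:
  assumes "cross a b = 0" "a \<noteq> 0"
  shows "\<exists>c. b = c *s a"
proof -
  have e: "a $ 2 * b $ 3 = a $ 3 * b $ 2" "a $ 3 * b $ 1 = a $ 1 * b $ 3"
    "a $ 1 * b $ 2 = a $ 2 * b $ 1"
    using assms(1) by (simp_all add: vec3_eq_iff)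
  consider "a $ 1 \<noteq> 0" | "a $ 2 \<noteq> 0" | "a $ 3 \<noteq> 0"
    using assms(2) by (auto simp: vec3_eq_iff)
  then show ?thesis
  proof cases
    case 1
    with e show ?thesis
      by (intro exI[of _ "b $ 1 / a $ 1"]) (simp add: vec3_eq_iff field_simps)
  next
    case 2
    with e show ?thesis
      by (intro exI[of _ "b $ 2 / a $ 2"]) (simp add: vec3_eq_iff field_simps)
  next
    case 3
    with e show ?thesis
      by (intro exI[of _ "b $ 3 / a $ 3"]) (simp add: vec3_eq_iff field_simps)
  qed
qed

lemma dot_cross_eq_0_imp:
  assumes "cross a b \<noteq> 0" "dot (cross a b) p = 0"
  shows "\<exists>x y. p = x *s a + y *s b"
proof -
  let ?n = "cross a b"
  have n: "?n $ 1 * p $ 1 + ?n $ 2 * p $ 2 + ?n $ 3 * p $ 3 = 0"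
    using assms(2) by (simp add: dot_def)
  consider "?n $ 1 \<noteq> 0" | "?n $ 2 \<noteq> 0" | "?n $ 3 \<noteq> 0"
    using assms(1) by (auto simp: vec3_eq_iff)
  then show ?thesis
  proof cases
    case 1
    \<comment> \<open>Cramer's rule in the second and third coordinates, whose minor is
      \<open>?n $ 1\<close>; the other cases rotate the indices.\<close>
    have "?n $ 1 *s p = (p $ 2 * b $ 3 - p $ 3 * b $ 2) *s a + (a $ 2 * p $ 3 - a $ 3 * p $ 2) *s b"
      using n by (simp add: vec3_eq_iff) algebra
    then have "p = (1 / ?n $ 1) *s ((p $ 2 * b $ 3 - p $ 3 * b $ 2) *s a + (a $ 2 * p $ 3 - a $ 3 * p $ 2) *s b)"
      using 1 by (metis divide_self_if one_divide_eq_0_iff times_divide_eq_left mult_1 vec.scale_one vec.scale_scale)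
    then show ?thesis
      by (metis vec.scale_right_distrib vec.scale_scale)
  next
    case 2
    have "?n $ 2 *s p = (p $ 3 * b $ 1 - p $ 1 * b $ 3) *s a + (a $ 3 * p $ 1 - a $ 1 * p $ 3) *s b"
      using n by (simp add: vec3_eq_iff) algebra
    then have "p = (1 / ?n $ 2) *s ((p $ 3 * b $ 1 - p $ 1 * b $ 3) *s a + (a $ 3 * p $ 1 - a $ 1 * p $ 3) *s b)"
      using 2 by (metis divide_self_if one_divide_eq_0_iff times_divide_eq_left mult_1 vec.scale_one vec.scale_scale)
    then show ?thesis
      by (metis vec.scale_right_distrib vec.scale_scale)
  next
    case 3
    have "?n $ 3 *s p = (p $ 1 * b $ 2 - p $ 2 * b $ 1) *s a + (a $ 1 * p $ 2 - a $ 2 * p $ 1) *s b"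
      using n by (simp add: vec3_eq_iff) algebra
    then have "p = (1 / ?n $ 3) *s ((p $ 1 * b $ 2 - p $ 2 * b $ 1) *s a + (a $ 1 * p $ 2 - a $ 2 * p $ 1) *s b)"
      using 3 by (metis divide_self_if one_divide_eq_0_iff times_divide_eq_left mult_1 vec.scale_one vec.scale_scale)
    then show ?thesis
      by (metis vec.scale_right_distrib vec.scale_scale)
  qed
qed

text \<open>By the triple product identity, \<open>cross (cross a b) v\<close> is a combination of
  \<open>a\<close> and \<open>b\<close> with coefficients \<open>dot b v\<close> and
  \<open>dot a v\<close> up to sign.\<close>

lemma orthogonal_imp_cross:
  assumes "cross a b \<noteq> 0" "dot a v = 0" "dot b v = 0"
  shows "\<exists>c. v = c *s cross a b"
proof (rule cross_eq_0_imp[OF _ assms(1)])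
  have v: "a $ 1 * v $ 1 + a $ 2 * v $ 2 + a $ 3 * v $ 3 = 0"
    "b $ 1 * v $ 1 + b $ 2 * v $ 2 + b $ 3 * v $ 3 = 0"
    using assms by (simp_all add: dot_def)
  show "cross (cross a b) v = 0"
    using v by (simp add: vec3_eq_iff) algebra
qed

section \<open>Conics\<close>

definition polar_form :: "'a::field ^ 3 ^ 3 \<Rightarrow> 'a ^ 3 \<Rightarrow> 'a ^ 3 \<Rightarrow> 'a" where
  "polar_form M v w = (\<Sum>i\<in>UNIV. \<Sum>j\<in>UNIV. M $ i $ j * (v $ i * w $ j + w $ i * v $ j))"

lemma quad_form_add: "quad_form M (v + w) = quad_form M v + quad_form M w + polar_form M v w"
  by (simp add: quad_form_def polar_form_def sum_3 algebra_simps)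

lemma quad_form_scale: "quad_form M (c *s v) = c ^ 2 * quad_form M v"
  by (simp add: quad_form_def sum_3 power2_eq_square algebra_simps)

lemma polar_form_linear [simp]:
  "polar_form M v (w + x) = polar_form M v w + polar_form M v x" "polar_form M v (w - x) = polar_form M v w - polar_form M v x"
  "polar_form M v (c *s w) = c * polar_form M v w"
  "polar_form M (v + x) w = polar_form M v w + polar_form M x w" "polar_form M (v - x) w = polar_form M v w - polar_form M x w"
  "polar_form M (c *s v) w = c * polar_form M v w"
  by (simp_all add: polar_form_def sum_3 algebra_simps)

lemma polar_form_commute: "polar_form M v w = polar_form M w v"
  by (simp add: polar_form_def sum_3 algebra_simps)

lemma polar_form_self: "polar_form M v v = 2 * quad_form M v"
  by (simp add: quad_form_def polar_form_def sum_3 algebra_simps)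

section \<open>Frobenius powers and subfields in a field of order q ^ 6\<close>

locale frobenius_field =
  fixes q :: nat and ty :: "'a::{field,finite} itself"
  assumes primepow: "primepow q" and card_univ: "CARD('a) = q ^ 6"
begin

text \<open>The exponents of the Frobenius maps over \<open>GF q\<close>. One predicate serves both
  the conjugations and the subfields \<open>GF q\<close>, \<open>GF (q ^ 3)\<close> and
  \<open>GF (q ^ 6)\<close>.\<close>

definition fexp :: "nat \<Rightarrow> bool" where
  "fexp m \<longleftrightarrow> (\<exists>k. m = q ^ k)"

lemma fexp [simp]: "fexp (q ^ k)" "fexp q" "fexp 1" "fexp (Suc 0)"
  unfolding fexp_def by (blast, metis power_one_right, metis power_0, metis power_0 One_nat_def)

lemma q_gt_1: "q > 1"
  using primepow by (metis One_nat_def primepow_gt_Suc_0)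

lemma fexp_pos [simp]: "fexp m \<Longrightarrow> m > 0"
  using q_gt_1 by (auto simp: fexp_def)

lemma CHAR_pow: "\<exists>n. q = CHAR('a) ^ n" and prime_CHAR: "prime CHAR('a)"
proof -
  have pos: "CHAR('a) > 0"
    by (rule finite_imp_CHAR_pos) simp
  then show pr: "prime CHAR('a)"
    by (rule prime_CHAR_semidom)
  obtain p n where p: "prime p" "q = p ^ n" "n > 0"
    using primepow by (auto simp: primepow_def)
  have "CHAR('a) dvd p"
    using CHAR_dvd_card[where 'a = 'a] card_univ p pr prime_dvd_power by metis
  then have "CHAR('a) = p"
    using p(1) pr primes_dvd_imp_eq by blast
  with p show "\<exists>n. q = CHAR('a) ^ n" by blast
qed

lemma fexp_CHAR: "fexp m \<Longrightarrow> \<exists>n. m = CHAR('a) ^ n"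
  using CHAR_pow by (auto simp: fexp_def power_mult[symmetric])

lemma frob_add: "fexp m \<Longrightarrow> (x + y :: 'a) ^ m = x ^ m + y ^ m"
  using fexp_CHAR freshmans_dream'[OF prime_CHAR] by blast

lemma frob_sum: "fexp m \<Longrightarrow> (sum f A :: 'a) ^ m = (\<Sum>i\<in>A. f i ^ m)"
  using fexp_CHAR freshmans_dream_sum'[OF prime_CHAR] by blast

lemma frob_diff: "fexp m \<Longrightarrow> (x - y :: 'a) ^ m = x ^ m - y ^ m"
  using frob_add[of m "x - y" y] by (simp add: algebra_simps)

lemma frob_minus: "fexp m \<Longrightarrow> (- y :: 'a) ^ m = - (y ^ m)"
  using frob_diff[of m 0 y] by (simp add: power_0_left)

lemma frob_inj: "fexp m \<Longrightarrow> (x :: 'a) ^ m = y ^ m \<longleftrightarrow> x = y"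
  using frob_diff[of m x y] by auto

lemma frob_surj: "fexp m \<Longrightarrow> \<exists>y :: 'a. x = y ^ m"
proof -
  assume "fexp m"
  then have "inj (\<lambda>y :: 'a. y ^ m)"
    by (auto simp: inj_def frob_inj)
  then have "surj (\<lambda>y :: 'a. y ^ m)"
    by (simp add: finite_UNIV_inj_surj)
  then show ?thesis by blast
qed

lemma pow_q6 [simp]: "(x :: 'a) ^ (q ^ 6) = x"
  using finite_field_pow_card[of x] card_univ by simp

lemma GF_q6 [simp]: "GF (q ^ 6) = (UNIV :: 'a set)"
  by (auto simp: GF_def)

lemma GF_closed:
  assumes "fexp m" "x \<in> GF m" "y \<in> GF m"
  shows "x + y \<in> (GF m :: 'a set)" "x - y \<in> GF m" "x * y \<in> GF m" "x / y \<in> GF m"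
  using assms by (auto simp: GF_def frob_add frob_diff power_mult_distrib power_divide)

lemma GF_minus: "fexp m \<Longrightarrow> x \<in> GF m \<Longrightarrow> - x \<in> (GF m :: 'a set)"
  by (auto simp: GF_def frob_minus)

lemma GF_power: "x \<in> GF m \<Longrightarrow> x ^ n \<in> (GF m :: 'a set)"
  by (auto simp: GF_def power_commutes simp flip: power_mult) (metis mult.commute power_mult)

lemma GF_01 [simp]: "fexp m \<Longrightarrow> 0 \<in> (GF m :: 'a set)" "1 \<in> (GF m :: 'a set)"
  by (auto simp: GF_def power_0_left dest: fexp_pos)

lemma GF_sum: "fexp m \<Longrightarrow> (\<And>i. i \<in> A \<Longrightarrow> f i \<in> GF m) \<Longrightarrow> sum f A \<in> (GF m :: 'a set)"
  by (simp add: GF_def frob_sum)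

lemma GF_mono:
  assumes "x \<in> GF q" "fexp m"
  shows "x \<in> (GF m :: 'a set)"
proof -
  obtain k where "m = q ^ k" using assms(2) by (auto simp: fexp_def)
  have "x ^ (q ^ k) = x"
    using assms(1) by (induction k) (auto simp: GF_def power_mult)
  with \<open>m = q ^ k\<close> show ?thesis by (simp add: GF_def)
qed

lemma card_GF_q: "card (GF q :: 'a set) = q" and card_GF_q3: "card (GF (q ^ 3) :: 'a set) = q ^ 3"
proof -
  have d: "x - 1 dvd x ^ k - (1 :: nat)" if "x > 0" for x k
  proof -
    have "int x - 1 dvd int x ^ k - 1"
      by (simp add: power_diff_1_eq)
    then have "int (x - 1) dvd int (x ^ k - 1)"
      using that by (simp add: of_nat_diff)
    then show ?thesis
      by (simp only: int_dvd_int_iff)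
  qed
  show "card (GF q :: 'a set) = q"
    by (rule card_GF) (use q_gt_1 card_univ d[of q 6] in auto)
  have "q ^ 3 > 1"
    using q_gt_1 one_less_power[of q 3] by simp
  moreover have "q ^ 3 - 1 dvd CARD('a) - 1"
    using d[of "q ^ 3" 2] q_gt_1 by (simp add: card_univ power_mult[symmetric])
  ultimately show "card (GF (q ^ 3) :: 'a set) = q ^ 3"
    by (rule card_GF)
qed

text \<open>The ambient field is quadratic over \<open>GF (q ^ 3)\<close>. The relations are those
  of Vieta for a + b X + c X^2, multiplied by \<open>c\<close>, as the later factorisation of this
  polynomial uses them.\<close>

lemma quadratic_root:
  assumes "a \<in> GF (q ^ 3)" "b \<in> GF (q ^ 3)" "c \<in> GF (q ^ 3)" "c \<noteq> (0 :: 'a)"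
  shows "\<exists>x y. c * (x + y) = - b \<and> c * (x * y) = a"
proof -
  have "\<exists>x. x * x - (- b / c) * x + a / c = 0"
    by (rule quadratic_splits[where m = "q ^ 3"])
      (use assms in \<open>auto simp: card_univ card_GF_q3 frob_add GF_closed GF_minus
        simp flip: power_mult\<close>)
  then obtain x where "x * x - (- b / c) * x + a / c = 0" ..
  then have "c * (x + (- b / c - x)) = - b \<and> c * (x * (- b / c - x)) = a"
    using assms(4) by (simp add: field_simps) algebra
  then show ?thesis by blast
qed

subsection \<open>Existence of points on a conic\<close>

text \<open>For i > 0, X^i - 1 has too few roots to vanish on all nonzero elements; substituting g x
  with g^i different from 1 multiplies the sum by g^i. For i = 0 the convention 0^0 = 1 matters: the
  sum is then q times 1, which is 0.\<close>

lemma sum_powers_GF: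
  assumes "i < q - 1"
  shows "(\<Sum>x\<in>GF q. x ^ i) = (0 :: 'a)"
proof (cases "i = 0")
  case True
  obtain n where n: "q = CHAR('a) ^ n" using CHAR_pow ..
  have "n \<noteq> 0" using n q_gt_1 by (cases n) auto
  then have "of_nat q = (0 :: 'a)"
    by (simp add: n power_0_left)
  with True show ?thesis
    by (simp add: card_GF_q)
next
  case False
  define P where "P = (monom 1 i - 1 :: 'a poly)"
  have dP: "degree P = i"
    unfolding P_def using False degree_add_eq_left[of "- 1" "monom 1 i :: 'a poly"]
    by (simp add: degree_monom_eq)
  then have "P \<noteq> 0"
    using False by auto
  then have "card {x. poly P x = 0} \<le> i"
    using card_poly_roots_bound[of P] dP by simp
  then have "\<not> GF q - {0} \<subseteq> {x. poly P x = 0}"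
    using assms card_mono[of "{x. poly P x = 0}" "GF q - {0}"] by (auto simp: card_GF_q)
  then obtain g where "g \<in> GF q - {0}" "g \<notin> {x. poly P x = 0}" by blast
  then have g: "g \<in> GF q" "g \<noteq> 0" "g ^ i \<noteq> 1"
    by (auto simp: P_def poly_monom)
  have "(\<Sum>x\<in>GF q. x ^ i) = (\<Sum>x\<in>GF q. (g * x) ^ i)"
    by (rule sum.reindex_bij_witness[of _ "\<lambda>x. g * x" "\<lambda>x. x / g"])
      (use g GF_closed[of q] in auto)
  also have "\<dots> = g ^ i * (\<Sum>x\<in>GF q. x ^ i)"
    by (simp add: power_mult_distrib sum_distrib_left)
  finally have "(1 - g ^ i) * (\<Sum>x\<in>GF q. x ^ i) = 0"
    by (simp add: algebra_simps)
  with g show ?thesis by simp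
qed

text \<open>The monomial in front carries the induction: expanding one factor of the form raises its
  degree by 2. When no factor is left, a total degree below 3 (q - 1) forces one exponent below q -
  1, and that sum vanishes.\<close>

lemma sum_monomial_quad_form:
  assumes "i + j + k + 2 * n < 3 * (q - 1)"
  shows "(\<Sum>x\<in>GF q. \<Sum>y\<in>GF q. \<Sum>z\<in>GF q.
    x ^ i * y ^ j * z ^ k * quad_form M (vector [x, y, z]) ^ n) = (0 :: 'a)"
  using assms
proof (induction n arbitrary: i j k)
  case 0
  have "(\<Sum>x\<in>GF q. \<Sum>y\<in>GF q. \<Sum>z\<in>GF q. x ^ i * y ^ j * z ^ k :: 'a)
      = (\<Sum>x\<in>GF q. x ^ i) * ((\<Sum>y\<in>GF q. y ^ j) * (\<Sum>z\<in>GF q. z ^ k))"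
    by (simp only: mult.assoc sum_distrib_left[symmetric] sum_distrib_right[symmetric])
  moreover have "i < q - 1 \<or> j < q - 1 \<or> k < q - 1"
    using 0 by linarith
  ultimately show ?case
    using sum_powers_GF by auto
next
  case (Suc n)
  let ?S = "\<lambda>i j k. \<Sum>x\<in>GF q. \<Sum>y\<in>GF q. \<Sum>z\<in>GF q.
    x ^ i * y ^ j * z ^ k * quad_form M (vector [x, y, z]) ^ n :: 'a"
  have "x ^ i * y ^ j * z ^ k * quad_form M (vector [x, y, z]) ^ Suc n =
      M $ 1 $ 1 * (x ^ (i + 2) * y ^ j * z ^ k * quad_form M (vector [x, y, z]) ^ n)
    + M $ 2 $ 2 * (x ^ i * y ^ (j + 2) * z ^ k * quad_form M (vector [x, y, z]) ^ n)
    + M $ 3 $ 3 * (x ^ i * y ^ j * z ^ (k + 2) * quad_form M (vector [x, y, z]) ^ n)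
    + (M $ 1 $ 2 + M $ 2 $ 1) * (x ^ (i + 1) * y ^ (j + 1) * z ^ k * quad_form M (vector [x, y, z]) ^ n)
    + (M $ 1 $ 3 + M $ 3 $ 1) * (x ^ (i + 1) * y ^ j * z ^ (k + 1) * quad_form M (vector [x, y, z]) ^ n)
    + (M $ 2 $ 3 + M $ 3 $ 2) * (x ^ i * y ^ (j + 1) * z ^ (k + 1) * quad_form M (vector [x, y, z]) ^ n)"
    for x y z
  proof -
    have "quad_form M (vector [x, y, z]) = M $ 1 $ 1 * x ^ 2 + M $ 2 $ 2 * y ^ 2 + M $ 3 $ 3 * z ^ 2
      + (M $ 1 $ 2 + M $ 2 $ 1) * (x * y) + (M $ 1 $ 3 + M $ 3 $ 1) * (x * z)
      + (M $ 2 $ 3 + M $ 3 $ 2) * (y * z)"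
      by (simp add: quad_form_def sum_3 power2_eq_square algebra_simps)
    moreover have "x ^ i * y ^ j * z ^ k * (m11 * x ^ 2 + m22 * y ^ 2 + m33 * z ^ 2
        + m12 * (x * y) + m13 * (x * z) + m23 * (y * z)) * P =
      m11 * (x ^ (i + 2) * y ^ j * z ^ k * P) + m22 * (x ^ i * y ^ (j + 2) * z ^ k * P)
      + m33 * (x ^ i * y ^ j * z ^ (k + 2) * P) + m12 * (x ^ (i + 1) * y ^ (j + 1) * z ^ k * P)
      + m13 * (x ^ (i + 1) * y ^ j * z ^ (k + 1) * P) + m23 * (x ^ i * y ^ (j + 1) * z ^ (k + 1) * P)"
      for m11 m22 m33 m12 m13 m23 P
      by (simp add: power_add power2_eq_square algebra_simps)
    ultimately show ?thesis
      by (metis (no_types, lifting) mult.assoc power_Suc)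
  qed
  then have "(\<Sum>x\<in>GF q. \<Sum>y\<in>GF q. \<Sum>z\<in>GF q.
      x ^ i * y ^ j * z ^ k * quad_form M (vector [x, y, z]) ^ Suc n) =
      M $ 1 $ 1 * ?S (i + 2) j k + M $ 2 $ 2 * ?S i (j + 2) k + M $ 3 $ 3 * ?S i j (k + 2)
    + (M $ 1 $ 2 + M $ 2 $ 1) * ?S (i + 1) (j + 1) k + (M $ 1 $ 3 + M $ 3 $ 1) * ?S (i + 1) j (k + 1)
    + (M $ 2 $ 3 + M $ 3 $ 2) * ?S i (j + 1) (k + 1)"
    by (simp only: sum.distrib sum_distrib_left)
  also have "\<dots> = 0"
  proof -
    have IH: "?S a b c = 0" if "a + b + c = i + j + k + 2" for a b c
      by (rule Suc.IH) (use that Suc.prems in simp)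
    have "?S (i + 2) j k = 0" "?S i (j + 2) k = 0" "?S i j (k + 2) = 0" "?S (i + 1) (j + 1) k = 0"
      "?S (i + 1) j (k + 1) = 0" "?S i (j + 1) (k + 1) = 0"
      by (rule IH, simp)+
    then show ?thesis by simp
  qed
  finally show ?case .
qed

text \<open>
  Chevalley--Warning: the sum of \<open>Q ^ (q - 1)\<close> over the whole space vanishes for reasons of degree,
  but it would be \<open>- 1\<close> if \<open>Q\<close> had no non-trivial zero.
\<close>

lemma quad_form_isotropic:
  assumes M: "M \<in> rational_mat (GF q)"
  shows "\<exists>v \<in> rational (GF q). v \<noteq> 0 \<and> quad_form M v = (0 :: 'a)"
proof (rule ccontr)
  assume no: "\<not> ?thesis"
  \<comment> \<open>The indicator of 0. Without a nontrivial zero, the power \<open>q - 1\<close> of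
    the form is 0 at the origin and 1 elsewhere; written with \<open>d\<close>, it can be summed one
    coordinate at a time.\<close>
  define d where "d x = (if x = 0 then 1 else 0 :: 'a)" for x :: 'a
  have one: "quad_form M (vector [x, y, z]) ^ (q - 1) = 1 - d x * (d y * d z)"
    if "x \<in> GF q" "y \<in> GF q" "z \<in> GF q" for x y z
  proof (cases "x = 0 \<and> y = 0 \<and> z = 0")
    case True
    then show ?thesis
      using q_gt_1 by (simp add: d_def quad_form_def sum_3)
  next
    case False
    let ?Q = "quad_form M (vector [x, y, z])"
    have "vector [x, y, z] \<in> (rational (GF q) :: ('a ^ 3) set)" "vector [x, y, z] \<noteq> (0 :: 'a ^ 3)"
      using that False by (auto simp: rational3_iff vec3_eq_iff)
    with no have "?Q \<noteq> 0" by blast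
    moreover have "?Q \<in> GF q"
      unfolding quad_form_def using M \<open>vector [x, y, z] \<in> (rational (GF q) :: ('a ^ 3) set)\<close>
      by (intro GF_sum GF_closed) (auto simp: rational_mat_def rational_def)
    then have "?Q * ?Q ^ (q - 1) = ?Q * 1"
      using q_gt_1 by (simp add: GF_def flip: power_Suc)
    ultimately show ?thesis
      using False by (auto simp: d_def)
  qed
  have "(\<Sum>x\<in>GF q. \<Sum>y\<in>GF q. \<Sum>z\<in>GF q. quad_form M (vector [x, y, z]) ^ (q - 1)) = (0 :: 'a)"
    using sum_monomial_quad_form[of 0 0 0 "q - 1" M] q_gt_1 by simp
  also have "(\<Sum>x\<in>GF q. \<Sum>y\<in>GF q. \<Sum>z\<in>GF q. quad_form M (vector [x, y, z]) ^ (q - 1))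
      = (\<Sum>x\<in>GF q. \<Sum>y\<in>GF q. \<Sum>z\<in>GF q. 1 - d x * (d y * d z))"
    by (intro sum.cong refl one)
  also have "\<dots> = (\<Sum>x\<in>(GF q :: 'a set). \<Sum>y\<in>(GF q :: 'a set). \<Sum>z\<in>(GF q :: 'a set). 1)
      - (\<Sum>x\<in>GF q. d x) * ((\<Sum>y\<in>GF q. d y) * (\<Sum>z\<in>GF q. d z))"
    by (simp only: sum_subtractf sum_distrib_left[symmetric] sum_distrib_right[symmetric])
  also have "(\<Sum>x\<in>GF q. d x) = 1"
    by (simp add: d_def)
  also have "(\<Sum>z\<in>(GF q :: 'a set). 1) = (0 :: 'a)"
    using sum_powers_GF[of 0] q_gt_1 by simp
  finally show False by simp
qed

end

section \<open>Frobenius action on vectors and matrices, and the standard conic\<close>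

definition frob_vec :: "nat \<Rightarrow> 'a::field ^ 'n \<Rightarrow> 'a ^ 'n" where
  "frob_vec m v = (\<chi> i. v $ i ^ m)"

definition frob_mat :: "nat \<Rightarrow> 'a::field ^ 'm ^ 'n \<Rightarrow> 'a ^ 'm ^ 'n" where
  "frob_mat m A = (\<chi> i j. A $ i $ j ^ m)"

definition std_conic :: "'a::field set \<Rightarrow> ('a ^ 3) set set" where
  "std_conic K = (\<lambda>\<theta>. pt (nu \<theta>)) ` K \<union> {pt e3}"

definition cols :: "'a::field ^ 'n \<Rightarrow> 'a ^ 'n \<Rightarrow> 'a ^ 'n \<Rightarrow> 'a ^ 3 ^ 'n" where
  "cols a b c = (\<chi> i. vector [a $ i, b $ i, c $ i])"

lemma cols_mult: "cols a b c *v y = y $ 1 *s a + y $ 2 *s b + y $ 3 *s c"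
  by (simp add: cols_def matrix_vector_mult_def vec_eq_iff sum_3 mult.commute)

lemma frob_vec_component [simp]: "frob_vec m v $ i = v $ i ^ m"
  by (simp add: frob_vec_def)

text \<open>As a fixed-point equation, rationality passes through every operation that commutes with
  Frobenius.\<close>

lemma rational_iff_frob_vec: "v \<in> rational (GF m) \<longleftrightarrow> frob_vec m v = v"
  by (simp add: rational_def GF_def frob_vec_def vec_eq_iff)

lemma rational_mat_iff_frob_mat: "A \<in> rational_mat (GF m) \<longleftrightarrow> frob_mat m A = A"
  by (simp add: rational_mat_def GF_def frob_mat_def vec_eq_iff)

lemma frob_vec_frob_vec: "frob_vec m (frob_vec n v) = frob_vec (m * n) v"
  by (simp add: vec_eq_iff power_mult mult.commute[of m])

lemma frob_mat_frob_mat: "frob_mat m (frob_mat n A) = frob_mat (m * n) A"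
  by (simp add: frob_mat_def vec_eq_iff power_mult mult.commute[of m])

lemma frob_vec_scale: "frob_vec m (c *s v) = (c ^ m) *s frob_vec m v"
  by (simp add: vec_eq_iff power_mult_distrib)

lemma inj_matI:
  assumes "invertible A" "A *v x = A *v y"
  shows "x = (y :: 'a::field ^ 'n)"
  using assms by (metis inj_eq inj_matrix_vector_mult)

lemma surj_matE:
  fixes A :: "'a::field ^ 'n ^ 'n"
  assumes "invertible A"
  obtains x where "y = A *v x"
proof -
  obtain A' where "A ** A' = mat 1"
    using assms by (auto simp: invertible_def)
  then have "y = A *v (A' *v y)"
    by (simp add: matrix_vector_mul_assoc)
  then show thesis by (rule that)
qed

lemma matrix_mult_axis: "(A *v axis j 1) $ i = (A $ i $ j :: 'a::field)"
  by (simp add: matrix_vector_mult_def axis_def if_distrib cong: if_cong)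

lemma basis3:
  assumes "dot (cross a b) c \<noteq> 0"
  shows "\<exists>x y z. v = x *s a + y *s b + z *s c"
proof -
  let ?n = "cross a b"
  let ?z = "dot ?n v / dot ?n c"
  have "?n \<noteq> 0"
    using assms by (auto simp: dot_def vec3_eq_iff)
  moreover have "dot ?n (v - ?z *s c) = 0"
    using assms by simp
  ultimately obtain x y where "v - ?z *s c = x *s a + y *s b"
    using dot_cross_eq_0_imp by blast
  then have "v = x *s a + y *s b + ?z *s c"
    by (simp add: algebra_simps)
  then show ?thesis by blast
qed

lemma invertible_cols:
  assumes "dot (cross a b) c \<noteq> (0 :: 'a::field)"
  shows "invertible (cols a b c)"
proof -
  have "y = 0" if "cols a b c *v y = 0" for y
  proof -
    have z: "y $ 1 *s a + y $ 2 *s b + y $ 3 *s c = 0"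
      using that by (simp add: cols_mult)
    \<comment> \<open>The three cross products are, up to the common determinant, the basis dual to
      the columns, so pairing with them isolates the coordinates of \<open>y\<close>.\<close>
    have d: "dot w (y $ 1 *s a + y $ 2 *s b + y $ 3 *s c) = 0" for w
      unfolding z by simp
    have cyc: "dot (cross b c) a = dot (cross a b) c" "dot (cross c a) b = dot (cross a b) c"
      by (simp_all add: dot_def algebra_simps)
    show ?thesis
      using d[of "cross a b"] d[of "cross b c"] d[of "cross c a"] assms
      by (simp add: vec3_eq_iff cyc)
  qed
  then show ?thesis
    unfolding invertible_left_inverse matrix_left_invertible_ker by blast
qed

context frobenius_field
begin

lemma frob_vec_add: "fexp m \<Longrightarrow> frob_vec m (v + w) = frob_vec m v + frob_vec m (w :: 'a ^ 'n)"
  by (simp add: vec_eq_iff frob_add)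

lemma frob_vec_mult: "fexp m \<Longrightarrow> frob_vec m (A *v v) = frob_mat m A *v frob_vec m (v :: 'a ^ 'n)"
  by (simp add: vec_eq_iff matrix_vector_mult_def frob_mat_def frob_sum power_mult_distrib)

lemma frob_vec_eq_0_iff: "fexp m \<Longrightarrow> frob_vec m v = 0 \<longleftrightarrow> v = (0 :: 'a ^ 'n)"
  by (simp add: vec_eq_iff)

text \<open>The scalars c^m run through the whole field, so the semilinear image of a point is again
  a full one-dimensional subspace.\<close>

lemma frob_pt: "fexp m \<Longrightarrow> frob m (pt v) = pt (frob_vec m (v :: 'a ^ 'n))"
proof -
  assume m: "fexp m"
  have "frob m (pt v) = frob_vec m ` range (\<lambda>c. c *s v)"
    by (simp add: frob_def frob_vec_def[abs_def] vec.span_singleton)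
  also have "\<dots> = (\<lambda>c. c *s frob_vec m v) ` range (\<lambda>c. c ^ m)"
    by (simp add: image_image frob_vec_scale)
  also have "range (\<lambda>c :: 'a. c ^ m) = UNIV"
    using frob_surj[OF m] by blast
  finally show ?thesis
    by (simp add: vec.span_singleton)
qed

lemma rational_closed:
  assumes "fexp m" "v \<in> rational (GF m)"
  shows "w \<in> rational (GF m) \<Longrightarrow> v + w \<in> rational (GF m)"
    and "w \<in> rational (GF m) \<Longrightarrow> v - w \<in> rational (GF m)"
    and "c \<in> (GF m :: 'a set) \<Longrightarrow> c *s v \<in> rational (GF m)"
  using assms by (simp_all add: rational_def GF_closed)

lemma rational_mult:
  assumes "fexp m" "A \<in> rational_mat (GF m)" "v \<in> rational (GF m)"
  shows "A *v v \<in> rational (GF m :: 'a set)"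
  using assms by (simp add: rational_iff_frob_vec rational_mat_iff_frob_mat frob_vec_mult)

lemma rational_mult_iff:
  assumes "fexp m" "A \<in> rational_mat (GF m)" "invertible A"
  shows "A *v v \<in> rational (GF m :: 'a set) \<longleftrightarrow> v \<in> rational (GF m)"
  using assms rational_mult[of m A v] inj_matI[of A "frob_vec m v" v]
  by (auto simp: rational_iff_frob_vec rational_mat_iff_frob_mat frob_vec_mult)

lemma rational_mono:
  assumes "fexp m" "v \<in> rational (GF q)"
  shows "v \<in> rational (GF m :: 'a set)"
  using assms GF_mono by (auto simp: rational_def)

lemma rational_std [simp]:
  "fexp m \<Longrightarrow> e3 \<in> rational (GF m :: 'a set)"
  "\<theta> \<in> GF m \<Longrightarrow> fexp m \<Longrightarrow> nu \<theta> \<in> rational (GF m :: 'a set)"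
  by (auto simp: rational3_iff GF_power)

lemma std_conic_iff:
  assumes "fexp m" "y \<in> rational (GF m :: 'a set)" "y \<noteq> 0"
  shows "pt y \<in> std_conic (GF m) \<longleftrightarrow> y $ 2 ^ 2 = y $ 1 * y $ 3"
proof
  assume "pt y \<in> std_conic (GF m)"
  then consider \<theta> where "pt y = pt (nu \<theta>)" | "pt y = pt e3"
    by (auto simp: std_conic_def)
  then show "y $ 2 ^ 2 = y $ 1 * y $ 3"
  proof cases
    case 1
    then obtain c where "nu \<theta> = c *s y" "c \<noteq> 0"
      using assms pt_eq_iff by blast
    then have "1 = c * y $ 1" "\<theta> = c * y $ 2" "\<theta> ^ 2 = c * y $ 3"
      by (metis nu_component vector_smult_component)+
    then have "c ^ 2 * (y $ 2 ^ 2) = c ^ 2 * (y $ 1 * y $ 3)"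
      by (simp add: power2_eq_square) algebra
    with \<open>c \<noteq> 0\<close> show ?thesis by simp
  next
    case 2
    then obtain c where "e3 = c *s y" "c \<noteq> 0"
      using assms pt_eq_iff by blast
    then have "0 = c * y $ 1" "0 = c * y $ 2"
      by (metis e3_component vector_smult_component)+
    with \<open>c \<noteq> 0\<close> show ?thesis by simp
  qed
next
  assume y: "y $ 2 ^ 2 = y $ 1 * y $ 3"
  show "pt y \<in> std_conic (GF m)"
  proof (cases "y $ 1 = 0")
    case True
    then have "y = y $ 3 *s e3" "y $ 3 \<noteq> 0"
      using y assms(3) by (auto simp: vec3_eq_iff)
    then have "pt y = pt e3"
      using pt_scale by metis
    then show ?thesis by (simp add: std_conic_def)
  next
    case False
    then have "y = y $ 1 *s nu (y $ 2 / y $ 1)"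
      using y by (simp add: vec3_eq_iff power2_eq_square)
    then have "pt y = pt (nu (y $ 2 / y $ 1))"
      using pt_scale False by metis
    moreover have "y $ 2 / y $ 1 \<in> GF m"
      using assms by (auto simp: rational3_iff intro: GF_closed)
    ultimately show ?thesis by (auto simp: std_conic_def)
  qed
qed

lemma std_conic_cases:
  assumes "fexp m" "X \<in> std_conic (GF m :: 'a set)"
  obtains y where "y \<in> rational (GF m)" "y \<noteq> 0" "X = pt y" "y $ 2 ^ 2 = y $ 1 * y $ 3"
proof -
  have "\<exists>y. y \<in> rational (GF m) \<and> y \<noteq> 0 \<and> X = pt y"
    using assms rational_std e3_nonzero nu_nonzero unfolding std_conic_def by blast
  with that std_conic_iff assms show thesis by blast
qed

text \<open>Both the parametrisation of a conic and the uniqueness of its extension end with a form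
  that becomes a multiple of y2^2 - y1 y3 in new coordinates; this turns the identity of forms into
  an equality of point sets.\<close>

lemma quad_form_zero_set:
  assumes m: "fexp m" and A: "A \<in> rational_mat (GF m :: 'a set)" "invertible A" and "\<delta> \<noteq> 0"
    and Q: "\<And>y. quad_form M (A *v y) = \<delta> * (y $ 2 ^ 2 - y $ 1 * y $ 3)"
  shows "{X \<in> PG (GF m). \<forall>x\<in>X. quad_form M x = 0} = mat_image A ` std_conic (GF m)"
proof (intro equalityI subsetI)
  fix X assume X: "X \<in> {X \<in> PG (GF m). \<forall>x\<in>X. quad_form M x = 0}"
  then obtain x where x: "x \<in> rational (GF m)" "x \<noteq> 0" "X = pt x"
    by (auto simp: PG_iff)
  obtain y where y: "x = A *v y"
    using A(2) by (rule surj_matE)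
  have "quad_form M x = 0"
    using X x vec.span_base[of x "{x}"] by auto
  with y Q \<open>\<delta> \<noteq> 0\<close> have "y $ 2 ^ 2 = y $ 1 * y $ 3" by simp
  moreover have "y \<in> rational (GF m)" "y \<noteq> 0"
    using x y A m rational_mult_iff by auto
  ultimately have "pt y \<in> std_conic (GF m)"
    using std_conic_iff m by blast
  moreover have "X = mat_image A (pt y)"
    using x y by (simp add: mat_image_pt)
  ultimately show "X \<in> mat_image A ` std_conic (GF m)"
    by blast
next
  fix X assume "X \<in> mat_image A ` std_conic (GF m)"
  then obtain Y where Y: "Y \<in> std_conic (GF m)" "X = mat_image A Y" by blast
  obtain y where y: "y \<in> rational (GF m)" "y \<noteq> 0" "Y = pt y" "y $ 2 ^ 2 = y $ 1 * y $ 3"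
    using std_conic_cases[OF m Y(1)] .
  have X: "X = pt (A *v y)"
    using Y y by (simp add: mat_image_pt)
  have "A *v y \<noteq> 0"
    using y inj_matI[OF A(2), of y 0] by auto
  moreover have "A *v y \<in> rational (GF m)"
    using rational_mult m A y by blast
  ultimately have "X \<in> PG (GF m)"
    using X unfolding PG_iff by blast
  moreover have "quad_form M x = 0" if "x \<in> X" for x
  proof -
    obtain c where "x = c *s (A *v y)"
      using \<open>x \<in> X\<close> X mem_pt_iff by blast
    then show ?thesis
      using y(4) by (simp add: quad_form_scale Q)
  qed
  ultimately show "X \<in> {X \<in> PG (GF m). \<forall>x\<in>X. quad_form M x = 0}"
    by blast
qed

section \<open>Parametrisation of conics and uniqueness of their extensions\<close>

lemma nondeg_conicE:
  assumes "nondeg_conic (GF m) D" "fexp m"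
  obtains M where "M \<in> rational_mat (GF m)"
    "D = {X \<in> PG (GF m). \<forall>x\<in>X. quad_form M x = (0 :: 'a)}"
    "\<And>v. v \<in> rational (GF m) \<Longrightarrow> v \<noteq> 0 \<Longrightarrow> quad_form M v = 0 \<Longrightarrow>
      \<exists>w \<in> rational (GF m). polar_form M v w \<noteq> 0"
proof -
  from assms(1) obtain M where "M \<in> rational_mat (GF m)"
    and "\<not> (\<exists>v \<in> rational (GF m). v \<noteq> 0 \<and> quad_form M v = 0 \<and>
          (\<forall>w \<in> rational (GF m). quad_form M (v + w) - quad_form M v - quad_form M w = 0))"
    and "D = {X \<in> PG (GF m). \<forall>x\<in>X. quad_form M x = 0}"
    unfolding nondeg_conic_def by blast
  moreover have "quad_form M (v + w) - quad_form M v - quad_form M w = polar_form M v w" for v w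
    by (simp add: quad_form_add)
  ultimately show thesis
    using that[of M] by fastforce
qed

text \<open>Projection from the point \<open>P\<close> of the conic.\<close>

lemma conic_parametrization:
  assumes "nondeg_conic (GF q) D" and "P \<in> D"
  obtains N where "N \<in> rational_mat (GF q :: 'a set)" "invertible N"
    "D = mat_image N ` std_conic (GF q)" "P = mat_image N (pt e3)"
proof -
  obtain M where M: "M \<in> rational_mat (GF q)"
    and D: "D = {X \<in> PG (GF q). \<forall>x\<in>X. quad_form M x = 0}"
    and ns: "\<And>v. v \<in> rational (GF q) \<Longrightarrow> v \<noteq> 0 \<Longrightarrow> quad_form M v = 0 \<Longrightarrow>
      \<exists>w \<in> rational (GF q). polar_form M v w \<noteq> 0"
    using nondeg_conicE[OF assms(1)] fexp(2) by blast
  have qfr: "polar_form M v w \<in> GF q" "quad_form M v \<in> GF q"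
    if "v \<in> rational (GF q)" "w \<in> rational (GF q)" for v w
    unfolding polar_form_def quad_form_def using M that
    by (auto intro!: GF_sum GF_closed simp: rational_mat_def rational_def)
  obtain p where p: "p \<in> rational (GF q)" "p \<noteq> 0" "P = pt p"
    using assms(2) by (auto simp: D PG_iff)
  have Qp: "quad_form M p = 0"
    using assms(2) p vec.span_base[of p "{p}"] by (auto simp: D)
  then obtain w where w: "w \<in> rational (GF q)" "polar_form M p w \<noteq> 0"
    using ns p by blast
  let ?\<gamma> = "polar_form M p w"
  let ?n = "cross p w"
  have pp: "polar_form M p p = 0"
    by (simp add: polar_form_self Qp)
  have "?n \<noteq> 0"
  proof
    assume "?n = 0"
    then obtain c where "w = c *s p"
      using cross_eq_0_imp p by blast
    with w pp show False by simp
  qed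
  then obtain i where i: "?n $ i \<noteq> 0"
    by (auto simp: vec_eq_iff)
  define s where "s = (axis i 1 :: 'a ^ 3)"
  have s: "s \<in> rational (GF q)"
    by (auto simp: s_def rational_def axis_def)
  have ns': "dot ?n s \<noteq> 0"
    using i exhaust_3[of i] by (auto simp: s_def dot_def axis_def)
  \<comment> \<open>\<open>s\<close> lies outside the span of \<open>p\<close> and \<open>w\<close>;
    subtracting a multiple of \<open>w\<close> moves it onto the tangent line at \<open>p\<close>
    and keeps it independent of \<open>p\<close> and \<open>w\<close>.\<close>
  define t where "t = s - (polar_form M p s / ?\<gamma>) *s w"
  have t: "t \<in> rational (GF q)"
    unfolding t_def using s w p qfr by (intro rational_closed GF_closed) auto
  have pt0: "polar_form M p t = 0"
    using w by (simp add: t_def)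
  have nt: "dot ?n t \<noteq> 0"
    using ns' by (simp add: t_def)
  have Qt: "quad_form M t \<noteq> 0"
  proof
    assume Qt: "quad_form M t = 0"
    \<comment> \<open>The combination of \<open>t\<close> and \<open>p\<close> that is polar to
      \<open>w\<close>. If \<open>t\<close> were isotropic, it would be polar to the whole basis
      \<open>p\<close>, \<open>w\<close>, \<open>t\<close>, hence a singular point of the
      conic.\<close>
    define v where "v = ?\<gamma> *s t - polar_form M t w *s p"
    have "v \<in> rational (GF q)"
      unfolding v_def using t w p qfr by (intro rational_closed) auto
    moreover have "v \<noteq> 0"
    proof
      assume "v = 0"
      then have "dot ?n v = 0" by simp
      with nt w show False by (simp add: v_def)
    qed
    moreover have "quad_form M v = quad_form M (?\<gamma> *s t + (- polar_form M t w) *s p)"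
      by (simp add: v_def vec.scale_minus_left)
    then have "quad_form M v = 0"
      using Qt Qp pt0 by (simp add: quad_form_add quad_form_scale polar_form_commute[of M t p] del: vec.scale_minus_left)
    ultimately obtain x where "polar_form M v x \<noteq> 0"
      using ns by blast
    moreover obtain a b c where "x = a *s p + b *s w + c *s t"
      using basis3[OF nt] by blast
    moreover have "polar_form M v p = 0" "polar_form M v w = 0" "polar_form M v t = 0"
      using pp pt0 Qt by (simp_all add: v_def polar_form_self polar_form_commute[of M t p])
    ultimately show False by simp
  qed
  \<comment> \<open>Multiples of \<open>p\<close> are subtracted so that the first column becomes
    isotropic and polar to the second; the third column is scaled so that the coefficient of y1 y3
    is \<open>- quad_form M t\<close>. Being a multiple of \<open>p\<close>, it sends
    \<open>e3\<close> to \<open>P\<close>.\<close>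
  define N where "N = cols (w - (quad_form M w / ?\<gamma>) *s p) (t - (polar_form M w t / ?\<gamma>) *s p)
    ((- quad_form M t / ?\<gamma>) *s p)"
  have Q: "quad_form M (N *v y) = quad_form M t * (y $ 2 ^ 2 - y $ 1 * y $ 3)" for y
  proof -
    define z where "z = - (quad_form M w * y $ 1 + polar_form M w t * y $ 2 + quad_form M t * y $ 3) / ?\<gamma>"
    have "?\<gamma> * z = - (quad_form M w * y $ 1 + polar_form M w t * y $ 2 + quad_form M t * y $ 3)"
      using w by (simp add: z_def)
    note z = this
    have "N *v y = y $ 1 *s w + y $ 2 *s t + z *s p"
      unfolding N_def cols_mult z_def
      by (simp add: vec_eq_iff add_divide_distrib diff_divide_distrib algebra_simps)
    moreover have "quad_form M (y $ 1 *s w + y $ 2 *s t + z *s p) = y $ 1 ^ 2 * quad_form M w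
        + y $ 2 ^ 2 * quad_form M t + y $ 1 * y $ 2 * polar_form M w t + y $ 1 * (?\<gamma> * z)"
      using Qp pt0 by (simp add: quad_form_add quad_form_scale polar_form_commute[of M t p] polar_form_commute[of M w p])
    ultimately have "quad_form M (N *v y) = y $ 1 ^ 2 * quad_form M w
        + y $ 2 ^ 2 * quad_form M t + y $ 1 * y $ 2 * polar_form M w t + y $ 1 * (?\<gamma> * z)"
      by simp
    then show ?thesis
      unfolding z by (simp add: power2_eq_square algebra_simps)
  qed
  have inv: "invertible N"
    unfolding N_def
  proof (rule invertible_cols)
    have det: "dot (cross (w - x *s p) (t - y *s p)) (z *s p) = z * dot ?n t" for x y z
      by (simp add: dot_def algebra_simps)
    show "dot (cross (w - (quad_form M w / ?\<gamma>) *s p) (t - (polar_form M w t / ?\<gamma>) *s p))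
        ((- quad_form M t / ?\<gamma>) *s p) \<noteq> 0"
      unfolding det using nt Qt w by simp
  qed
  have r: "- quad_form M t / ?\<gamma> \<in> GF q" "quad_form M w / ?\<gamma> \<in> GF q" "polar_form M w t / ?\<gamma> \<in> GF q"
    using t w p qfr by (auto intro!: GF_closed GF_minus)
  have "w - (quad_form M w / ?\<gamma>) *s p \<in> rational (GF q)"
    "t - (polar_form M w t / ?\<gamma>) *s p \<in> rational (GF q)" "(- quad_form M t / ?\<gamma>) *s p \<in> rational (GF q)"
    by (intro rational_closed fexp(2) t w(1) p(1) r)+
  then have rat: "N \<in> rational_mat (GF q)"
    unfolding N_def rational_mat_def cols_def by (simp add: rational_def forall_3)
  have "N *v e3 = (- quad_form M t / ?\<gamma>) *s p"
    by (simp add: N_def cols_mult)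
  then have "mat_image N (pt e3) = pt ((- quad_form M t / ?\<gamma>) *s p)"
    by (simp only: mat_image_pt)
  also have "\<dots> = P"
    unfolding p(3) by (rule pt_scale) (use Qt w in simp)
  finally have "P = mat_image N (pt e3)" ..
  moreover have "D = mat_image N ` std_conic (GF q)"
    unfolding D by (rule quad_form_zero_set) (use inv rat Qt Q in auto)
  ultimately show thesis
    using that rat inv by blast
qed

lemma nondeg_conic_nonempty:
  assumes "nondeg_conic (GF q) D"
  shows "\<exists>P :: ('a ^ 3) set. P \<in> D"
proof -
  obtain M where M: "M \<in> rational_mat (GF q)"
    and D: "D = {X \<in> PG (GF q). \<forall>x\<in>X. quad_form M x = 0}"
    using nondeg_conicE[OF assms] fexp(2) by blast
  obtain v where "v \<in> rational (GF q)" "v \<noteq> 0" "quad_form M v = 0"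
    using quad_form_isotropic[OF M] by blast
  then have "pt v \<in> PG (GF q)" "\<forall>x\<in>pt v. quad_form M x = 0"
    unfolding PG_iff by (blast, auto simp: mem_pt_iff quad_form_scale)
  then show ?thesis
    unfolding D by blast
qed

text \<open>The columns of the inverse are the preimages of the rational axis vectors, and
  \<open>rational_mult_iff\<close> applies to them.\<close>

lemma matrix_inverse_rational:
  assumes "fexp m" "A \<in> rational_mat (GF m :: 'a set)" "invertible A"
  obtains A' where "A' \<in> rational_mat (GF m)" "A ** A' = mat 1" "A' ** A = mat (1 :: 'a)"
proof -
  obtain A' where A': "A ** A' = mat 1" "A' ** A = mat 1"
    using assms(3) by (auto simp: invertible_def)
  have "A' *v axis j 1 \<in> rational (GF m)" for j
  proof -
    have "A *v (A' *v axis j 1) = axis j 1"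
      by (simp add: matrix_vector_mul_assoc A')
    moreover have "axis j 1 \<in> rational (GF m :: 'a set)"
      using assms(1) by (auto simp: rational_def axis_def)
    ultimately show ?thesis
      using rational_mult_iff[OF assms] by metis
  qed
  then have "A' \<in> rational_mat (GF m)"
    by (simp add: rational_mat_def rational_def matrix_mult_axis)
  with that A' show thesis by blast
qed

text \<open>Substituting the parametrisation into a form of degree 2 gives a quartic, which vanishes
  identically once it has five zeros. Since \<open>C\<close> may be anything between the conics over
  \<open>GF q\<close> and \<open>GF m\<close>, the result covers both \<open>conic_plus\<close> and
  \<open>conic_plusplus\<close>.\<close>

lemma conic_ext_eq:
  assumes m: "fexp m" and A: "A \<in> rational_mat (GF m :: 'a set)" "invertible A" and q: "q \<ge> 5"
    and C: "mat_image A ` std_conic (GF q) \<subseteq> C" "C \<subseteq> mat_image A ` std_conic (GF m)"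
  shows "conic_ext (GF m) C = mat_image A ` std_conic (GF m)"
  unfolding conic_ext_def
proof (rule the_equality)
  have ax: "axis i 1 \<in> rational (GF m :: 'a set)" for i :: 3
    using m by (auto simp: rational_def axis_def)
  obtain A' where A': "A' \<in> rational_mat (GF m)" "A ** A' = mat 1" "A' ** A = mat 1"
    using matrix_inverse_rational[OF m A] .
  \<comment> \<open>The form y2^2 - y1 y3 in the coordinates y = A' x; the matrix is left
    unsymmetric, so that nothing is divided by 2.\<close>
  define M where "M = (\<chi> i j. A' $ 2 $ i * A' $ 2 $ j - A' $ 1 $ i * A' $ 3 $ j)"
  have Q': "quad_form M x = (A' *v x) $ 2 ^ 2 - (A' *v x) $ 1 * (A' *v x) $ 3" for x
    by (simp add: quad_form_def M_def matrix_vector_mult_def sum_3 power2_eq_square algebra_simps)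
  then have Q: "quad_form M (A *v y) = 1 * (y $ 2 ^ 2 - y $ 1 * y $ 3)" for y
    by (simp add: matrix_vector_mul_assoc A')
  have "M \<in> rational_mat (GF m)"
    using A' m by (auto simp: M_def rational_mat_def intro!: GF_closed)
  moreover have False if v: "v \<in> rational (GF m)" "v \<noteq> 0" "quad_form M v = 0"
    "\<forall>w \<in> rational (GF m). quad_form M (v + w) - quad_form M v - quad_form M w = 0" for v
  proof -
    obtain y where y: "v = A *v y"
      using A(2) by (rule surj_matE)
    have pol: "quad_form M (A *v (y + z)) - quad_form M (A *v y) - quad_form M (A *v z) = 0"
      if "z \<in> rational (GF m)" for z
      using that v y rational_mult[OF m A(1)] by (simp add: vec.add)
    \<comment> \<open>Pairing with the second axis vector would only give 2 y2 = 0, which says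
      nothing in characteristic 2; y2 is obtained from the equation of the conic instead.\<close>
    have "y $ 3 = 0" "y $ 1 = 0"
      using pol[OF ax[of 1]] pol[OF ax[of 3]] unfolding Q
      by (simp_all add: axis_def algebra_simps)
    moreover have "y $ 2 ^ 2 = y $ 1 * y $ 3"
      using v(3) y Q[of y] by simp
    ultimately have "y = 0"
      by (simp add: vec3_eq_iff)
    with y v show False by simp
  qed
  moreover have "mat_image A ` std_conic (GF m) = {X \<in> PG (GF m). \<forall>x\<in>X. quad_form M x = 0}"
    by (rule quad_form_zero_set[symmetric, where \<delta> = 1]) (use m A Q in auto)
  ultimately have "nondeg_conic (GF m) (mat_image A ` std_conic (GF m))"
    unfolding nondeg_conic_def by (intro bexI[of _ M]) blast
  with C show "nondeg_conic (GF m) (mat_image A ` std_conic (GF m)) \<and> C \<subseteq> mat_image A ` std_conic (GF m)"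
    by blast
next
  fix D assume D0: "nondeg_conic (GF m) D \<and> C \<subseteq> D"
  obtain M where D: "D = {X \<in> PG (GF m). \<forall>x\<in>X. quad_form M x = (0 :: 'a)}"
    and ns: "\<And>v. v \<in> rational (GF m) \<Longrightarrow> v \<noteq> 0 \<Longrightarrow> quad_form M v = 0 \<Longrightarrow>
      \<exists>w \<in> rational (GF m). polar_form M v w \<noteq> 0"
    using nondeg_conicE[OF conjunct1[OF D0] m] by blast
  define c where "c i = A *v axis i 1" for i
  have Ay: "A *v y = y $ 1 *s c 1 + y $ 2 *s c 2 + y $ 3 *s c 3" for y
    by (simp add: c_def vec_eq_iff matrix_mult_axis) (simp add: matrix_vector_mult_def sum_3 mult.commute)
  have Qy: "quad_form M (A *v y) = y $ 1 ^ 2 * quad_form M (c 1) + y $ 2 ^ 2 * quad_form M (c 2)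
    + y $ 3 ^ 2 * quad_form M (c 3) + y $ 1 * y $ 2 * polar_form M (c 1) (c 2) + y $ 1 * y $ 3 * polar_form M (c 1) (c 3)
    + y $ 2 * y $ 3 * polar_form M (c 2) (c 3)" for y
    unfolding Ay by (simp add: quad_form_add quad_form_scale algebra_simps)
  \<comment> \<open>Only the middle coefficient mixes two of the six coefficients of the form, since
    \<theta>^2 arises both as a square and as 1 times \<theta>^2. This leaves the one-parameter
    family of multiples of the standard form.\<close>
  define P where "P = [:quad_form M (c 1), polar_form M (c 1) (c 2), quad_form M (c 2) + polar_form M (c 1) (c 3),
    polar_form M (c 2) (c 3), quad_form M (c 3):]"
  have "poly P \<theta> = 0" if "\<theta> \<in> GF q" for \<theta>
  proof -
    have "mat_image A (pt (nu \<theta>)) \<in> D"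
      using C(1) D0 that unfolding std_conic_def by blast
    then have "quad_form M (A *v nu \<theta>) = 0"
      unfolding D mat_image_pt using vec.span_base[of "A *v nu \<theta>" "{A *v nu \<theta>}"] by auto
    then show ?thesis
      unfolding Qy P_def by (simp add: algebra_simps power2_eq_square)
  qed
  then have "P = 0"
    by (intro poly_eqI_degree[of "GF q"])
      (use q in \<open>auto simp: P_def card_GF_q intro!: le_less_trans[OF degree_pCons_le]\<close>)
  then have z: "quad_form M (c 1) = 0" "polar_form M (c 1) (c 2) = 0" "polar_form M (c 2) (c 3) = 0"
    "quad_form M (c 3) = 0" and "quad_form M (c 2) + polar_form M (c 1) (c 3) = 0"
    by (simp_all add: P_def)
  then have z2: "polar_form M (c 1) (c 3) = - quad_form M (c 2)"
    by (simp add: eq_neg_iff_add_eq_0 add.commute)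
  have Q: "quad_form M (A *v y) = quad_form M (c 2) * (y $ 2 ^ 2 - y $ 1 * y $ 3)" for y
    unfolding Qy z z2 by (simp add: algebra_simps)
  have "quad_form M (c 2) \<noteq> 0"
  proof
    assume "quad_form M (c 2) = 0"
    then have Q0: "quad_form M (A *v y) = 0" for y
      by (simp add: Q)
    have "quad_form M v = 0" for v
    proof -
      obtain y where "v = A *v y"
        using A(2) by (rule surj_matE)
      then show ?thesis
        using Q0 by simp
    qed
    then have "polar_form M v w = 0" for v w
      using quad_form_add[of M v w] by simp
    moreover have "c 1 \<in> rational (GF m)"
      unfolding c_def using m by (intro rational_mult A) (auto simp: rational_def axis_def)
    moreover have "c 1 \<noteq> 0"
      using inj_matI[OF A(2), of "axis 1 1" 0] by (auto simp: c_def axis_eq_0_iff)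
    ultimately show False
      using ns z by blast
  qed
  then show "D = mat_image A ` std_conic (GF m)"
    unfolding D by (intro quad_form_zero_set) (use m A Q in auto)
qed

end

section \<open>Normal rational curves from triples of polynomials\<close>

lemma nrc_basisI:
  assumes rat: "\<And>i. i \<le> r \<Longrightarrow> b i \<in> rational K"
    and zero: "\<And>c i. (\<Sum>i\<le>r. c i *s b i) = 0 \<Longrightarrow> i \<le> r \<Longrightarrow> c i = (0 :: 'a::field)"
  shows "nrc_basis K r b"
proof -
  have inj: "inj_on b {..r}"
  proof (rule inj_onI, rule ccontr)
    fix i j assume ij: "i \<in> {..r}" "j \<in> {..r}" "b i = b j" "i \<noteq> j"
    let ?c = "\<lambda>k. (if k = i then 1 else 0) - (if k = j then 1 else 0 :: 'a)"
    have "(\<Sum>k\<le>r. ?c k *s b k) = (\<Sum>k\<le>r. (if k = i then b k else 0) - (if k = j then b k else 0))"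
      by (intro sum.cong) auto
    also have "\<dots> = 0"
      using ij by (simp add: sum_subtractf)
    finally have "?c i = 0"
      using ij by (intro zero) auto
    with ij show False by simp
  qed
  moreover have "vec.independent (b ` {..r})"
  proof (rule vec.independent_if_scalars_zero)
    fix f x assume f: "(\<Sum>x\<in>b ` {..r}. f x *s x) = 0" and "x \<in> b ` {..r}"
    then obtain i where i: "i \<le> r" "x = b i" by auto
    have "(\<Sum>i\<le>r. f (b i) *s b i) = 0"
      using f inj by (simp add: sum.reindex)
    then show "f x = 0"
      unfolding i(2) using i(1) by (rule zero)
  qed simp
  ultimately show ?thesis
    using rat by (simp add: nrc_basis_def)
qed

lemma poly_sum_upto:
  fixes p :: "'a::comm_semiring_1 poly"
  assumes "degree p \<le> n"
  shows "poly p x = (\<Sum>i\<le>n. x ^ i * coeff p i)"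
proof -
  have "poly p x = (\<Sum>i\<le>degree p. coeff p i * x ^ i)"
    by (simp add: poly_altdef)
  also have "\<dots> = (\<Sum>i\<le>n. coeff p i * x ^ i)"
    using assms by (intro sum.mono_neutral_left) (auto simp: coeff_eq_0)
  finally show ?thesis by (simp add: mult.commute)
qed

text \<open>
  Sequences all of whose windows of length three are proportional to \<open>t\<close> are geometric with
  \<open>t\<close> on the conic, or zero.
\<close>

lemma window_zero:
  fixes d \<mu> :: "nat \<Rightarrow> 'a::field"
  assumes "t2 ^ 2 \<noteq> t1 * t3" and "n \<ge> 1"
    and w: "\<And>j. j \<le> n \<Longrightarrow> d j = \<mu> j * t1 \<and> d (j + 1) = \<mu> j * t2 \<and> d (j + 2) = \<mu> j * t3"
    and i: "i \<le> n + 2"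
  shows "d i = 0"
proof -
  \<comment> \<open>Neighbouring windows overlap in two entries. This gives two linear equations for
    \<mu> j and \<mu> (j + 1), with determinant t2^2 - t1 t3 up to sign.\<close>
  have both: "\<mu> j = 0 \<and> \<mu> (j + 1) = 0" if "j < n" for j
  proof -
    have "\<mu> j * t2 = \<mu> (j + 1) * t1" "\<mu> j * t3 = \<mu> (j + 1) * t2"
      using w[of j] w[of "j + 1"] that by (auto simp: numeral_2_eq_2)
    then have "\<mu> j * (t2 ^ 2 - t1 * t3) = 0" "\<mu> (j + 1) * (t2 ^ 2 - t1 * t3) = 0"
      by algebra+
    with assms(1) show ?thesis by simp
  qed
  have \<mu>: "\<mu> j = 0" if "j \<le> n" for j
  proof (cases "j < n")
    case False
    then have "j - 1 < n" "j = j - 1 + 1"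
      using that assms(2) by auto
    then show ?thesis using both[of "j - 1"] by metis
  qed (use both in blast)
  consider "i \<le> n" | "i = n + 1" | "i = n + 2" using i by linarith
  then show ?thesis
    using w[of i] w[of n] \<mu> by cases auto
qed

text \<open>The coefficient of X^i in the vector polynomial (g, X g, X^2 g), which is g times the
  parametrisation of the conic.\<close>

definition shifted_coeffs :: "'a::field poly \<Rightarrow> nat \<Rightarrow> 'a ^ 3" where
  "shifted_coeffs g i = vector [coeff g i, coeff (pCons 0 g) i, coeff (pCons 0 (pCons 0 g)) i]"

lemma shifted_coeffs_sum:
  assumes "degree g + 2 \<le> r"
  shows "(\<Sum>i\<le>r. \<theta> ^ i *s shifted_coeffs g i) = poly g \<theta> *s nu \<theta>"
proof -
  have d: "degree g \<le> r" "degree (pCons 0 g) \<le> r" "degree (pCons 0 (pCons 0 g)) \<le> r"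
    using assms degree_pCons_le[of 0 g] degree_pCons_le[of 0 "pCons 0 g"] by linarith+
  show ?thesis
    using poly_sum_upto[OF d(1), of \<theta>] poly_sum_upto[OF d(2), of \<theta>] poly_sum_upto[OF d(3), of \<theta>]
    by (simp add: vec3_eq_iff shifted_coeffs_def power2_eq_square mult_ac)
qed

lemma shifted_coeffs_top: "degree g + 2 \<le> r \<Longrightarrow> shifted_coeffs g r = coeff g (r - 2) *s e3"
  by (cases r; cases "r - 1") (auto simp: vec3_eq_iff shifted_coeffs_def coeff_eq_0)

definition form_poly :: "'a::field ^ 3 \<Rightarrow> 'a poly" where
  "form_poly v = [:v $ 1, v $ 2, v $ 3:]"

lemma poly_form_poly: "poly (form_poly v) \<theta> = dot v (nu \<theta>)"
  by (simp add: form_poly_def dot_def power2_eq_square algebra_simps)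

lemma form_poly_linear: "form_poly (v + w) = form_poly v + form_poly w" "form_poly (c *s v) = smult c (form_poly v)"
  by (simp_all add: form_poly_def)

context frobenius_field
begin

lemma coeff_mult_frob:
  assumes "fexp m" "\<And>n. coeff p' n = coeff p n ^ m" "\<And>n. coeff s' n = coeff s n ^ m"
  shows "coeff (p * s :: 'a poly) n ^ m = coeff (p' * s') n"
  using assms by (simp add: coeff_mult frob_sum power_mult_distrib)

lemma coeff_form_poly_frob: "fexp m \<Longrightarrow> coeff (form_poly (frob_vec m v)) n = coeff (form_poly v :: 'a poly) n ^ m"
  by (auto simp: form_poly_def coeff_pCons power_0_left dest: fexp_pos split: nat.splits)

lemma frob_vec_shifted_coeffs:
  assumes "fexp m" "\<And>n. coeff g' n = coeff g n ^ m"
  shows "frob_vec m (shifted_coeffs g i) = shifted_coeffs (g' :: 'a poly) i"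
proof -
  have "coeff (pCons 0 g) n ^ m = coeff (pCons 0 g') n" for n
    using assms by (cases n) (auto simp: power_0_left)
  moreover have "coeff (pCons 0 (pCons 0 g)) n ^ m = coeff (pCons 0 (pCons 0 g')) n" for n
    using assms by (cases n; cases "n - 1") (auto simp: power_0_left)
  ultimately show ?thesis
    using assms by (simp add: vec3_eq_iff shifted_coeffs_def)
qed

lemma frob_vec_cross: "fexp m \<Longrightarrow> frob_vec m (cross u v) = cross (frob_vec m u) (frob_vec m v :: 'a ^ 3)"
  by (simp add: vec3_eq_iff frob_diff power_mult_distrib)

lemma frob_vec_dot: "fexp m \<Longrightarrow> dot u v ^ m = dot (frob_vec m u) (frob_vec m v :: 'a ^ 3)"
  by (simp add: dot_def frob_add power_mult_distrib)

end

section \<open>The Bose representation in coordinates\<close>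

text \<open>\<open>H\<close> maps subplane coordinates into the transversal plane \<Gamma>, and
  \<open>H_surj\<close> is the condition that \<Gamma> and its conjugates span the space. The line
  at infinity has equation \<open>a\<close>, and \<open>tangent\<close> makes \<open>t\<close> its
  only point over \<open>GF q\<close>.\<close>

locale bose_frame = frobenius_field q ty for q and ty :: "'a::{field,finite} itself" +
  fixes H :: "'a ^ 3 ^ 9" and a t :: "'a ^ 3"
  assumes H: "H \<in> rational_mat (GF (q ^ 3))"
    and H_surj: "\<And>x. \<exists>u0 u1 u2. x = H *v u0 + frob_mat q H *v u1 + frob_mat (q ^ 2) H *v u2"
    and a: "a \<in> rational (GF (q ^ 3))"
    and t: "t \<in> rational (GF q)" "t \<noteq> 0" "dot a t = 0"
    and tangent: "\<And>s. s \<in> rational (GF q) \<Longrightarrow> dot a s = 0 \<Longrightarrow> \<exists>c. s = c *s t"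
begin

definition Phi :: "'a ^ 3 \<Rightarrow> 'a ^ 3 \<Rightarrow> 'a ^ 3 \<Rightarrow> 'a ^ 9" where
  "Phi u0 u1 u2 = H *v u0 + frob_mat q H *v u1 + frob_mat (q ^ 2) H *v u2"

lemma Phi_linear:
  "Phi u0 u1 u2 + Phi v0 v1 v2 = Phi (u0 + v0) (u1 + v1) (u2 + v2)"
  "Phi u0 u1 u2 - Phi v0 v1 v2 = Phi (u0 - v0) (u1 - v1) (u2 - v2)"
  "c *s Phi u0 u1 u2 = Phi (c *s u0) (c *s u1) (c *s u2)"
  "Phi 0 0 0 = 0"
  by (simp_all add: Phi_def vec.add vec.diff vec.scale vec.scale_right_distrib)

lemma Phi_sum:
  "(\<Sum>i\<in>A. Phi (u i) (v i) (w i)) = Phi (\<Sum>i\<in>A. u i) (\<Sum>i\<in>A. v i) (\<Sum>i\<in>A. w i)"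
  by (simp add: Phi_def sum.distrib vec.sum)

text \<open>A surjection between finite sets of equal size is injective; both sides have 9
  coordinates.\<close>

lemma Phi_eq_iff: "Phi u0 u1 u2 = Phi v0 v1 v2 \<longleftrightarrow> u0 = v0 \<and> u1 = v1 \<and> u2 = v2"
proof -
  let ?f = "\<lambda>(u0, u1, u2). Phi u0 u1 u2"
  have "surj ?f"
    using H_surj by (force simp: Phi_def surj_def)
  moreover have "CARD('a ^ 9) = CARD(('a ^ 3) \<times> ('a ^ 3) \<times> ('a ^ 3))"
    by (simp only: card_prod CARD_vec) (simp flip: power_add)
  ultimately have "card (range ?f) = card (UNIV :: (('a ^ 3) \<times> ('a ^ 3) \<times> ('a ^ 3)) set)"
    by simp
  then have "inj ?f"
    by (intro eq_card_imp_inj_on) auto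
  then show ?thesis
    by (auto simp: inj_def)
qed

lemma Phi_eq_0_iff: "Phi u0 u1 u2 = 0 \<longleftrightarrow> u0 = 0 \<and> u1 = 0 \<and> u2 = 0"
  using Phi_eq_iff[of u0 u1 u2 0 0 0] by (simp add: Phi_linear)

lemma Phi_cases: obtains u0 u1 u2 where "x = Phi u0 u1 u2"
  using H_surj unfolding Phi_def by blast

lemma frob_mat_q3_H: "frob_mat (q ^ 3) H = H"
  using H by (simp add: rational_mat_iff_frob_mat)

text \<open>Since \<open>H\<close> is fixed by the power q^3, Frobenius permutes the three blocks
  cyclically. Hence the \<open>GF q\<close>-vectors are exactly the triples of conjugates.\<close>

lemma frob_vec_Phi: "frob_vec q (Phi u0 u1 u2) = Phi (frob_vec q u2) (frob_vec q u0) (frob_vec q u1)"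
proof -
  have "frob_mat q (frob_mat (q ^ 2) H) = H"
    using frob_mat_q3_H by (simp add: frob_mat_frob_mat power2_eq_square power3_eq_cube mult.assoc)
  then show ?thesis
    by (simp add: Phi_def frob_vec_add frob_vec_mult frob_mat_frob_mat power2_eq_square)
qed

section \<open>The conjugates of the line at infinity\<close>

definition a1 where "a1 = frob_vec q a"
definition a2 where "a2 = frob_vec (q ^ 2) a"

lemma frob_vec_a [simp]: "frob_vec q a = a1" "frob_vec q a1 = a2" "frob_vec q a2 = a" "frob_vec (q ^ 2) a = a2" "frob_vec (q ^ 2) a1 = a"
    "frob_vec (q ^ 2) a2 = a1"
proof -
  have q3: "frob_vec (q ^ 3) a = a"
    using a by (simp add: rational_iff_frob_vec)
  show "frob_vec q a = a1" "frob_vec q a1 = a2" "frob_vec (q ^ 2) a = a2"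
    by (simp_all add: a1_def a2_def frob_vec_frob_vec power2_eq_square)
  show "frob_vec q a2 = a" "frob_vec (q ^ 2) a1 = a"
    using q3 by (simp_all add: a1_def a2_def frob_vec_frob_vec power2_eq_square power3_eq_cube mult.assoc)
  have "frob_vec (q ^ 2) a2 = frob_vec q (frob_vec (q ^ 3) a)"
    by (simp add: a2_def frob_vec_frob_vec flip: power_add power_Suc)
  then show "frob_vec (q ^ 2) a2 = a1"
    by (simp add: q3 a1_def)
qed

lemma frob_vec_t [simp]: "frob_vec q t = t" "frob_vec (q ^ 2) t = t"
proof -
  show "frob_vec q t = t" using t by (simp add: rational_iff_frob_vec)
  then have "frob_vec q (frob_vec q t) = t" by simp
  then show "frob_vec (q ^ 2) t = t" by (simp add: frob_vec_frob_vec power2_eq_square)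
qed

lemma a_dot_t [simp]: "dot a t = 0" "dot a1 t = 0" "dot a2 t = 0"
proof -
  show "dot a t = 0" using t by simp
  then show "dot a1 t = 0" "dot a2 t = 0"
    using frob_vec_dot[of q a t] frob_vec_dot[of "q ^ 2" a t] q_gt_1 by (simp_all add: power_0_left)
qed

text \<open>If the line at infinity coincided with its conjugate, it would be a line of the subplane
  and contain more than one of its points, against tangency.\<close>

lemma cross_a_a1: "cross a a1 \<noteq> 0"
proof
  assume 0: "cross a a1 = 0"
  have ax: "axis i 1 \<in> rational (GF q :: 'a set)" for i :: 3
    by (auto simp: rational_def axis_def)
  have "a \<noteq> 0"
  proof
    assume "a = 0"
    then obtain c d where "axis 1 1 = c *s t" "e3 = d *s t"
      using tangent[OF ax[of 1]] tangent[of e3] by (auto simp: dot_def)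
    then have "c *s t = axis 1 1" "d *s t = e3" by simp_all
    then show False
      by (auto simp: vec3_eq_iff axis_def)
  qed
  then obtain c where c: "a1 = c *s a"
    using cross_eq_0_imp[OF 0] by blast
  obtain j where j: "a $ j \<noteq> 0"
    using \<open>a \<noteq> 0\<close> by (auto simp: vec_eq_iff)
  have ci: "a $ i ^ q = c * a $ i" for i
    using c by (metis frob_vec_component frob_vec_a(1) vector_smult_component)
  have "c \<noteq> 0"
    using ci[of j] j by auto
  \<comment> \<open>Dividing by a nonzero coordinate cancels the factor \<open>c\<close> picked up
    under Frobenius, so this multiple of \<open>a\<close> has entries in
    \<open>GF q\<close>.\<close>
  define r where "r = (1 / a $ j) *s a"
  have "r $ i ^ q = r $ i" for i
    using ci[of i] ci[of j] \<open>c \<noteq> 0\<close> j by (simp add: r_def power_divide)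
  then have r: "r \<in> rational (GF q)"
    by (simp add: rational_def GF_def)
  have ar: "a = a $ j *s r"
    using j by (simp add: r_def)
  have "r \<noteq> 0"
    using ar j by auto
  \<comment> \<open>The vectors \<open>cross r e\<close> are the \<open>GF q\<close>-points of the
    line. Tangency makes them all proportional to \<open>t\<close>, which is impossible for the
    three obtained from the axis vectors unless \<open>r\<close> is 0.\<close>
  have tr: "\<exists>c. cross r e = c *s t" if "e \<in> rational (GF q)" for e
  proof (rule tangent)
    show "cross r e \<in> rational (GF q)"
      using r that by (simp add: rational_iff_frob_vec frob_vec_cross)
    show "dot a (cross r e) = 0"
      by (subst ar) simp
  qed
  have "cross (cross r (axis i 1)) (cross r (axis k 1)) = 0" for i k :: 3
  proof -
    have "cross (c *s t) (d *s t) = 0" for c d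
      by (simp add: vec3_eq_iff algebra_simps)
    then show ?thesis
      using tr[OF ax[of i]] tr[OF ax[of k]] by metis
  qed
  from this[of 1 2] this[of 2 3] this[of 1 3] have "r = 0"
    by (simp add: vec3_eq_iff axis_def)
  with \<open>r \<noteq> 0\<close> show False ..
qed

lemma cross_a: "cross a a1 \<noteq> 0" "cross a1 a2 \<noteq> 0" "cross a2 a \<noteq> 0"
proof -
  show "cross a1 a2 \<noteq> 0" "cross a2 a \<noteq> 0"
    using cross_a_a1 frob_vec_cross[of q a a1] frob_vec_cross[of "q ^ 2" a a1]
      frob_vec_eq_0_iff[of q "cross a a1"] frob_vec_eq_0_iff[of "q ^ 2" "cross a a1"] by auto
qed (rule cross_a_a1)

lemma a_nonzero: "a \<noteq> 0"
  using cross_a_a1 by (auto simp: vec3_eq_iff)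

lemma orthogonal_imp_t:
  assumes "cross u v \<noteq> 0" "dot u t = 0" "dot v t = 0" "dot u w = 0" "dot v w = 0"
  shows "\<exists>c. w = c *s t"
proof -
  obtain c d where c: "w = c *s cross u v" and d: "t = d *s cross u v"
    using orthogonal_imp_cross assms by meson
  have "d \<noteq> 0" using d t by auto
  then have "w = (c / d) *s t"
    by (subst d) (simp add: c)
  then show ?thesis ..
qed

lemma t_perp:
  assumes "dot p t = 0"
  shows "\<exists>x y. p = x *s a + y *s a1"
proof -
  obtain d where d: "t = d *s cross a a1"
    using orthogonal_imp_cross[OF cross_a_a1, of t] by auto
  then have "d \<noteq> 0" using t by auto
  moreover have "d * dot p (cross a a1) = 0"
    using assms by (simp add: d)
  ultimately have "dot (cross a a1) p = 0"
    by (simp add: dot_def mult.commute)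
  then show ?thesis
    using dot_cross_eq_0_imp[OF cross_a_a1] by blast
qed

text \<open>The point \<open>e3\<close> of the standard conic is at infinity iff \<open>a $ 3 = 0\<close>.\<close>

definition curve_deg :: nat where "curve_deg = (if a $ 3 = 0 then 4 else 6)"

text \<open>The coefficient of X^i in the polynomial triple (f1 f2 \<nu>, f2 f0 \<nu>, f0 f1
  \<nu>).\<close>

definition curve_basis :: "nat \<Rightarrow> 'a ^ 9" where
  "curve_basis i = Phi (shifted_coeffs (form_poly a1 * form_poly a2) i) (shifted_coeffs (form_poly a2 * form_poly a) i) (shifted_coeffs (form_poly a * form_poly a1) i)"

text \<open>The same triple as a cubic expression in homogeneous coordinates, so that evaluation at
  \<open>e3\<close> covers the parameter at infinity.\<close>

definition curve_vec :: "'a ^ 3 \<Rightarrow> 'a ^ 9" where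
  "curve_vec y = Phi ((dot a1 y * dot a2 y) *s y) ((dot a2 y * dot a y) *s y) ((dot a y * dot a1 y) *s y)"

lemma a3_eq_0: "a1 $ 3 = 0 \<longleftrightarrow> a $ 3 = 0" "a2 $ 3 = 0 \<longleftrightarrow> a $ 3 = 0"
proof -
  have "a1 $ 3 = a $ 3 ^ q" "a2 $ 3 = a $ 3 ^ (q ^ 2)"
    unfolding a1_def a2_def by (rule frob_vec_component)+
  then show "a1 $ 3 = 0 \<longleftrightarrow> a $ 3 = 0" "a2 $ 3 = 0 \<longleftrightarrow> a $ 3 = 0"
    using q_gt_1 by simp_all
qed

lemma degree_form_poly_mult:
  assumes "v \<in> {a, a1, a2}" "w \<in> {a, a1, a2}"
  shows "degree (form_poly v * form_poly w) + 2 \<le> curve_deg"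
proof -
  have "degree (form_poly v) + 1 \<le> curve_deg div 2" if "v \<in> {a, a1, a2}" for v
  proof -
    have "v $ 3 = 0 \<longleftrightarrow> a $ 3 = 0"
      using that a3_eq_0 by blast
    then show ?thesis
      by (simp add: form_poly_def curve_deg_def)
  qed
  from this[OF assms(1)] this[OF assms(2)] show ?thesis
    using degree_mult_le[of "form_poly v" "form_poly w"] by (simp add: curve_deg_def split: if_splits)
qed

lemma curve_basis_sum: "(\<Sum>i\<le>curve_deg. \<theta> ^ i *s curve_basis i) = curve_vec (nu \<theta>)"
proof -
  have "(\<Sum>i\<le>curve_deg. \<theta> ^ i *s shifted_coeffs (form_poly v * form_poly w) i) = (dot v (nu \<theta>) * dot w (nu \<theta>)) *s nu \<theta>"
    if "v \<in> {a, a1, a2}" "w \<in> {a, a1, a2}" for v w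
    by (simp add: shifted_coeffs_sum[OF degree_form_poly_mult[OF that]] poly_form_poly)
  then show ?thesis
    unfolding curve_basis_def curve_vec_def Phi_linear Phi_sum by simp
qed

lemma curve_basis_6: "a $ 3 \<noteq> 0 \<Longrightarrow> curve_basis 6 = curve_vec e3"
proof -
  assume "a $ 3 \<noteq> 0"
  then have curve_deg: "curve_deg = 6" by (simp add: curve_deg_def)
  have *: "shifted_coeffs (form_poly v * form_poly w) 6 = (dot v e3 * dot w e3) *s e3" if "v \<in> {a, a1, a2}" "w \<in> {a, a1, a2}" for v w
  proof -
    have "coeff (form_poly v * form_poly w) 4 = v $ 3 * w $ 3"
      by (simp add: form_poly_def eval_nat_numeral)
    moreover have "degree (form_poly v * form_poly w) + 2 \<le> 6"
      using degree_form_poly_mult[OF that] curve_deg by simp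
    ultimately show ?thesis
      by (simp add: shifted_coeffs_top dot_def)
  qed
  show ?thesis
    unfolding curve_basis_def curve_vec_def by (simp add: *)
qed

text \<open>Here \<open>e3\<close> lies on all three conjugate lines and \<open>curve_vec e3\<close>
  is 0. The forms drop to degree at most 1, and the coefficient of X^4 takes over as the value at
  infinity.\<close>

lemma curve_basis_4:
  assumes "a $ 3 = 0"
  shows "curve_basis 4 = Phi ((a1 $ 2 * a2 $ 2) *s e3) ((a2 $ 2 * a $ 2) *s e3) ((a $ 2 * a1 $ 2) *s e3)"
proof -
  have curve_deg: "curve_deg = 4" using assms by (simp add: curve_deg_def)
  have *: "shifted_coeffs (form_poly v * form_poly w) 4 = (v $ 2 * w $ 2) *s e3" if "v \<in> {a, a1, a2}" "w \<in> {a, a1, a2}" for v w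
  proof -
    have "v $ 3 = 0" "w $ 3 = 0"
      using that a3_eq_0 assms by auto
    then have "coeff (form_poly v * form_poly w) 2 = v $ 2 * w $ 2"
      by (simp add: form_poly_def eval_nat_numeral)
    moreover have "degree (form_poly v * form_poly w) + 2 \<le> 4"
      using degree_form_poly_mult[OF that] curve_deg by simp
    ultimately show ?thesis
      by (simp add: shifted_coeffs_top)
  qed
  show ?thesis
    unfolding curve_basis_def by (simp add: *)
qed

text \<open>Frobenius conjugates the three coefficient blocks cyclically, and
  \<open>frob_vec_Phi\<close> shifts their positions in step.\<close>

lemma curve_basis_rational: "curve_basis i \<in> rational (GF q)"
proof -
  have "coeff (form_poly (frob_vec q v) * form_poly (frob_vec q w)) n = coeff (form_poly v * form_poly w) n ^ q" for v w :: "'a ^ 3" and n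
    by (rule coeff_mult_frob[symmetric]) (simp_all add: coeff_form_poly_frob)
  then have "frob_vec q (shifted_coeffs (form_poly v * form_poly w) i) = shifted_coeffs (form_poly (frob_vec q v) * form_poly (frob_vec q w)) i" for v w :: "'a ^ 3"
    by (intro frob_vec_shifted_coeffs) auto
  then show ?thesis
    by (simp add: rational_iff_frob_vec curve_basis_def frob_vec_Phi)
qed

section \<open>Linear independence of the coefficient vectors of the curve\<close>

lemma a2_combination:
  obtains x y where "a2 = x *s a + y *s a1" "x \<noteq> 0" "y \<noteq> 0"
proof -
  obtain x y where xy: "a2 = x *s a + y *s a1"
    using t_perp[of a2] by auto
  have "x \<noteq> 0"
  proof
    assume "x = 0"
    with xy have "a2 = y *s a1" by simp
    then have "cross a1 a2 = 0" by (simp add: vec3_eq_iff)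
    then show False using cross_a by simp
  qed
  moreover have "y \<noteq> 0"
  proof
    assume "y = 0"
    with xy have "a2 = x *s a" by simp
    then have "cross a2 a = 0" by (simp add: vec3_eq_iff)
    then show False using cross_a by simp
  qed
  ultimately show thesis using that xy by blast
qed

text \<open>The relation \<open>c\<close> is turned into the functional \<open>L\<close>, which
  sends X^i to \<open>c i\<close>. The three blocks of a window of coefficients say that
  \<open>L\<close> kills X^j f1 f2, X^j f2 f0 and X^j f0 f1 for j at most 2; the aim is to show that
  it kills every X^i up to \<open>curve_deg\<close>.\<close>

lemma curve_basis_independent:
  assumes nt: "a $ 3 \<noteq> 0 \<Longrightarrow> t $ 2 ^ 2 \<noteq> t $ 1 * t $ 3"
    and c: "(\<Sum>i\<le>curve_deg. c i *s curve_basis i) = 0" and i: "i \<le> curve_deg"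
  shows "c i = 0"
proof -
  define L where "L p = (\<Sum>i\<le>curve_deg. c i * coeff p i)" for p
  have L_add: "L (p + s) = L p + L s" and L_smult: "L (smult x p) = x * L p" for p s x
    by (simp_all add: L_def sum.distrib sum_distrib_left algebra_simps)
  have L_monom: "L (monom 1 i) = c i" if "i \<le> curve_deg" for i
    using that by (simp add: L_def if_distrib cong: if_cong)
  have z: "(\<Sum>i\<le>curve_deg. c i *s shifted_coeffs (form_poly a1 * form_poly a2) i) = 0" "(\<Sum>i\<le>curve_deg. c i *s shifted_coeffs (form_poly a2 * form_poly a) i) = 0"
    "(\<Sum>i\<le>curve_deg. c i *s shifted_coeffs (form_poly a * form_poly a1) i) = 0"
    using c by (simp_all add: curve_basis_def Phi_linear Phi_sum Phi_eq_0_iff)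
  have cf0: "L (monom 1 j * g) = 0" if g: "(\<Sum>i\<le>curve_deg. c i *s shifted_coeffs g i) = 0" and j: "j \<le> 2" for g j
  proof -
    have "L g = 0" "L (pCons 0 g) = 0" "L (pCons 0 (pCons 0 g)) = 0"
      using g by (simp_all add: L_def shifted_coeffs_def vec3_eq_iff)
    moreover have "j = 0 \<or> j = 1 \<or> j = 2" using j by linarith
    ultimately show ?thesis
      by (auto simp: monom_0 monom_Suc numeral_2_eq_2)
  qed
  \<comment> \<open>Replacing one factor by a2 = x a + y a1 in the mixed products brings in the
    squares of \<open>form_poly a\<close> and \<open>form_poly a1\<close>; x and y are nonzero, so
    \<open>L\<close> kills these too. By bilinearity this covers all products of two forms vanishing
    at \<open>t\<close>.\<close>
  have perp: "L (monom 1 j * (form_poly v * form_poly w)) = 0" if "dot v t = 0" "dot w t = 0" "j \<le> 2" for v w j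
  proof -
    obtain x y where xy: "a2 = x *s a + y *s a1" "x \<noteq> 0" "y \<noteq> 0"
      by (rule a2_combination)
    let ?m = "monom 1 j :: 'a poly"
    have 1: "L (?m * (form_poly a * form_poly a1)) = 0" and 2: "L (?m * (form_poly a2 * form_poly a)) = 0"
      and 3: "L (?m * (form_poly a1 * form_poly a2)) = 0"
      by (rule cf0[OF z(3) that(3)], rule cf0[OF z(2) that(3)], rule cf0[OF z(1) that(3)])
    have p2: "form_poly a2 = smult x (form_poly a) + smult y (form_poly a1)"
      unfolding xy(1) by (simp add: form_poly_linear)
    have "?m * (form_poly a2 * form_poly a) = smult x (?m * (form_poly a * form_poly a)) + smult y (?m * (form_poly a * form_poly a1))"
      unfolding p2 by (simp add: algebra_simps)
    then have "L (?m * (form_poly a2 * form_poly a)) = x * L (?m * (form_poly a * form_poly a)) + y * L (?m * (form_poly a * form_poly a1))"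
      by (simp only: L_add L_smult)
    with 1 2 xy(2) have 4: "L (?m * (form_poly a * form_poly a)) = 0" by simp
    have "?m * (form_poly a1 * form_poly a2) = smult x (?m * (form_poly a * form_poly a1)) + smult y (?m * (form_poly a1 * form_poly a1))"
      unfolding p2 by (simp add: algebra_simps)
    then have "L (?m * (form_poly a1 * form_poly a2)) = x * L (?m * (form_poly a * form_poly a1)) + y * L (?m * (form_poly a1 * form_poly a1))"
      by (simp only: L_add L_smult)
    with 1 3 xy(3) have 5: "L (?m * (form_poly a1 * form_poly a1)) = 0" by simp
    obtain v1 v2 where v: "v = v1 *s a + v2 *s a1"
      using t_perp[OF \<open>dot v t = 0\<close>] by blast
    obtain w1 w2 where w: "w = w1 *s a + w2 *s a1"
      using t_perp[OF \<open>dot w t = 0\<close>] by blast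
    have "?m * (form_poly v * form_poly w) = smult (v1 * w1) (?m * (form_poly a * form_poly a)) + smult (v1 * w2) (?m * (form_poly a * form_poly a1))
      + (smult (v2 * w1) (?m * (form_poly a * form_poly a1)) + smult (v2 * w2) (?m * (form_poly a1 * form_poly a1)))"
      unfolding v w by (simp add: form_poly_linear algebra_simps smult_add_right)
    then have "L (?m * (form_poly v * form_poly w)) = v1 * w1 * L (?m * (form_poly a * form_poly a)) + v1 * w2 * L (?m * (form_poly a * form_poly a1))
      + (v2 * w1 * L (?m * (form_poly a * form_poly a1)) + v2 * w2 * L (?m * (form_poly a1 * form_poly a1)))"
      by (simp only: L_add L_smult)
    with 1 4 5 show ?thesis by simp
  qed
  show "c i = 0"
  proof (cases "a $ 3 = 0")
    case True
    then have curve_deg: "curve_deg = 4" by (simp add: curve_deg_def)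
    obtain d where "e3 = d *s t"
      using tangent[of e3] True by (auto simp: dot_def)
    then have "d *s t = e3" ..
    then have "t $ 1 = 0" "t $ 2 = 0"
      by (auto simp: vec3_eq_iff)
    \<comment> \<open>Now \<open>t\<close> is proportional to \<open>e3\<close>, and the forms
      vanishing at \<open>t\<close> are spanned by 1 and X. Products of two of them, shifted by at
      most X^2, reach every power up to 4.\<close>
    define u where "u = (vector [1, 0, 0] :: 'a ^ 3)"
    define v where "v = (vector [0, 1, 0] :: 'a ^ 3)"
    have uv: "dot u t = 0" "dot v t = 0" "form_poly u = 1" "form_poly v = monom 1 1"
      using \<open>t $ 1 = 0\<close> \<open>t $ 2 = 0\<close> by (simp_all add: u_def v_def dot_def form_poly_def monom_Suc monom_0)
    have "i = i - 2 + 1 + 1 \<or> i \<le> 2" by linarith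
    then have "L (monom 1 i) = 0"
    proof
      assume "i \<le> 2"
      then show ?thesis using perp[of u u i] uv by simp
    next
      assume i': "i = i - 2 + 1 + 1"
      have "L (monom 1 (i - 2) * (form_poly v * form_poly v)) = 0"
        by (rule perp) (use uv i curve_deg in auto)
      moreover have "monom 1 (i - 2) * (form_poly v * form_poly v) = monom 1 i"
        using i' unfolding uv by (simp add: mult_monom)
      ultimately show ?thesis by simp
    qed
    then show ?thesis using L_monom[OF i] by simp
  next
    case False
    then have curve_deg: "curve_deg = 6" by (simp add: curve_deg_def)
    have expand: "L (monom 1 j * (form_poly v * g)) = v $ 1 * L (monom 1 j * g) + v $ 2 * L (monom 1 (j + 1) * g)
        + v $ 3 * L (monom 1 (j + 2) * g)" for v j g
    proof -
      have "form_poly v = smult (v $ 1) (monom 1 0) + smult (v $ 2) (monom 1 1) + smult (v $ 3) (monom 1 2)"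
        by (simp add: form_poly_def monom_0 monom_Suc numeral_2_eq_2)
      then have "monom 1 j * (form_poly v * g) = smult (v $ 1) (monom 1 j * g) + smult (v $ 2) (monom 1 (j + 1) * g)
        + smult (v $ 3) (monom 1 (j + 2) * g)"
        by (simp add: algebra_simps mult_monom flip: mult.assoc)
      then show ?thesis by (simp only: L_add L_smult)
    qed
    have window: "L (monom 1 k * g) = 0"
      if z: "\<And>v j. dot v t = 0 \<Longrightarrow> j \<le> n \<Longrightarrow> L (monom 1 j * (form_poly v * g)) = 0"
        and n: "n \<ge> 1" "k \<le> n + 2" for g n k
    proof -
      \<comment> \<open>Three consecutive values of \<open>L\<close> on the shifts of
        \<open>g\<close> form a vector orthogonal to every form vanishing at \<open>t\<close>, hence
        a multiple of \<open>t\<close>; \<open>window_zero\<close> then applies because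
        \<open>t\<close> is off the conic.\<close>
      have "\<exists>\<mu>. L (monom 1 j * g) = \<mu> * t $ 1 \<and> L (monom 1 (j + 1) * g) = \<mu> * t $ 2
          \<and> L (monom 1 (j + 2) * g) = \<mu> * t $ 3" if "j \<le> n" for j
      proof -
        let ?w = "vector [L (monom 1 j * g), L (monom 1 (j + 1) * g), L (monom 1 (j + 2) * g)] :: 'a ^ 3"
        have "dot v ?w = 0" if "dot v t = 0" for v
          using z[OF that \<open>j \<le> n\<close>] expand[of j v g] by (simp add: dot_def)
        then have "\<exists>c. ?w = c *s t"
          by (intro orthogonal_imp_t[OF cross_a_a1]) auto
        then show ?thesis
          by (auto simp: vec3_eq_iff)
      qed
      then have "\<exists>\<mu>. \<forall>j. j \<le> n \<longrightarrow> L (monom 1 j * g) = \<mu> j * t $ 1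
          \<and> L (monom 1 (j + 1) * g) = \<mu> j * t $ 2 \<and> L (monom 1 (j + 2) * g) = \<mu> j * t $ 3"
        by (intro choice) blast
      then obtain \<mu> where \<mu>: "\<And>j. j \<le> n \<Longrightarrow> L (monom 1 j * g) = \<mu> j * t $ 1
          \<and> L (monom 1 (j + 1) * g) = \<mu> j * t $ 2 \<and> L (monom 1 (j + 2) * g) = \<mu> j * t $ 3"
        by blast
      show ?thesis
        by (rule window_zero[where d = "\<lambda>k. L (monom 1 k * g)", OF nt[OF False] n(1) \<mu> n(2)])
    qed
    \<comment> \<open>Stripping the first form extends the range of shifts from 2 to 4; stripping
      the second extends it from 4 to 6, which is all of \<open>curve_deg\<close>.\<close>
    have w4: "L (monom 1 k * form_poly w) = 0" if "dot w t = 0" "k \<le> 4" for w k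
    proof (rule window[where n = 2])
      show "L (monom 1 j * (form_poly v * form_poly w)) = 0" if "dot v t = 0" "j \<le> 2" for v j
        by (rule perp) fact+
    qed (use \<open>k \<le> 4\<close> in simp_all)
    have "L (monom 1 i * 1) = 0"
    proof (rule window[where n = 4])
      show "L (monom 1 j * (form_poly v * 1)) = 0" if "dot v t = 0" "j \<le> 4" for v j
        using w4[OF that] by simp
    qed (use i curve_deg in simp_all)
    then show ?thesis using L_monom[OF i] by simp
  qed
qed

end

section \<open>Interpolation and the spans of the spaces at infinity\<close>

lemma lagrange3:
  fixes x0 x1 x2 :: "'a::field"
  assumes "x0 \<noteq> x1" "x0 \<noteq> x2"
  shows "\<exists>\<alpha> \<beta> \<gamma>. \<alpha> + \<beta> * x0 + \<gamma> * x0 ^ 2 = 1 \<and> \<alpha> + \<beta> * x1 + \<gamma> * x1 ^ 2 = 0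
    \<and> \<alpha> + \<beta> * x2 + \<gamma> * x2 ^ 2 = 0"
proof -
  \<comment> \<open>The coefficients are those of (X - x1) (X - x2), divided by its value at
    x0.\<close>
  define d where "d = 1 / ((x0 - x1) * (x0 - x2))"
  have "d * ((x0 - x1) * (x0 - x2)) = 1"
    using assms by (simp add: d_def)
  then show ?thesis
    by (intro exI[of _ "d * (x1 * x2)"] exI[of _ "- d * (x1 + x2)"] exI[of _ d])
      (auto simp: algebra_simps power2_eq_square)
qed

text \<open>The triple product identity gives \<open>cross a (cross u n)\<close> = (a . n) u - (a .
  u) n.\<close>

lemma perp_eq_cross:
  assumes "dot a n = 1" "dot a u = (0 :: 'a::field)"
  shows "u = cross a (cross u n)"
proof -
  have n: "a $ 1 * n $ 1 + a $ 2 * n $ 2 + a $ 3 * n $ 3 = 1"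
    and u: "a $ 1 * u $ 1 + a $ 2 * u $ 2 + a $ 3 * u $ 3 = 0"
    using assms by (simp_all add: dot_def)
  show ?thesis
    unfolding vec3_eq_iff cross_component using n u by (intro conjI) algebra+
qed

lemma cross_expand:
  "cross a z = z $ 1 *s cross a (axis 1 1) + z $ 2 *s cross a (axis 2 1) + z $ 3 *s cross a (axis 3 1 :: 'a::field ^ 3)"
  by (simp add: vec3_eq_iff axis_def)

text \<open>Three vectors span the plane orthogonal to \<open>a\<close> redundantly, but they have a
  uniform formula that commutes with Frobenius and needs no choice of a nonzero coordinate.\<close>

lemma perp_span:
  assumes "dot a n = 1" "dot a u = (0 :: 'a::field)"
  shows "\<exists>z :: 'a ^ 3. u = z $ 1 *s cross a (axis 1 1) + z $ 2 *s cross a (axis 2 1) + z $ 3 *s cross a (axis 3 1)"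
  using trans[OF perp_eq_cross[OF assms] cross_expand] by blast

context bose_frame
begin

text \<open>The spans of \<open>\<Sigma>inf\<close> and, if \<open>a\<close> is scaled suitably, of \<open>\<Sigma>6\<close>.\<close>

definition W6 :: "('a ^ 9) set" where
  "W6 = {Phi u0 u1 u2 | u0 u1 u2. dot a u0 = 0 \<and> dot a1 u1 = 0 \<and> dot a2 u2 = 0}"

definition W7 :: "('a ^ 9) set" where
  "W7 = {Phi u0 u1 u2 | u0 u1 u2. dot a u0 = dot a1 u1 \<and> dot a1 u1 = dot a2 u2}"

lemma Phi_in_W6: "Phi u0 u1 u2 \<in> W6 \<longleftrightarrow> dot a u0 = 0 \<and> dot a1 u1 = 0 \<and> dot a2 u2 = 0"
  by (auto simp: W6_def Phi_eq_iff)

lemma Phi_in_W7: "Phi u0 u1 u2 \<in> W7 \<longleftrightarrow> dot a u0 = dot a1 u1 \<and> dot a1 u1 = dot a2 u2"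
  by (auto simp: W7_def Phi_eq_iff)

lemma subspace_W6: "vec.subspace W6"
proof (rule vec.subspaceI)
  show "0 \<in> W6"
    using Phi_in_W6[of 0 0 0] by (simp add: Phi_linear)
next
  fix x y assume "x \<in> W6" "y \<in> W6"
  then show "x + y \<in> W6"
    by (auto simp: W6_def Phi_linear Phi_eq_iff)
next
  fix c x assume "x \<in> W6"
  then show "c *s x \<in> W6"
    by (auto simp: W6_def Phi_linear Phi_eq_iff)
qed

lemma subspace_W7: "vec.subspace W7"
proof (rule vec.subspaceI)
  show "0 \<in> W7"
    using Phi_in_W7[of 0 0 0] by (simp add: Phi_linear)
next
  fix x y assume "x \<in> W7" "y \<in> W7"
  then show "x + y \<in> W7"
    by (auto simp: W7_def Phi_linear Phi_eq_iff)
next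
  fix c x assume "x \<in> W7"
  then show "c *s x \<in> W7"
    by (auto simp: W7_def Phi_linear Phi_eq_iff)
qed

lemma a_dual: obtains n where "dot a n = 1"
proof -
  have "a $ i \<noteq> 0 \<Longrightarrow> dot a (axis i (1 / a $ i)) = 1" for i
    using exhaust_3[of i] by (auto simp: dot_def axis_def)
  then show thesis
    using that a_nonzero by (auto simp: vec_eq_iff)
qed

lemma a_dual': assumes "dot a n = 1" shows "dot a1 (frob_vec q n) = 1" "dot a2 (frob_vec (q ^ 2) n) = 1"
  using frob_vec_dot[of q a n] frob_vec_dot[of "q ^ 2" a n] assms by simp_all

text \<open>Each of the three equations of \<open>W6\<close> is broken by exactly one of the vectors
  \<open>x\<close>, \<open>y\<close>, \<open>z\<close>, which therefore complete it to the
  9-dimensional space one dimension at a time.\<close>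

lemma dim_W6: "vec.dim W6 = 6"
proof -
  obtain n where n: "dot a n = 1" by (rule a_dual)
  note n' = a_dual'[OF n]
  define x where "x = Phi n 0 0"
  define y where "y = Phi 0 (frob_vec q n) 0"
  define z where "z = Phi 0 0 (frob_vec (q ^ 2) n)"
  have sp: "vec.span W6 = W6"
    using subspace_W6 by simp
  have 1: "x \<notin> vec.span W6"
    by (simp add: sp x_def Phi_in_W6 n)
  have 2: "y \<notin> vec.span (insert x W6)"
    unfolding vec.span_breakdown_eq sp
    by (simp add: x_def y_def Phi_linear Phi_in_W6 n n')
  have 3: "z \<notin> vec.span (insert y (insert x W6))"
    unfolding vec.span_breakdown_eq sp
    by (simp add: x_def y_def z_def Phi_linear Phi_in_W6 n n')
  have "v \<in> vec.span (insert z (insert y (insert x W6)))" for v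
  proof -
    obtain u0 u1 u2 where v: "v = Phi u0 u1 u2" by (rule Phi_cases)
    have "v - dot a2 u2 *s z - dot a1 u1 *s y - dot a u0 *s x \<in> W6"
      by (simp add: v x_def y_def z_def Phi_linear Phi_in_W6 n n')
    then show ?thesis
      unfolding vec.span_breakdown_eq sp by blast
  qed
  then have "vec.span (insert z (insert y (insert x W6))) = UNIV"
    by blast
  then have "vec.dim (insert z (insert y (insert x W6))) = vec.dim (UNIV :: ('a ^ 9) set)"
    by (metis vec.dim_span)
  also have "\<dots> = CARD(9)"
    by (simp only: vec.dim_UNIV card_cart_basis)
  finally show ?thesis
    using 1 2 3 by (simp add: vec.dim_insert)
qed

lemma rational_Phi: "u \<in> rational (GF (q ^ 3)) \<Longrightarrow> Phi u (frob_vec q u) (frob_vec (q ^ 2) u) \<in> rational (GF q)"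
  by (simp add: rational_iff_frob_vec frob_vec_Phi frob_vec_frob_vec power2_eq_square power3_eq_cube mult.assoc)

lemma rational_PhiD:
  assumes "Phi u0 u1 u2 \<in> rational (GF q)"
  shows "u0 \<in> rational (GF (q ^ 3))" "u1 = frob_vec q u0" "u2 = frob_vec (q ^ 2) u0"
proof -
  have "frob_vec q u2 = u0" "frob_vec q u0 = u1" "frob_vec q u1 = u2"
    using assms by (simp_all add: rational_iff_frob_vec frob_vec_Phi Phi_eq_iff)
  moreover have "frob_vec (q ^ 2) u0 = frob_vec q (frob_vec q u0)" "frob_vec (q ^ 3) u0 = frob_vec q (frob_vec q (frob_vec q u0))"
    by (simp_all add: frob_vec_frob_vec power2_eq_square power3_eq_cube mult.assoc)
  ultimately show "u1 = frob_vec q u0" "u2 = frob_vec (q ^ 2) u0" "u0 \<in> rational (GF (q ^ 3))"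
    by (simp_all add: rational_iff_frob_vec)
qed

text \<open>
  Galois descent: the twists of a vector by \<open>1, \<omega>, \<omega> ^ 2\<close> give rational vectors from which its
  three components are recovered by interpolation at the conjugates of \<open>\<omega>\<close>.
\<close>

lemma descent:
  assumes S: "vec.subspace S" and y: "y \<in> rational (GF (q ^ 3))"
    and mem: "\<And>c. c \<in> GF (q ^ 3) \<Longrightarrow> Phi (c *s y) (frob_vec q (c *s y)) (frob_vec (q ^ 2) (c *s y)) \<in> S"
  shows "Phi y 0 0 \<in> S" "Phi 0 (frob_vec q y) 0 \<in> S" "Phi 0 0 (frob_vec (q ^ 2) y) \<in> S"
proof -
  have "\<not> GF (q ^ 3) \<subseteq> (GF q :: 'a set)"
  proof
    assume "GF (q ^ 3) \<subseteq> (GF q :: 'a set)"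
    then have "q ^ 3 \<le> q"
      using card_mono[of "GF q :: 'a set" "GF (q ^ 3)"] by (simp add: card_GF_q card_GF_q3)
    moreover have "q ^ 1 < q ^ 3"
      using q_gt_1 by (intro power_strict_increasing) auto
    ultimately show False by simp
  qed
  then obtain \<omega> :: 'a where \<omega>: "\<omega> \<in> GF (q ^ 3)" "\<omega> \<notin> GF q" by blast
  define x1 where "x1 = \<omega> ^ q"
  define x2 where "x2 = \<omega> ^ (q ^ 2)"
  have conj: "x1 ^ q = x2" "x2 ^ q = \<omega>"
    using \<omega>(1) by (simp_all add: x1_def x2_def GF_def power2_eq_square power3_eq_cube mult.assoc flip: power_mult)
  \<comment> \<open>Frobenius carries the pair (\<omega>, x1) to (x1, x2) and then to (x2,
    \<omega>), so one inequality yields all three.\<close>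
  have "\<omega> \<noteq> x1"
    using \<omega>(2) by (auto simp: x1_def GF_def)
  moreover from this have "x1 \<noteq> x2" "x2 \<noteq> \<omega>"
    using frob_inj[of q \<omega> x1] frob_inj[of q x1 x2] conj x1_def by auto
  ultimately have ne: "\<omega> \<noteq> x1" "x1 \<noteq> x2" "x2 \<noteq> \<omega>" "x1 \<noteq> \<omega>" "x2 \<noteq> x1" "\<omega> \<noteq> x2"
    by auto
  have comb: "Phi ((\<alpha> + \<beta> * \<omega> + \<gamma> * \<omega> ^ 2) *s y) ((\<alpha> + \<beta> * x1 + \<gamma> * x1 ^ 2) *s frob_vec q y)
      ((\<alpha> + \<beta> * x2 + \<gamma> * x2 ^ 2) *s frob_vec (q ^ 2) y) \<in> S" for \<alpha> \<beta> \<gamma>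
  proof -
    let ?v = "\<lambda>c. Phi (c *s y) (frob_vec q (c *s y)) (frob_vec (q ^ 2) (c *s y))"
    have pw: "(\<omega> ^ 2) ^ q = x1 ^ 2" "(\<omega> ^ 2) ^ (q ^ 2) = x2 ^ 2"
      by (simp_all add: x1_def x2_def mult.commute flip: power_mult)
    have "?v 1 \<in> S" "?v \<omega> \<in> S" "?v (\<omega> ^ 2) \<in> S"
      by (rule mem, simp, rule mem, rule \<omega>, rule mem, rule GF_power, rule \<omega>)
    then have "\<alpha> *s ?v 1 + \<beta> *s ?v \<omega> + \<gamma> *s ?v (\<omega> ^ 2) \<in> S"
      using S by (blast intro: vec.subspace_add vec.subspace_scale)
    also have "\<alpha> *s ?v 1 + \<beta> *s ?v \<omega> + \<gamma> *s ?v (\<omega> ^ 2) =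
        Phi ((\<alpha> + \<beta> * \<omega> + \<gamma> * \<omega> ^ 2) *s y) ((\<alpha> + \<beta> * x1 + \<gamma> * x1 ^ 2) *s frob_vec q y)
      ((\<alpha> + \<beta> * x2 + \<gamma> * x2 ^ 2) *s frob_vec (q ^ 2) y)"
      unfolding frob_vec_scale pw x1_def[symmetric] x2_def[symmetric]
      by (simp add: Phi_linear Phi_eq_iff algebra_simps)
    finally show ?thesis .
  qed
  obtain \<alpha> \<beta> \<gamma> where "\<alpha> + \<beta> * \<omega> + \<gamma> * \<omega> ^ 2 = 1 \<and> \<alpha> + \<beta> * x1 + \<gamma> * x1 ^ 2 = 0
      \<and> \<alpha> + \<beta> * x2 + \<gamma> * x2 ^ 2 = 0"
    using lagrange3[of \<omega> x1 x2] ne by blast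
  with comb[of \<alpha> \<beta> \<gamma>] show "Phi y 0 0 \<in> S" by simp
  obtain \<alpha> \<beta> \<gamma> where "\<alpha> + \<beta> * x1 + \<gamma> * x1 ^ 2 = 1 \<and> \<alpha> + \<beta> * \<omega> + \<gamma> * \<omega> ^ 2 = 0
      \<and> \<alpha> + \<beta> * x2 + \<gamma> * x2 ^ 2 = 0"
    using lagrange3[of x1 \<omega> x2] ne by blast
  with comb[of \<alpha> \<beta> \<gamma>] show "Phi 0 (frob_vec q y) 0 \<in> S" by simp
  obtain \<alpha> \<beta> \<gamma> where "\<alpha> + \<beta> * x2 + \<gamma> * x2 ^ 2 = 1 \<and> \<alpha> + \<beta> * \<omega> + \<gamma> * \<omega> ^ 2 = 0
      \<and> \<alpha> + \<beta> * x1 + \<gamma> * x1 ^ 2 = 0"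
    using lagrange3[of x2 \<omega> x1] ne by blast
  with comb[of \<alpha> \<beta> \<gamma>] show "Phi 0 0 (frob_vec (q ^ 2) y) \<in> S" by simp
qed

text \<open>The \<open>GF q\<close>-vectors at infinity span \<open>W6\<close> over the ambient
  field: descent is applied to the spanning vectors \<open>cross a (axis i 1)\<close>, whose
  conjugates span the planes orthogonal to \<open>a1\<close> and \<open>a2\<close>.\<close>

lemma W6_subset:
  assumes S: "vec.subspace S"
    and mem: "\<And>y. y \<in> rational (GF (q ^ 3)) \<Longrightarrow> dot a y = 0 \<Longrightarrow> Phi y (frob_vec q y) (frob_vec (q ^ 2) y) \<in> S"
  shows "W6 \<subseteq> S"
proof
  fix x assume "x \<in> W6"
  then obtain u0 u1 u2 where x: "x = Phi u0 u1 u2" and u: "dot a u0 = 0" "dot a1 u1 = 0" "dot a2 u2 = 0"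
    by (auto simp: W6_def)
  obtain n where n: "dot a n = 1" by (rule a_dual)
  note n' = a_dual'[OF n]
  define e where "e i = cross a (axis i 1)" for i
  have fe: "frob_vec q (e i) = cross a1 (axis i 1)" "frob_vec (q ^ 2) (e i) = cross a2 (axis i 1)" for i
  proof -
    have "frob_vec m (axis i 1) = (axis i 1 :: 'a ^ 3)" if "fexp m" for m
      using fexp_pos[OF that] by (simp add: vec_eq_iff axis_def power_0_left)
    then show "frob_vec q (e i) = cross a1 (axis i 1)" "frob_vec (q ^ 2) (e i) = cross a2 (axis i 1)"
      by (simp_all add: e_def frob_vec_cross)
  qed
  have e: "e i \<in> rational (GF (q ^ 3))" for i
  proof -
    have "frob_vec (q ^ 3) (axis i 1) = (axis i 1 :: 'a ^ 3)"
      using q_gt_1 by (simp add: vec_eq_iff axis_def power_0_left)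
    then show ?thesis
      using a by (simp add: rational_iff_frob_vec e_def frob_vec_cross)
  qed
  have "Phi (c *s e i) (frob_vec q (c *s e i)) (frob_vec (q ^ 2) (c *s e i)) \<in> S" if "c \<in> GF (q ^ 3)" for c i
    by (rule mem) (use that e in \<open>auto intro: rational_closed simp: e_def\<close>)
  note d = descent[OF S e this]
  obtain z :: "'a ^ 3" where z: "u0 = z $ 1 *s e 1 + z $ 2 *s e 2 + z $ 3 *s e 3"
    using perp_span[OF n u(1)] unfolding e_def by blast
  have "Phi u0 0 0 = z $ 1 *s Phi (e 1) 0 0 + z $ 2 *s Phi (e 2) 0 0 + z $ 3 *s Phi (e 3) 0 0"
    by (simp add: Phi_linear z)
  then have 0: "Phi u0 0 0 \<in> S"
    by (simp add: vec.subspace_add vec.subspace_scale S d)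
  obtain z :: "'a ^ 3" where z: "u1 = z $ 1 *s frob_vec q (e 1) + z $ 2 *s frob_vec q (e 2) + z $ 3 *s frob_vec q (e 3)"
    using perp_span[OF n'(1) u(2)] unfolding fe by blast
  have "Phi 0 u1 0 = z $ 1 *s Phi 0 (frob_vec q (e 1)) 0 + z $ 2 *s Phi 0 (frob_vec q (e 2)) 0 + z $ 3 *s Phi 0 (frob_vec q (e 3)) 0"
    by (simp add: Phi_linear z)
  then have 1: "Phi 0 u1 0 \<in> S"
    by (simp add: vec.subspace_add vec.subspace_scale S d)
  obtain z :: "'a ^ 3" where z: "u2 = z $ 1 *s frob_vec (q ^ 2) (e 1) + z $ 2 *s frob_vec (q ^ 2) (e 2) + z $ 3 *s frob_vec (q ^ 2) (e 3)"
    using perp_span[OF n'(2) u(3)] unfolding fe by blast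
  have "Phi 0 0 u2 = z $ 1 *s Phi 0 0 (frob_vec (q ^ 2) (e 1)) + z $ 2 *s Phi 0 0 (frob_vec (q ^ 2) (e 2)) + z $ 3 *s Phi 0 0 (frob_vec (q ^ 2) (e 3))"
    by (simp add: Phi_linear z)
  then have 2: "Phi 0 0 u2 \<in> S"
    by (simp add: vec.subspace_add vec.subspace_scale S d)
  have "x = Phi u0 0 0 + Phi 0 u1 0 + Phi 0 0 u2"
    by (simp add: Phi_linear x)
  then show "x \<in> S"
    using 0 1 2 S by (simp add: vec.subspace_add)
qed

definition G :: "('a ^ 9) set set" where
  "G = {pt (H *v y) | y. y \<in> rational (GF (q ^ 3)) \<and> y \<noteq> 0 \<and> dot a y = 0}"

definition Sigma_inf :: "('a ^ 9) set set" where
  "Sigma_inf = pspan (GF q) (G \<union> frob q ` G \<union> frob (q ^ 2) ` G)"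

lemma H_eq_Phi: "H *v y = Phi y 0 0" "frob_mat q H *v y = Phi 0 y 0" "frob_mat (q ^ 2) H *v y = Phi 0 0 y"
  by (simp_all add: Phi_def)

lemma frob_pt_Phi: "frob q (pt (Phi u0 u1 u2)) = pt (Phi (frob_vec q u2) (frob_vec q u0) (frob_vec q u1))"
  "frob (q ^ 2) (pt (Phi u0 u1 u2)) = pt (Phi (frob_vec (q ^ 2) u1) (frob_vec (q ^ 2) u2) (frob_vec (q ^ 2) u0))"
proof -
  show 1: "frob q (pt (Phi u0 u1 u2)) = pt (Phi (frob_vec q u2) (frob_vec q u0) (frob_vec q u1))" for u0 u1 u2
    by (simp add: frob_pt frob_vec_Phi)
  have fr2: "frob_vec (q ^ 2) v = frob_vec q (frob_vec q v)" for v :: "'a ^ 'n"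
    by (simp add: frob_vec_frob_vec power2_eq_square)
  show "frob (q ^ 2) (pt (Phi u0 u1 u2)) = pt (Phi (frob_vec (q ^ 2) u1) (frob_vec (q ^ 2) u2) (frob_vec (q ^ 2) u0))"
    by (simp only: frob_pt[OF fexp(1)] fr2 frob_vec_Phi)
qed

text \<open>\<open>Sigma_inf\<close> consists of \<open>GF q\<close>-points only, yet its ambient
  span must be the full \<open>W6\<close>; by \<open>W6_subset\<close> it is enough to see that it
  contains the sum of every vector on \<open>g\<close> and its two conjugates.\<close>

lemma span_Sigma_inf: "vec.span (\<Union>Sigma_inf) = W6"
proof
  have G: "\<Union>G \<subseteq> W6" "\<Union>(frob q ` G) \<subseteq> W6" "\<Union>(frob (q ^ 2) ` G) \<subseteq> W6"
  proof -
    have z: "dot a1 (frob_vec q y) = 0" "dot a2 (frob_vec (q ^ 2) y) = 0" if "dot a y = 0" for y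
      using frob_vec_dot[of q a y] frob_vec_dot[of "q ^ 2" a y] that q_gt_1 by (simp_all add: power_0_left)
    have f0: "frob_vec m (0 :: 'a ^ 3) = 0" if "fexp m" for m
      using that by (simp add: frob_vec_eq_0_iff)
    have "X \<subseteq> W6 \<and> frob q X \<subseteq> W6 \<and> frob (q ^ 2) X \<subseteq> W6" if "X \<in> G" for X
    proof -
      obtain y where y: "X = pt (Phi y 0 0)" "dot a y = 0"
        using \<open>X \<in> G\<close> unfolding G_def H_eq_Phi by blast
      show ?thesis
        unfolding y(1) frob_pt_Phi pt_subset_iff[OF subspace_W6]
        using y(2) by (simp add: Phi_in_W6 f0 z)
    qed
    then show "\<Union>G \<subseteq> W6" "\<Union>(frob q ` G) \<subseteq> W6" "\<Union>(frob (q ^ 2) ` G) \<subseteq> W6"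
      by blast+
  qed
  then have "vec.span (\<Union>(G \<union> frob q ` G \<union> frob (q ^ 2) ` G)) \<subseteq> W6"
    by (intro vec.span_minimal subspace_W6) auto
  then have "\<Union>Sigma_inf \<subseteq> W6"
    by (auto simp: Sigma_inf_def pspan_def)
  then show "vec.span (\<Union>Sigma_inf) \<subseteq> W6"
    by (intro vec.span_minimal subspace_W6)
next
  show "W6 \<subseteq> vec.span (\<Union>Sigma_inf)"
  proof (rule W6_subset)
    fix y assume y: "y \<in> rational (GF (q ^ 3))" "dot a y = 0"
    let ?v = "Phi y (frob_vec q y) (frob_vec (q ^ 2) y)"
    show "?v \<in> vec.span (\<Union>Sigma_inf)"
    proof (cases "y = 0")
      case True
      then have "?v = 0"
        by (simp add: Phi_eq_0_iff frob_vec_eq_0_iff)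
      then show ?thesis by (simp add: vec.span_zero)
    next
      case False
      let ?U = "G \<union> frob q ` G \<union> frob (q ^ 2) ` G"
      have g: "pt (Phi y 0 0) \<in> G"
        using y False unfolding G_def H_eq_Phi by blast
      have "frob_vec m (0 :: 'a ^ 3) = 0" if "fexp m" for m
        using that by (simp add: frob_vec_eq_0_iff)
      then have "pt (Phi 0 (frob_vec q y) 0) = frob q (pt (Phi y 0 0))"
          "pt (Phi 0 0 (frob_vec (q ^ 2) y)) = frob (q ^ 2) (pt (Phi y 0 0))"
        by (simp_all add: frob_pt_Phi)
      with g have mem: "pt (Phi y 0 0) \<in> ?U" "pt (Phi 0 (frob_vec q y) 0) \<in> ?U" "pt (Phi 0 0 (frob_vec (q ^ 2) y)) \<in> ?U"
        by auto
      have "x \<in> vec.span (\<Union>?U)" if "pt x \<in> ?U" for x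
        using that vec.span_base[of x "{x}"] by (intro vec.span_base) blast
      from this[OF mem(1)] this[OF mem(2)] this[OF mem(3)]
      have "Phi y 0 0 + Phi 0 (frob_vec q y) 0 + Phi 0 0 (frob_vec (q ^ 2) y) \<in> vec.span (\<Union>?U)"
        by (intro vec.span_add)
      then have "?v \<in> vec.span (\<Union>?U)"
        by (simp add: Phi_linear)
      moreover have "?v \<noteq> 0"
        using False by (simp add: Phi_eq_0_iff)
      ultimately have "pt ?v \<in> Sigma_inf"
        unfolding Sigma_inf_def pspan_iff using rational_Phi[OF y(1)] by blast
      then show ?thesis
        using vec.span_base[of ?v "{?v}"] by (intro vec.span_base) blast
    qed
  qed simp
qed

lemma bose_frame_scale:
  assumes "c \<in> GF (q ^ 3)" "c \<noteq> 0"
  shows "bose_frame q H (c *s a) t"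
  using bose_frame_axioms assms unfolding bose_frame_def bose_frame_axioms_def
  by (auto intro: rational_closed)

text \<open>The 6-space is spanned by \<open>W6\<close> and one \<open>GF q\<close>-point
  \<open>w\<close> off infinity, with value \<rho> under \<open>a\<close>. On the span, the values
  of \<open>a\<close>, \<open>a1\<close>, \<open>a2\<close> are in the ratio of \<rho> to its
  conjugates, so dividing \<open>a\<close> by \<rho> makes the three values equal.\<close>

lemma normalize:
  assumes S: "proj_subspace (GF q) 6 \<Sigma>" and sub: "Sigma_inf \<subseteq> \<Sigma>"
  obtains c where "c \<in> GF (q ^ 3)" "c \<noteq> 0"
    "vec.span (\<Union>\<Sigma>) = {Phi u0 u1 u2 | u0 u1 u2. dot (c *s a) u0 = dot (frob_vec q (c *s a)) u1
       \<and> dot (frob_vec q (c *s a)) u1 = dot (frob_vec (q ^ 2) (c *s a)) u2}"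
proof -
  let ?S = "vec.span (\<Union>\<Sigma>)"
  have W6: "W6 \<subseteq> ?S"
    using sub by (metis span_Sigma_inf vec.span_mono Union_mono)
  have dim: "vec.dim ?S = 7" and PG: "\<Sigma> \<subseteq> PG (GF q)"
    using S by (simp_all add: proj_subspace_def)
  have "\<not> \<Union>\<Sigma> \<subseteq> W6"
  proof
    assume "\<Union>\<Sigma> \<subseteq> W6"
    then have "vec.dim (\<Union>\<Sigma>) \<le> 6"
      using dim_W6 vec.dim_subset by metis
    with dim show False by simp
  qed
  then obtain X where X: "X \<in> \<Sigma>" "\<not> X \<subseteq> W6" by blast
  then obtain w where w: "w \<in> rational (GF q)" "X = pt w"
    using PG unfolding PG_def by blast
  have wS: "w \<in> ?S"
    using X w vec.span_base[of w "{w}"] by (intro vec.span_base) blast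
  have "w \<notin> W6"
    using X w pt_subset_iff[OF subspace_W6] by simp
  obtain u0 u1 u2 where wu': "w = Phi u0 u1 u2" by (rule Phi_cases)
  then have u0: "u0 \<in> rational (GF (q ^ 3))" and wu: "w = Phi u0 (frob_vec q u0) (frob_vec (q ^ 2) u0)"
    using rational_PhiD[of u0 u1 u2] w by auto
  define \<rho> where "\<rho> = dot a u0"
  have \<rho>12: "dot a1 (frob_vec q u0) = \<rho> ^ q" "dot a2 (frob_vec (q ^ 2) u0) = \<rho> ^ (q ^ 2)"
    using frob_vec_dot[of q a u0] frob_vec_dot[of "q ^ 2" a u0] by (simp_all add: \<rho>_def)
  have "\<rho> \<noteq> 0"
  proof
    assume "\<rho> = 0"
    then have "w \<in> W6"
      unfolding wu Phi_in_W6 \<rho>12 using q_gt_1 by (simp add: \<rho>_def power_0_left)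
    with \<open>w \<notin> W6\<close> show False ..
  qed
  define c where "c = 1 / \<rho>"
  have "\<rho> \<in> GF (q ^ 3)"
    using u0 a unfolding \<rho>_def dot_def by (intro GF_closed) (auto simp: rational3_iff)
  then have c: "c \<in> GF (q ^ 3)" "c \<noteq> 0"
    using \<open>\<rho> \<noteq> 0\<close> by (auto simp: c_def intro: GF_closed)
  have fc: "frob_vec q (c *s a) = (1 / \<rho> ^ q) *s a1" "frob_vec (q ^ 2) (c *s a) = (1 / \<rho> ^ (q ^ 2)) *s a2"
    by (simp_all add: frob_vec_scale c_def power_divide)
  have "w \<notin> vec.span W6"
    using \<open>w \<notin> W6\<close> subspace_W6 by (metis vec.span_eq_iff)
  then have "vec.dim (insert w W6) = 7"
    by (simp add: vec.dim_insert dim_W6)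
  then have "vec.span (insert w W6) = ?S"
    using wS W6 dim vec.span_minimal[of "insert w W6" ?S]
    by (intro vec.subspace_dim_equal) auto
  moreover have "vec.span (insert w W6) = {Phi u0 u1 u2 | u0 u1 u2. dot (c *s a) u0 = dot (frob_vec q (c *s a)) u1
       \<and> dot (frob_vec q (c *s a)) u1 = dot (frob_vec (q ^ 2) (c *s a)) u2}" (is "_ = ?R")
  proof -
    have "x \<in> vec.span (insert w W6) \<longleftrightarrow> x \<in> ?R" for x
    proof -
      obtain v0 v1 v2 where x: "x = Phi v0 v1 v2" by (rule Phi_cases)
      have "x \<in> vec.span (insert w W6) \<longleftrightarrow> (\<exists>k. x - k *s w \<in> W6)"
        unfolding vec.span_breakdown_eq vec.span_eq_iff[THEN iffD2, OF subspace_W6] ..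
      also have "\<dots> \<longleftrightarrow> (\<exists>k. dot a v0 = k * \<rho> \<and> dot a1 v1 = k * \<rho> ^ q \<and> dot a2 v2 = k * \<rho> ^ (q ^ 2))"
        by (simp add: x wu Phi_linear Phi_in_W6 \<rho>12 \<rho>_def[symmetric])
      also have "\<dots> \<longleftrightarrow> dot a v0 / \<rho> = dot a1 v1 / \<rho> ^ q \<and> dot a1 v1 / \<rho> ^ q = dot a2 v2 / \<rho> ^ (q ^ 2)"
        using \<open>\<rho> \<noteq> 0\<close> by (auto simp: divide_eq_eq intro: exI[of _ "dot a v0 / \<rho>"])
      also have "\<dots> \<longleftrightarrow> x \<in> ?R"
        unfolding fc x by (auto simp: c_def Phi_eq_iff)
      finally show ?thesis .
    qed
    then show ?thesis by blast
  qed
  ultimately show thesis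
    using that c by simp
qed

end

section \<open>Factored quadratics, spans of three points and linear forms\<close>

lemma form_poly_factor:
  assumes "v $ 3 * (x + y) = - v $ 2" "v $ 3 * (x * y) = (v $ 1 :: 'a::field)"
  shows "form_poly v = smult (v $ 3) ([:- x, 1:] * [:- y, 1:])"
proof -
  have "v $ 2 = - (v $ 3 * (x + y))" using assms(1) by simp
  then show ?thesis
    using assms(2) by (simp add: form_poly_def algebra_simps)
qed

lemma span_three_points:
  "x \<in> vec.span (\<Union>{pt u, pt v, pt w}) \<longleftrightarrow> (\<exists>k l m. x = k *s u + l *s v + m *s w)"
proof -
  have "vec.span (\<Union>{pt u, pt v, pt w}) = vec.span (pt u \<union> (pt v \<union> pt w))"
    by simp
  then have "x \<in> vec.span (\<Union>{pt u, pt v, pt w}) \<longleftrightarrow> (\<exists>p\<in>pt u. \<exists>s\<in>pt v. \<exists>t\<in>pt w. x = p + (s + t))"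
    unfolding vec.span_Un vec.span_span by blast
  then show ?thesis
    unfolding vec.span_singleton by (simp add: add.assoc)
qed

definition hdot :: "'a::field ^ 'n \<Rightarrow> 'a ^ 'n \<Rightarrow> 'a" where
  "hdot h x = (\<Sum>i\<in>UNIV. h $ i * x $ i)"

lemma hdot_linear: "hdot h (x + y) = hdot h x + hdot h y" "hdot h (c *s x) = c * hdot h x"
    "hdot h 0 = 0"
  by (simp_all add: hdot_def algebra_simps sum.distrib sum_distrib_left)

lemma hdot_sum: "hdot h (\<Sum>i\<in>A. f i) = (\<Sum>i\<in>A. hdot h (f i))"
  by (induction A rule: infinite_finite_induct) (simp_all add: hdot_linear)

lemma hyperplane_iff: "x \<in> hyperplane h \<longleftrightarrow> hdot h x = 0"
  by (simp add: hyperplane_def hdot_def)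

lemma subspace_hyperplane: "vec.subspace (hyperplane h)"
  by (rule vec.subspaceI) (auto simp: hyperplane_iff hdot_linear)

context frobenius_field
begin

lemma frob_vec_nu: "frob_vec m (nu \<theta>) = nu (\<theta> ^ m :: 'a)"
  by (simp add: vec3_eq_iff mult.commute flip: power_mult)

lemma rational_scale_sum:
  assumes "fexp m" "\<And>i. i \<in> A \<Longrightarrow> c i \<in> GF m" "\<And>i. i \<in> A \<Longrightarrow> b i \<in> rational (GF m)"
  shows "(\<Sum>i\<in>A. c i *s b i) \<in> (rational (GF m) :: ('a ^ 'n) set)"
  using assms by (auto simp: rational_def intro!: GF_sum GF_closed)

end

section \<open>The section by the 6-space\<close>

text \<open>\<open>span_S6\<close> fixes the scaling of \<open>a\<close>. By \<open>affine\<close>,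
  the tangency point is either \<open>e3\<close> or off the standard conic, which leaves just the
  two cases of the theorem.\<close>

locale bb_frame = bose_frame q ty H a t for q and ty :: "'a::{field,finite} itself" and H a t +
  fixes \<Sigma>6 :: "('a ^ 9) set set"
  assumes S6: "proj_subspace (GF q) 6 \<Sigma>6"
    and span_S6: "vec.span (\<Union>\<Sigma>6) = W7"
    and affine: "\<And>\<theta> c. nu \<theta> \<noteq> c *s t"
begin

text \<open>At most one of the three conjugate lines passes through \<open>y\<close>, so that some
  product of two of the forms survives in \<open>curve_vec y\<close>.\<close>

definition good :: "'a ^ 3 \<Rightarrow> bool" where
  "good y \<longleftrightarrow> y \<noteq> 0 \<and> (dot a y \<noteq> 0 \<or> dot a1 y \<noteq> 0) \<and> (dot a1 y \<noteq> 0 \<or> dot a2 y \<noteq> 0)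
     \<and> (dot a2 y \<noteq> 0 \<or> dot a y \<noteq> 0)"

lemma good_nu: "good (nu \<theta>)"
proof -
  have "dot u (nu \<theta>) \<noteq> 0 \<or> dot v (nu \<theta>) \<noteq> 0"
    if "cross u v \<noteq> 0" "dot u t = 0" "dot v t = 0" for u v
    using orthogonal_imp_t[OF that, of "nu \<theta>"] affine by blast
  then show ?thesis
    using cross_a by (simp add: good_def)
qed

lemma dot_e3 [simp]: "dot v e3 = v $ 3"
  by (simp add: dot_def)

lemma good_e3: "a $ 3 \<noteq> 0 \<Longrightarrow> good e3"
  by (simp add: good_def a3_eq_0)

lemma curve_vec_nonzero: "good y \<Longrightarrow> curve_vec y \<noteq> 0"
  by (auto simp: good_def curve_vec_def Phi_eq_0_iff)

lemma curve_vec_in_W7: "curve_vec y \<in> W7"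
  by (simp add: curve_vec_def Phi_in_W7)

lemma curve_vec_in_W6: "curve_vec y \<in> W6 \<longleftrightarrow> dot a y * dot a1 y * dot a2 y = 0"
  by (auto simp: curve_vec_def Phi_in_W6)

text \<open>The system k f = l g = m h with at most one of f, g, h equal to 0 has a one-dimensional
  solution space, spanned by (g h, h f, f g). If f = 0, for instance, then l = m = 0 and only k is
  free.\<close>

lemma curve_vec_unique:
  assumes y: "good y" and x: "Phi (k *s y) (l *s y) (m *s y) \<in> W7"
  shows "\<exists>c. Phi (k *s y) (l *s y) (m *s y) = c *s curve_vec y"
proof -
  let ?f = "dot a y" and ?g = "dot a1 y" and ?h = "dot a2 y"
  have e: "k * ?f = l * ?g" "l * ?g = m * ?h"
    using x by (simp_all add: Phi_in_W7)
  have *: ?thesis if "k = c * (?g * ?h)" "l = c * (?h * ?f)" "m = c * (?f * ?g)" for c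
    using that by (auto simp: curve_vec_def Phi_linear)
  consider "?f = 0" | "?g = 0" | "?h = 0" | "?f \<noteq> 0 \<and> ?g \<noteq> 0 \<and> ?h \<noteq> 0" by blast
  then show ?thesis
  proof cases
    case 1
    with y e show ?thesis
      by (intro *[of "k / (?g * ?h)"]) (auto simp: good_def)
  next
    case 2
    with y e show ?thesis
      by (intro *[of "l / (?h * ?f)"]) (auto simp: good_def)
  next
    case 3
    with y e show ?thesis
      by (intro *[of "m / (?f * ?g)"]) (auto simp: good_def)
  next
    case 4
    with e show ?thesis
      by (intro *[of "k * ?f / (?f * ?g * ?h)"]) (auto simp: field_simps)
  qed
qed

text \<open>The common coordinate form of the Bose planes of subplane points and of the
  scroll-planes: the matrix is conjugated, the vector \<open>y\<close> is not.\<close>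

definition element :: "'a set \<Rightarrow> 'a ^ 3 \<Rightarrow> ('a ^ 9) set set" where
  "element K y = pspan K {pt (H *v y), pt (frob_mat q H *v y), pt (frob_mat (q ^ 2) H *v y)}"

lemma element_iff:
  "X \<in> element K y \<longleftrightarrow> (\<exists>k l m. Phi (k *s y) (l *s y) (m *s y) \<in> rational K
     \<and> Phi (k *s y) (l *s y) (m *s y) \<noteq> 0 \<and> X = pt (Phi (k *s y) (l *s y) (m *s y)))"
  unfolding element_def pspan_iff span_three_points H_eq_Phi Phi_linear
    vec.scale_zero_right add_0_left add_0_right by blast

lemma pspan_S6: "pspan K \<Sigma>6 = {X \<in> PG K. X \<subseteq> W7}"
  by (simp add: pspan_def span_S6)

lemma S6_eq: "\<Sigma>6 = {X \<in> PG (GF q). X \<subseteq> W7}"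
  using S6 pspan_S6 by (auto simp: proj_subspace_def)

lemma pspan_Sigma_inf: "pspan K Sigma_inf = {X \<in> PG K. X \<subseteq> W6}"
  by (simp add: pspan_def span_Sigma_inf)

lemma element_section:
  assumes y: "good y" and w: "curve_vec y \<in> rational K"
  shows "element K y \<inter> pspan K \<Sigma>6 = {pt (curve_vec y)}"
proof (intro equalityI subsetI)
  fix X assume X: "X \<in> element K y \<inter> pspan K \<Sigma>6"
  then obtain k l m where k: "X = pt (Phi (k *s y) (l *s y) (m *s y))" "Phi (k *s y) (l *s y) (m *s y) \<noteq> 0"
    unfolding element_iff Int_iff by blast
  moreover have "Phi (k *s y) (l *s y) (m *s y) \<in> W7"
    using X pt_subset_iff[OF subspace_W7] unfolding k(1) by (simp add: pspan_S6)
  then obtain c where c: "Phi (k *s y) (l *s y) (m *s y) = c *s curve_vec y"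
    using curve_vec_unique[OF y] by blast
  ultimately have "c \<noteq> 0" "X = pt (c *s curve_vec y)"
    by auto
  then show "X \<in> {pt (curve_vec y)}"
    by (simp add: pt_scale)
next
  fix X assume "X \<in> {pt (curve_vec y)}"
  then have X: "X = pt (curve_vec y)" by simp
  have "X \<in> element K y"
    unfolding element_iff X using w curve_vec_nonzero[OF y] unfolding curve_vec_def by blast
  moreover have "X \<in> pspan K \<Sigma>6"
    unfolding pspan_S6 X using w curve_vec_nonzero[OF y] curve_vec_in_W7 pt_subset_iff[OF subspace_W7]
    by (auto simp: PG_def)
  ultimately show "X \<in> element K y \<inter> pspan K \<Sigma>6" ..
qed

lemma curve_vec_rational:
  assumes "fexp m" "\<theta> \<in> GF m"
  shows "curve_vec (nu \<theta>) \<in> rational (GF m)"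
  unfolding curve_basis_sum[symmetric] using assms curve_basis_rational rational_mono
  by (intro rational_scale_sum) (auto intro: GF_power)

lemma nrc_point_curve_basis: "nrc_point curve_deg curve_basis \<theta> = pt (curve_vec (nu \<theta>))"
  by (simp add: nrc_point_def curve_basis_sum)

lemma curve_basis_independent': 
  assumes "(\<Sum>i\<le>curve_deg. c i *s curve_basis i) = 0" "i \<le> curve_deg"
  shows "c i = 0"
proof (rule curve_basis_independent[OF _ assms])
  assume "a $ 3 \<noteq> 0"
  \<comment> \<open>On the conic, \<open>t\<close> would be a multiple of \<open>e3\<close>, where
    \<open>dot a\<close> is nonzero, or of some \<open>nu \<theta>\<close>, which
    \<open>affine\<close> excludes.\<close>
  show "t $ 2 ^ 2 \<noteq> t $ 1 * t $ 3"
  proof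
    assume t2: "t $ 2 ^ 2 = t $ 1 * t $ 3"
    show False
    proof (cases "t $ 1 = 0")
      case True
      then have "t = t $ 3 *s e3"
        using t2 by (simp add: vec3_eq_iff)
      then have "dot a t = t $ 3 * a $ 3"
        by (metis dot_linear(3) dot_e3)
      moreover have "t $ 3 \<noteq> 0"
        using \<open>t = t $ 3 *s e3\<close> t by auto
      ultimately show False
        using \<open>a $ 3 \<noteq> 0\<close> by simp
    next
      case False
      then have "nu (t $ 2 / t $ 1) = (1 / t $ 1) *s t"
        using t2 by (simp add: vec3_eq_iff power2_eq_square)
      with affine show False by blast
    qed
  qed
qed

lemma nrc_basis_curve_basis: "nrc_basis (GF q) curve_deg curve_basis"
  by (rule nrc_basisI) (auto intro: curve_basis_rational curve_basis_independent')

text \<open>Each of the three forms is a factor of two of the blocks; where it vanishes, only the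
  third block survives and the point falls on \<Gamma> or on one of its conjugates.\<close>

lemma pt_curve_vec:
  assumes "good y"
  shows "dot a y = 0 \<Longrightarrow> pt (curve_vec y) = pt (Phi y 0 0)"
    and "dot a1 y = 0 \<Longrightarrow> pt (curve_vec y) = pt (Phi 0 y 0)"
    and "dot a2 y = 0 \<Longrightarrow> pt (curve_vec y) = pt (Phi 0 0 y)"
proof -
  assume "dot a y = 0"
  then have "curve_vec y = (dot a1 y * dot a2 y) *s Phi y 0 0"
    by (simp add: curve_vec_def Phi_linear)
  then show "pt (curve_vec y) = pt (Phi y 0 0)"
    using assms \<open>dot a y = 0\<close> by (simp only: good_def pt_scale) (simp add: pt_scale)
next
  assume "dot a1 y = 0"
  then have "curve_vec y = (dot a2 y * dot a y) *s Phi 0 y 0"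
    by (simp add: curve_vec_def Phi_linear)
  then show "pt (curve_vec y) = pt (Phi 0 y 0)"
    using assms \<open>dot a1 y = 0\<close> by (simp only: good_def pt_scale) (simp add: pt_scale)
next
  assume "dot a2 y = 0"
  then have "curve_vec y = (dot a y * dot a1 y) *s Phi 0 0 y"
    by (simp add: curve_vec_def Phi_linear)
  then show "pt (curve_vec y) = pt (Phi 0 0 y)"
    using assms \<open>dot a2 y = 0\<close> by (simp only: good_def pt_scale) (simp add: pt_scale)
qed

lemma dot_frob: "dot a1 (nu (\<theta> ^ q)) = dot a (nu \<theta>) ^ q"
  "dot a2 (nu (\<theta> ^ (q ^ 2))) = dot a (nu \<theta>) ^ (q ^ 2)"
  using frob_vec_dot[of q a "nu \<theta>"] frob_vec_dot[of "q ^ 2" a "nu \<theta>"] by (simp_all add: frob_vec_nu)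

lemma nrc_point_root:
  assumes "dot a (nu \<theta>) = 0"
  shows "nrc_point curve_deg curve_basis \<theta> = pt (H *v nu \<theta>)"
    and "nrc_point curve_deg curve_basis (\<theta> ^ q) = frob q (pt (H *v nu \<theta>))"
    and "nrc_point curve_deg curve_basis (\<theta> ^ (q ^ 2)) = frob (q ^ 2) (pt (H *v nu \<theta>))"
proof -
  have f0: "frob_vec m (0 :: 'a ^ 3) = 0" if "fexp m" for m
    using that by (simp add: frob_vec_eq_0_iff)
  have "dot a1 (nu (\<theta> ^ q)) = 0" "dot a2 (nu (\<theta> ^ (q ^ 2))) = 0"
    using assms q_gt_1 unfolding dot_frob by (simp_all add: power_0_left)
  with assms show "nrc_point curve_deg curve_basis \<theta> = pt (H *v nu \<theta>)"
    and "nrc_point curve_deg curve_basis (\<theta> ^ q) = frob q (pt (H *v nu \<theta>))"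
    and "nrc_point curve_deg curve_basis (\<theta> ^ (q ^ 2)) = frob (q ^ 2) (pt (H *v nu \<theta>))"
    unfolding nrc_point_curve_basis H_eq_Phi frob_pt_Phi by (simp_all add: pt_curve_vec good_nu f0 frob_vec_nu)
qed

lemma dot_a12_zero:
  "dot a1 (nu \<theta>) = 0 \<longleftrightarrow> (\<exists>x. \<theta> = x ^ q \<and> dot a (nu x) = 0)"
  "dot a2 (nu \<theta>) = 0 \<longleftrightarrow> (\<exists>x. \<theta> = x ^ (q ^ 2) \<and> dot a (nu x) = 0)"
proof -
  obtain x where x: "\<theta> = x ^ q"
    using frob_surj fexp(2) by blast
  show "dot a1 (nu \<theta>) = 0 \<longleftrightarrow> (\<exists>x. \<theta> = x ^ q \<and> dot a (nu x) = 0)"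
    using q_gt_1 unfolding x by (auto simp: dot_frob power_0_left frob_inj)
  obtain x where x: "\<theta> = x ^ (q ^ 2)"
    using frob_surj fexp(1) by blast
  show "dot a2 (nu \<theta>) = 0 \<longleftrightarrow> (\<exists>x. \<theta> = x ^ (q ^ 2) \<and> dot a (nu x) = 0)"
    using q_gt_1 unfolding x by (auto simp: dot_frob power_0_left frob_inj)
qed

text \<open>A linear form cutting \<open>\<Sigma>6\<close> in the subspace at infinity is a multiple of \<open>dot a\<close> on \<open>\<Sigma>6\<close>.\<close>

lemma hyperplane_at_infinity:
  assumes h: "Sigma_inf = {X \<in> \<Sigma>6. X \<subseteq> hyperplane h}"
  obtains c where "c \<noteq> 0" "\<And>y. hdot h (curve_vec y) = c * (dot a y * dot a1 y * dot a2 y)"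
proof -
  have "\<Union>Sigma_inf \<subseteq> hyperplane h"
    using h by auto
  then have W6: "W6 \<subseteq> hyperplane h"
    using vec.span_minimal[OF _ subspace_hyperplane] by (metis span_Sigma_inf)
  obtain n where n: "dot a n = 1" by (rule a_dual)
  note n' = a_dual'[OF n]
  let ?n = "Phi n (frob_vec q n) (frob_vec (q ^ 2) n)"
  have "\<not> \<Union>\<Sigma>6 \<subseteq> W6"
  proof
    assume "\<Union>\<Sigma>6 \<subseteq> W6"
    then have "W7 \<subseteq> W6"
      using vec.span_minimal[OF _ subspace_W6] by (metis span_S6)
    moreover have "?n \<in> W7" "?n \<notin> W6"
      by (simp_all add: Phi_in_W7 Phi_in_W6 n n')
    ultimately show False by blast
  qed
  then obtain X where X: "X \<in> \<Sigma>6" "\<not> X \<subseteq> W6" by blast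
  obtain w where w: "X = pt w"
    using X unfolding S6_eq PG_def by blast
  obtain u0 u1 u2 where wu: "w = Phi u0 u1 u2" by (rule Phi_cases)
  have "X \<subseteq> W7"
    using X unfolding S6_eq by blast
  then have u: "dot a u0 = dot a1 u1" "dot a1 u1 = dot a2 u2"
    unfolding w pt_subset_iff[OF subspace_W7] by (simp_all add: wu Phi_in_W7)
  define \<rho> where "\<rho> = dot a u0"
  have "w \<notin> W6"
    using X w pt_subset_iff[OF subspace_W6] by simp
  then have "\<rho> \<noteq> 0"
    using u by (auto simp: wu Phi_in_W6 \<rho>_def)
  have "X \<notin> Sigma_inf"
    using X vec.span_superset[of "\<Union>Sigma_inf"] unfolding span_Sigma_inf by blast
  then have "\<not> X \<subseteq> hyperplane h"
    using X h by blast
  then have hw: "hdot h w \<noteq> 0"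
    unfolding w pt_subset_iff[OF subspace_hyperplane] hyperplane_iff .
  have "hdot h (curve_vec y) = hdot h w / \<rho> * (dot a y * dot a1 y * dot a2 y)" for y
  proof -
    \<comment> \<open>The multiple of \<open>w\<close> with the same common value of the three
      equations as \<open>curve_vec y\<close>; the difference lies at infinity, where
      \<open>hdot h\<close> is 0.\<close>
    let ?k = "dot a y * dot a1 y * dot a2 y / \<rho>"
    have "curve_vec y + (- ?k) *s w \<in> W6"
      using u \<open>\<rho> \<noteq> 0\<close> by (simp add: curve_vec_def wu Phi_linear Phi_in_W6 \<rho>_def del: vec.scale_minus_left)
    then have "hdot h (curve_vec y + (- ?k) *s w) = 0"
      using W6 hyperplane_iff by blast
    then show ?thesis
      by (simp add: hdot_linear del: vec.scale_minus_left)
  qed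
  moreover have "hdot h w / \<rho> \<noteq> 0"
    using hw \<open>\<rho> \<noteq> 0\<close> by simp
  ultimately show thesis
    using that by blast
qed

text \<open>The form cut out by \<open>h\<close> is a nonzero multiple of f0 f1 f2. Its degree is
  exactly 6, so the parameter at infinity contributes nothing, and its roots are the conjugates of
  \<open>x\<close> and \<open>y\<close>, counted twice if \<open>x = y\<close>.\<close>

lemma nrc_section_roots:
  assumes a3: "a $ 3 \<noteq> 0" and xy: "a $ 3 * (x + y) = - a $ 2" "a $ 3 * (x * y) = a $ 1"
    and h: "Sigma_inf = {X \<in> \<Sigma>6. X \<subseteq> hyperplane h}"
  shows "nrc_section 6 curve_basis h = {#pt (H *v nu x), frob q (pt (H *v nu x)), frob (q ^ 2) (pt (H *v nu x)),
    pt (H *v nu y), frob q (pt (H *v nu y)), frob (q ^ 2) (pt (H *v nu y))#}"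
proof -
  have curve_deg: "curve_deg = 6" using a3 by (simp add: curve_deg_def)
  obtain c where c: "c \<noteq> 0" "\<And>y. hdot h (curve_vec y) = c * (dot a y * dot a1 y * dot a2 y)"
    using hyperplane_at_infinity[OF h] by blast
  define p where "p = (\<Sum>i\<le>6. monom (hdot h (curve_basis i)) i)"
  define s where "s = smult c (form_poly a * form_poly a1 * form_poly a2)"
  have fac: "form_poly (frob_vec m a) = smult (a $ 3 ^ m) ([:- (x ^ m), 1:] * [:- (y ^ m), 1:])" if "fexp m" for m
  proof -
    have "frob_vec m a $ 3 * (x ^ m + y ^ m) = - frob_vec m a $ 2"
      using arg_cong[OF xy(1), of "\<lambda>z. z ^ m"] that by (simp add: power_mult_distrib frob_add frob_minus)
    moreover have "frob_vec m a $ 3 * (x ^ m * y ^ m) = frob_vec m a $ 1"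
      using arg_cong[OF xy(2), of "\<lambda>z. z ^ m"] that by (simp add: power_mult_distrib)
    ultimately show ?thesis
      using form_poly_factor[of "frob_vec m a" "x ^ m" "y ^ m"] by simp
  qed
  have facs: "form_poly a = smult (a $ 3) ([:- x, 1:] * [:- y, 1:])"
    "form_poly a1 = smult (a $ 3 ^ q) ([:- (x ^ q), 1:] * [:- (y ^ q), 1:])"
    "form_poly a2 = smult (a $ 3 ^ (q ^ 2)) ([:- (x ^ (q ^ 2)), 1:] * [:- (y ^ (q ^ 2)), 1:])"
    using form_poly_factor[OF xy] fac[of q] fac[of "q ^ 2"] by simp_all
  define P where "P = ([:- x, 1:] * [:- y, 1:]) * (([:- (x ^ q), 1:] * [:- (y ^ q), 1:])
     * ([:- (x ^ (q ^ 2)), 1:] * [:- (y ^ (q ^ 2)), 1:]))"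
  define k where "k = c * (a $ 3 * (a $ 3 ^ q * a $ 3 ^ (q ^ 2)))"
  have k: "k \<noteq> 0"
    using c a3 by (simp add: k_def)
  have s: "s = smult k P"
    unfolding s_def facs P_def k_def by (simp only: mult_smult_left mult_smult_right smult_smult mult.assoc) (simp add: mult_ac)
  define l where "l z = [:- z, 1:]" for z :: 'a
  have l: "degree (l z) = 1" "l z \<noteq> 0" "proots (l z) = {#z#}" for z
    by (simp_all add: l_def)
  have P: "P = (l x * l y) * ((l (x ^ q) * l (y ^ q)) * (l (x ^ (q ^ 2)) * l (y ^ (q ^ 2))))"
    by (simp only: P_def l_def)
  have "degree P = 6"
    unfolding P using l by (simp add: degree_mult_eq)
  then have ds: "degree s = 6"
    using k by (simp add: s)
  have "degree p \<le> 6"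
    unfolding p_def by (intro degree_sum_le) (auto intro: order_trans[OF degree_monom_le])
  \<comment> \<open>Polynomials of degree at most 6 that agree as functions are equal only because
    the field has more than 6 elements.\<close>
  moreover have "6 < CARD('a)"
  proof -
    have "2 ^ 6 \<le> q ^ 6"
      using q_gt_1 by (intro power_mono) auto
    then show ?thesis by (simp add: card_univ)
  qed
  moreover have "poly p \<theta> = poly s \<theta>" for \<theta>
  proof -
    have "poly p \<theta> = (\<Sum>i\<le>6. hdot h (\<theta> ^ i *s curve_basis i))"
      by (simp add: p_def poly_sum poly_monom hdot_linear mult.commute)
    also have "\<dots> = hdot h (curve_vec (nu \<theta>))"
      using curve_basis_sum[of \<theta>] by (simp add: curve_deg flip: hdot_sum)
    also have "\<dots> = poly s \<theta>"
      by (simp add: c s_def poly_form_poly mult_ac)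
    finally show ?thesis .
  qed
  ultimately have p: "p = s"
    using ds by (intro poly_eqI_degree[of UNIV]) auto

  have "proots P = {#x, y, x ^ q, y ^ q, x ^ (q ^ 2), y ^ (q ^ 2)#}"
    unfolding P using l by (simp add: proots_mult)
  then have pr: "proots p = {#x, y, x ^ q, y ^ q, x ^ (q ^ 2), y ^ (q ^ 2)#}"
    using k by (simp add: p s)
  have ax: "dot a (nu x) = 0" and ay: "dot a (nu y) = 0"
    unfolding poly_form_poly[symmetric] facs(1) by (simp_all add: algebra_simps)
  note np = nrc_point_root[OF ax, unfolded curve_deg] nrc_point_root[OF ay, unfolded curve_deg]
  have "nrc_section 6 curve_basis h = image_mset (nrc_point 6 curve_basis) (proots p) + replicate_mset (6 - degree p) (pt (curve_basis 6))"
    unfolding nrc_section_def p_def hdot_def Let_def ..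
  also have "\<dots> = {#pt (H *v nu x), frob q (pt (H *v nu x)), frob (q ^ 2) (pt (H *v nu x)),
    pt (H *v nu y), frob q (pt (H *v nu y)), frob (q ^ 2) (pt (H *v nu y))#}"
    unfolding pr using ds by (simp add: p np)
  finally show ?thesis .
qed

end

section \<open>Homographies, frames and equations of lines\<close>

lemma mat_image_comp: "mat_image (A ** B) X = mat_image A (mat_image B X)"
  by (simp add: mat_image_def image_image matrix_vector_mul_assoc)

lemma matrix_expand: "M *v y = y $ 1 *s (M *v axis 1 1) + y $ 2 *s (M *v axis 2 1) + y $ 3 *s (M *v axis 3 1)"
  for M :: "'a::field ^ 3 ^ 'n"
  by (simp add: vec_eq_iff matrix_mult_axis) (simp add: matrix_vector_mult_def sum_3 mult.commute)

text \<open>A homography is determined by its values at the four points of a frame.\<close>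

lemma frame_scalar:
  fixes A M :: "'a::field ^ 3 ^ 3"
  assumes A: "invertible A"
    and e: "\<And>i. \<exists>c. M *v axis i 1 = c *s (A *v axis i 1)"
    and s: "\<exists>c. M *v vector [1, 1, 1] = c *s (A *v vector [1, 1, 1])"
  shows "\<exists>c. \<forall>y. M *v y = c *s (A *v y)"
proof -
  have "\<exists>l. \<forall>i. M *v axis i 1 = l i *s (A *v axis i 1)"
    using e by (intro choice allI)
  then obtain l where l: "\<And>i. M *v axis i 1 = l i *s (A *v axis i 1)"
    by blast
  obtain c where c: "M *v vector [1, 1, 1] = c *s (A *v vector [1, 1, 1])"
    using s by blast
  \<comment> \<open>\<open>M\<close> is \<open>A\<close> after a diagonal matrix, and the fourth
    point of the frame forces the diagonal entries to agree.\<close>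
  have M: "M *v y = A *v vector [l 1 * y $ 1, l 2 * y $ 2, l 3 * y $ 3]" for y
    unfolding matrix_expand[of M y] matrix_expand[of A "vector [_, _, _]"] l by (simp add: mult.commute)
  have "A *v vector [l 1, l 2, l 3] = A *v (c *s vector [1, 1, 1])"
    using c unfolding M by (simp add: vec.scale)
  then have "vector [l 1, l 2, l 3] = (c *s vector [1, 1, 1] :: 'a ^ 3)"
    using inj_matI[OF A] by blast
  then have lc: "l 1 = c" "l 2 = c" "l 3 = c"
    by (simp_all add: vec3_eq_iff)
  have "M *v y = c *s (A *v y)" for y
  proof -
    have "vector [c * y $ 1, c * y $ 2, c * y $ 3] = c *s y"
      by (simp add: vec3_eq_iff)
    then show ?thesis
      unfolding M lc by (simp add: vec.scale)
  qed
  then show ?thesis by blast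
qed

context frobenius_field
begin

lemma rational_mat_mult:
  assumes "fexp m" "A \<in> rational_mat (GF m)" "B \<in> rational_mat (GF m)"
  shows "A ** B \<in> (rational_mat (GF m) :: ('a ^ 'n ^ 'k) set)"
  using assms by (auto simp: rational_mat_def matrix_matrix_mult_def intro!: GF_sum GF_closed)

lemma mat_image_PG:
  fixes A :: "'a ^ 'n ^ 'n"
  assumes "fexp m" "A \<in> rational_mat (GF m :: 'a set)" "invertible A"
  shows "mat_image A ` PG (GF m) = PG (GF m)"
proof (intro equalityI subsetI)
  fix X assume "X \<in> mat_image A ` PG (GF m)"
  then obtain v where v: "v \<in> rational (GF m)" "v \<noteq> 0" "X = mat_image A (pt v)"
    unfolding PG_def by blast
  then have X: "X = pt (A *v v)"
    by (simp only: mat_image_pt)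
  have "A *v v \<noteq> 0"
    using v inj_matI[OF assms(3), of v 0] by auto
  then show "X \<in> PG (GF m)"
    using X rational_mult[OF assms(1,2) v(1)] unfolding PG_iff by blast
next
  fix X :: "('a ^ 'n) set" assume "X \<in> PG (GF m)"
  then obtain v where v: "v \<in> rational (GF m)" "v \<noteq> 0" "X = pt v"
    unfolding PG_def by blast
  obtain y where y: "v = A *v y"
    using assms(3) by (rule surj_matE)
  have "y \<in> rational (GF m)" "y \<noteq> 0"
    using v y rational_mult_iff[OF assms] by auto
  then have "pt y \<in> PG (GF m)"
    unfolding PG_iff by blast
  moreover have "X = mat_image A (pt y)"
    by (simp add: v y mat_image_pt)
  ultimately show "X \<in> mat_image A ` PG (GF m)" by blast
qed

text \<open>Points are subspaces over the ambient field, so a basis picked from a line need not be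
  rational. Each of its vectors is a multiple of a rational one, and the cross product of the two
  rational vectors, taken in the coordinates of \<open>A\<close>, is the equation.\<close>

lemma line_equation:
  fixes A :: "'a ^ 3 ^ 3" and L :: "('a ^ 3) set set"
  assumes L: "proj_subspace (GF m) 1 L" and m: "fexp m"
    and A: "A \<in> rational_mat (GF m :: 'a set)" "invertible A"
  obtains a where "a \<in> rational (GF m)"
    "vec.span (\<Union>L) = {A *v y | y. dot a y = 0}"
proof -
  let ?S = "\<Union>L"
  have LPG: "L \<subseteq> PG (GF m)" and dim: "vec.dim ?S = 2"
    using L by (simp_all add: proj_subspace_def)
  obtain Bs where Bs: "Bs \<subseteq> ?S" "vec.independent Bs" "?S \<subseteq> vec.span Bs" "card Bs = 2"
    using vec.basis_exists[of ?S] dim by metis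
  then obtain v1 v2 where v: "Bs = {v1, v2}" "v1 \<noteq> v2"
    by (auto simp: card_2_iff)
  have rat: "\<exists>c y. v = c *s (A *v y) \<and> y \<in> rational (GF m) \<and> A *v y \<in> ?S" if "v \<in> ?S" for v
  proof -
    obtain w where w: "w \<in> rational (GF m)" "pt w \<in> L" "v \<in> pt w"
      using \<open>v \<in> ?S\<close> LPG unfolding PG_def by blast
    obtain c where "v = c *s w"
      using w(3) mem_pt_iff by blast
    moreover obtain y where y: "w = A *v y"
      using A(2) by (rule surj_matE)
    moreover have "y \<in> rational (GF m)"
      using w y rational_mult_iff[OF m A] by simp
    moreover have "w \<in> ?S"
      using w(2) vec.span_base[of w "{w}"] by blast
    ultimately show ?thesis by blast
  qed
  obtain c1 y1 where 1: "v1 = c1 *s (A *v y1)" "y1 \<in> rational (GF m)" "A *v y1 \<in> ?S"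
    using rat[of v1] Bs v by blast
  obtain c2 y2 where 2: "v2 = c2 *s (A *v y2)" "y2 \<in> rational (GF m)" "A *v y2 \<in> ?S"
    using rat[of v2] Bs v by blast
  define a where "a = cross y1 y2"
  have "vec.independent {v1, v2}"
    using Bs v by simp
  then have ind: "v2 \<notin> vec.span {v1}" "v1 \<noteq> 0"
    using v(2) by (auto simp: vec.independent_insert insert_commute[of v1] vec.dependent_zero)
  have "a \<noteq> 0"
  proof
    assume "a = 0"
    moreover have "y1 \<noteq> 0" "c1 \<noteq> 0"
      using ind 1 by auto
    ultimately obtain c where "y2 = c *s y1"
      using cross_eq_0_imp unfolding a_def by blast
    then have "v2 = (c2 * c / c1) *s v1"
      using \<open>c1 \<noteq> 0\<close> by (simp add: 1 2 vec.scale)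
    then show False
      using ind(1) by (auto simp: vec.span_singleton)
  qed
  have "vec.subspace {A *v y | y. dot a y = 0}"
  proof (rule vec.subspaceI)
    show "0 \<in> {A *v y | y. dot a y = 0}"
      by (auto intro!: exI[of _ 0])
  next
    fix x z assume "x \<in> {A *v y | y. dot a y = 0}" "z \<in> {A *v y | y. dot a y = 0}"
    then obtain u w where "x = A *v u" "dot a u = 0" "z = A *v w" "dot a w = 0" by blast
    then have "x + z = A *v (u + w)" "dot a (u + w) = 0"
      by (simp_all add: vec.add)
    then show "x + z \<in> {A *v y | y. dot a y = 0}" by blast
  next
    fix c x assume "x \<in> {A *v y | y. dot a y = 0}"
    then obtain u where "x = A *v u" "dot a u = 0" by blast
    then have "c *s x = A *v (c *s u)" "dot a (c *s u) = 0"
      by (simp_all add: vec.scale)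
    then show "c *s x \<in> {A *v y | y. dot a y = 0}" by blast
  qed
  moreover have "Bs \<subseteq> {A *v y | y. dot a y = 0}"
  proof -
    have "v1 = A *v (c1 *s y1)" "v2 = A *v (c2 *s y2)"
      by (simp_all add: 1 2 vec.scale)
    moreover have "dot a (c1 *s y1) = 0" "dot a (c2 *s y2) = 0"
      by (simp_all add: a_def)
    ultimately show ?thesis
      unfolding v by blast
  qed
  ultimately have "vec.span Bs \<subseteq> {A *v y | y. dot a y = 0}"
    by (intro vec.span_minimal)
  moreover have "vec.span ?S = vec.span Bs"
    using Bs(1,3) by (intro subset_antisym vec.span_mono vec.span_minimal vec.subspace_span)
  moreover have "A *v y \<in> vec.span ?S" if "dot a y = 0" for y
  proof -
    obtain k l where "y = k *s y1 + l *s y2"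
      using dot_cross_eq_0_imp[of y1 y2 y] \<open>a \<noteq> 0\<close> \<open>dot a y = 0\<close> unfolding a_def by blast
    then have "A *v y = k *s (A *v y1) + l *s (A *v y2)"
      by (simp add: vec.add vec.scale)
    then show ?thesis
      using 1(3) 2(3) by (simp add: vec.span_add vec.span_scale vec.span_base)
  qed
  ultimately have "vec.span ?S = {A *v y | y. dot a y = 0}"
    by blast
  moreover have "a \<in> rational (GF m)"
    using 1 2 m by (simp add: rational_iff_frob_vec a_def frob_vec_cross)
  ultimately show thesis
    using that by blast
qed

end

section \<open>The conic in the Bruck--Bose representation\<close>

locale bb_conic = bb_frame q ty H a t \<Sigma>6 for q and ty :: "'a::{field,finite} itself" and H a t \<Sigma>6 +
  fixes J :: "'a ^ 3 ^ 9" and A B :: "'a ^ 3 ^ 3" and linf C :: "('a ^ 3) set set"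
  assumes q5: "q \<ge> 5" and HJA: "H = J ** A" and J_inj: "inj (\<lambda>v. J *v v)"
    and A: "A \<in> rational_mat (GF (q ^ 3))" "invertible A"
    and span_linf: "vec.span (\<Union>linf) = {A *v y | y. dot a y = 0}"
    and linf: "proj_subspace (GF (q ^ 3)) 1 linf"
    and C: "C = mat_image A ` std_conic (GF q)"
    and conj: "\<And>y. conj_map q B (pt (A *v y)) = pt (A *v frob_vec q y)"
begin

lemma J_pt: "mat_image J (pt (A *v y)) = pt (H *v y)"
  by (simp add: mat_image_pt HJA matrix_vector_mul_assoc)

lemma pt_subset_linf: "pt (A *v y) \<subseteq> vec.span (\<Union>linf) \<longleftrightarrow> dot a y = 0"
proof -
  have "pt (A *v y) \<subseteq> vec.span (\<Union>linf) \<longleftrightarrow> A *v y \<in> vec.span (\<Union>linf)"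
    by (rule pt_subset_iff[OF vec.subspace_span])
  also have "\<dots> \<longleftrightarrow> (\<exists>z. A *v y = A *v z \<and> dot a z = 0)"
    unfolding span_linf by blast
  finally show ?thesis
    using inj_matI[OF A(2)] by metis
qed

lemma A_nonzero: "y \<noteq> 0 \<Longrightarrow> A *v y \<noteq> 0"
  using inj_matI[OF A(2), of y 0] by auto

lemma linf_eq: "linf = {X \<in> PG (GF (q ^ 3)). X \<subseteq> vec.span (\<Union>linf)}"
  using linf by (auto simp: proj_subspace_def pspan_def)

lemma pt_in_linf:
  assumes "y \<noteq> 0" "y \<in> rational (GF (q ^ 3))"
  shows "pt (A *v y) \<in> linf \<longleftrightarrow> dot a y = 0"
proof -
  have "pt (A *v y) \<in> PG (GF (q ^ 3))"
    unfolding PG_iff using A_nonzero rational_mult[OF _ A(1)] assms fexp(1) by blast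
  then show ?thesis
    by (subst linf_eq) (simp add: pt_subset_linf)
qed

lemma G_eq: "mat_image J ` linf = G"
proof (intro equalityI subsetI)
  fix X assume "X \<in> mat_image J ` linf"
  then obtain Y where Y: "Y \<in> linf" "X = mat_image J Y" by blast
  then obtain v where v: "v \<in> rational (GF (q ^ 3))" "v \<noteq> 0" "Y = pt v"
    using linf_eq unfolding PG_def by blast
  obtain y where y: "v = A *v y"
    using A(2) by (rule surj_matE)
  have "y \<in> rational (GF (q ^ 3))" "y \<noteq> 0"
    using v y rational_mult_iff[OF fexp(1) A] by auto
  moreover from this have "dot a y = 0"
    using Y(1) pt_in_linf unfolding v y by blast
  ultimately show "X \<in> G"
    unfolding G_def Y v y J_pt by blast
next
  fix X assume "X \<in> G"
  then obtain y where y: "X = pt (H *v y)" "y \<in> rational (GF (q ^ 3))" "y \<noteq> 0" "dot a y = 0"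
    unfolding G_def by blast
  then have "pt (A *v y) \<in> linf"
    using pt_in_linf by blast
  then show "X \<in> mat_image J ` linf"
    unfolding y J_pt[symmetric] by blast
qed

lemma conic_plus_eq: "conic_plus q C = mat_image A ` std_conic (GF (q ^ 3))"
  unfolding conic_plus_def
proof (rule conic_ext_eq[OF fexp(1) A q5])
  have "std_conic (GF q) \<subseteq> std_conic (GF (q ^ 3) :: 'a set)"
    using GF_mono fexp(1) unfolding std_conic_def by blast
  then show "C \<subseteq> mat_image A ` std_conic (GF (q ^ 3))"
    unfolding C by blast
qed (simp add: C)

lemma conic_plusplus_eq: "conic_plusplus q C = mat_image A ` std_conic (GF (q ^ 6))"
  unfolding conic_plusplus_def
proof (rule conic_ext_eq[OF fexp(1) _ A(2) q5])
  show "A \<in> rational_mat (GF (q ^ 6))"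
    by (simp add: rational_mat_def)
  have "std_conic (GF q) \<subseteq> std_conic (GF (q ^ 3) :: 'a set)" "std_conic (GF (q ^ 3)) \<subseteq> std_conic (GF (q ^ 6) :: 'a set)"
    using GF_mono fexp(1) unfolding std_conic_def by (blast, simp) blast
  then show "mat_image A ` std_conic (GF q) \<subseteq> conic_plus q C" "conic_plus q C \<subseteq> mat_image A ` std_conic (GF (q ^ 6))"
    unfolding conic_plus_eq by blast+
qed

lemma bb_element_eq:
  assumes "y \<in> rational (GF q)"
  shows "bb_element q J \<Sigma>6 (pt (A *v y)) = element (GF q) y \<inter> pspan (GF q) \<Sigma>6"
proof -
  have "frob_vec (q ^ 2) y = y"
    using assms rational_mono[of "q ^ 2"] by (simp add: rational_iff_frob_vec)
  moreover have "frob_vec q y = y"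
    using assms by (simp add: rational_iff_frob_vec)
  ultimately have "bose_element q (pt (H *v y)) = element (GF q) y"
    by (simp add: bose_element_def element_def frob_pt frob_vec_mult)
  moreover have "pspan (GF q) \<Sigma>6 = \<Sigma>6"
    using S6 by (simp add: proj_subspace_def)
  ultimately show ?thesis
    by (simp add: bb_element_def J_pt)
qed

text \<open>In these coordinates the conjugacy is Frobenius on \<open>y\<close>. Its fifth and
  fourth powers, followed by the powers q and q^2, both add up to q^6, so \<open>y\<close> returns
  to itself and only \<open>H\<close> is conjugated.\<close>

lemma scroll_plane_eq: "scroll_plane q J B K (pt (A *v y)) = element K y"
proof -
  have iter: "(conj_map q B ^^ k) (pt (A *v y)) = pt (A *v frob_vec (q ^ k) y)" for k
  proof (induction k)
    case 0
    have "frob_vec 1 y = y" by (simp add: vec_eq_iff)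
    then show ?case by simp
  next
    case (Suc k)
    then show ?case by (simp add: conj frob_vec_frob_vec)
  qed
  have "frob_vec q (frob_vec (q ^ 5) y) = y" "frob_vec (q ^ 2) (frob_vec (q ^ 4) y) = y"
    by (simp_all add: frob_vec_frob_vec vec_eq_iff flip: power_add power_Suc)
  then show ?thesis
    unfolding scroll_plane_def iter J_pt by (simp add: frob_pt frob_vec_mult element_def)
qed

lemma affine_points_section:
  assumes "fexp m"
  shows "(\<Union>\<theta>\<in>GF m. element (GF m) (nu \<theta>)) \<inter> pspan (GF m) \<Sigma>6 = nrc_point curve_deg curve_basis ` GF m"
proof -
  have "element (GF m) (nu \<theta>) \<inter> pspan (GF m) \<Sigma>6 = {nrc_point curve_deg curve_basis \<theta>}" if "\<theta> \<in> GF m" for \<theta>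
    unfolding nrc_point_curve_basis by (rule element_section[OF good_nu curve_vec_rational[OF assms that]])
  then show ?thesis by blast
qed

text \<open>A curve vector lies in \<open>W6\<close> iff the product of the three conjugate forms
  vanishes, and the zeros of the conjugate forms are the conjugates of those in
  \<open>Z\<close>.\<close>

lemma affine_points_infinity:
  assumes m: "fexp m" and Z: "{\<theta>. dot a (nu \<theta>) = 0} = Z" "Z \<subseteq> GF m"
  shows "nrc_point curve_deg curve_basis ` GF m \<inter> pspan (GF m) Sigma_inf =
    (\<Union>\<theta>\<in>Z. {pt (H *v nu \<theta>), frob q (pt (H *v nu \<theta>)), frob (q ^ 2) (pt (H *v nu \<theta>))})"
proof -
  have PG: "pt (curve_vec (nu \<theta>)) \<in> PG (GF m)" if "\<theta> \<in> GF m" for \<theta>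
    unfolding PG_iff using curve_vec_rational[OF m that] curve_vec_nonzero[OF good_nu] by blast
  have "nrc_point curve_deg curve_basis \<theta> \<in> pspan (GF m) Sigma_inf \<longleftrightarrow> \<theta> \<in> Z \<union> (\<lambda>x. x ^ q) ` Z \<union> (\<lambda>x. x ^ (q ^ 2)) ` Z"
    if "\<theta> \<in> GF m" for \<theta>
  proof -
    have "nrc_point curve_deg curve_basis \<theta> \<in> pspan (GF m) Sigma_inf \<longleftrightarrow> curve_vec (nu \<theta>) \<in> W6"
      using PG[OF that] unfolding nrc_point_curve_basis pspan_Sigma_inf
      by (simp add: pt_subset_iff[OF subspace_W6])
    also have "\<dots> \<longleftrightarrow> dot a (nu \<theta>) = 0 \<or> dot a1 (nu \<theta>) = 0 \<or> dot a2 (nu \<theta>) = 0"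
      unfolding curve_vec_in_W6 by auto
    finally show ?thesis
      unfolding dot_a12_zero using Z(1) by blast
  qed
  moreover have "Z \<union> (\<lambda>x. x ^ q) ` Z \<union> (\<lambda>x. x ^ (q ^ 2)) ` Z \<subseteq> GF m"
    using Z(2) GF_power by blast
  ultimately have "nrc_point curve_deg curve_basis ` GF m \<inter> pspan (GF m) Sigma_inf =
      nrc_point curve_deg curve_basis ` (Z \<union> (\<lambda>x. x ^ q) ` Z \<union> (\<lambda>x. x ^ (q ^ 2)) ` Z)"
    by blast
  also have "\<dots> = (\<Union>\<theta>\<in>Z. {nrc_point curve_deg curve_basis \<theta>, nrc_point curve_deg curve_basis (\<theta> ^ q), nrc_point curve_deg curve_basis (\<theta> ^ (q ^ 2))})"
    by blast
  also have "\<dots> = (\<Union>\<theta>\<in>Z. {pt (H *v nu \<theta>), frob q (pt (H *v nu \<theta>)), frob (q ^ 2) (pt (H *v nu \<theta>))})"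
  proof (rule SUP_cong[OF refl])
    fix \<theta> assume "\<theta> \<in> Z"
    then have "dot a (nu \<theta>) = 0" using Z by blast
    from nrc_point_root[OF this] show "{nrc_point curve_deg curve_basis \<theta>, nrc_point curve_deg curve_basis (\<theta> ^ q), nrc_point curve_deg curve_basis (\<theta> ^ (q ^ 2))} =
        {pt (H *v nu \<theta>), frob q (pt (H *v nu \<theta>)), frob (q ^ 2) (pt (H *v nu \<theta>))}"
      by simp
  qed
  finally show ?thesis .
qed

end

section \<open>Intersections with infinity and the two cases of the theorem\<close>

lemma image_std_conic: "mat_image A ` std_conic K = (\<lambda>\<theta>. pt (A *v nu \<theta>)) ` K \<union> {pt (A *v e3)}"
  by (simp add: std_conic_def image_Un image_image mat_image_pt)

context bb_conic
begin

lemma conic_plus_linf: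
  "conic_plus q C \<inter> linf = (\<lambda>\<theta>. pt (A *v nu \<theta>)) ` {\<theta> \<in> GF (q ^ 3). dot a (nu \<theta>) = 0}
     \<union> (if a $ 3 = 0 then {pt (A *v e3)} else {})"
proof -
  have "pt (A *v nu \<theta>) \<in> linf \<longleftrightarrow> dot a (nu \<theta>) = 0" if "\<theta> \<in> GF (q ^ 3)" for \<theta>
    using that by (intro pt_in_linf) auto
  moreover have "pt (A *v e3) \<in> linf \<longleftrightarrow> a $ 3 = 0"
    using pt_in_linf[of e3] by simp
  ultimately show ?thesis
    unfolding conic_plus_eq image_std_conic by auto
qed

lemma conic_plusplus_linf:
  assumes "a $ 3 \<noteq> 0"
  shows "conic_plusplus q C \<inter> pspan (GF (q ^ 6)) linf = (\<lambda>\<theta>. pt (A *v nu \<theta>)) ` {\<theta>. dot a (nu \<theta>) = 0}"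
proof -
  have PG: "pt (A *v y) \<in> PG (GF (q ^ 6))" if "y \<noteq> 0" for y
    unfolding PG_iff using A_nonzero[OF that] by (intro exI[of _ "A *v y"]) (simp add: rational_def)
  have "pt (A *v y) \<in> pspan (GF (q ^ 6)) linf \<longleftrightarrow> dot a y = 0" if "y \<noteq> 0" for y
    using PG[OF that] pt_subset_linf by (simp add: pspan_def)
  then show ?thesis
    unfolding conic_plusplus_eq image_std_conic using assms by auto
qed

lemma pt_A_eqD: "pt (A *v y) = pt (A *v z) \<Longrightarrow> y \<noteq> 0 \<Longrightarrow> \<exists>c. c \<noteq> 0 \<and> z = c *s y"
  using pt_eq_iff[OF A_nonzero, of y "A *v z"] inj_matI[OF A(2)] by (metis vec.scale)

text \<open>Now f0 has degree 1, and its single root gives \<open>Q\<close>. The coefficient of X^4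
  is a triple of multiples of \<open>e3\<close>, which makes it the real point \<open>R\<close> of
  the spread plane of \<open>T\<close>.\<close>

lemma point_on_conic:
  assumes a3: "a $ 3 = 0" and T: "T = pt (A *v e3)"
  shows "\<exists>Q. Q \<noteq> T \<and> conic_plus q C \<inter> linf = {T, Q} \<and>
         (\<exists>b R. nrc_basis (GF q) 4 b \<and>
            bb_set q J \<Sigma>6 C = bb_element q J \<Sigma>6 T \<union> nrc (GF q) 4 b \<and>
            R \<in> bb_element q J \<Sigma>6 T \<and>
            nrc (GF (q ^ 3)) 4 b \<inter> pspan (GF (q ^ 3)) Sigma_inf =
              {R, mat_image J Q, frob q (mat_image J Q), frob (q ^ 2) (mat_image J Q)})"
proof -
  have curve_deg: "curve_deg = 4" using a3 by (simp add: curve_deg_def)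
  \<comment> \<open>Otherwise the line at infinity would be the tangent of the conic at
    \<open>e3\<close>, which is a line of the subplane and equal to its own conjugates.\<close>
  have a2: "a $ 2 \<noteq> 0"
  proof
    assume "a $ 2 = 0"
    then have "a1 $ 2 = 0" "a1 $ 3 = 0"
      using a3 q_gt_1 by (simp_all add: a1_def del: frob_vec_a)
    with \<open>a $ 2 = 0\<close> a3 have "cross a a1 = 0"
      by (simp add: vec3_eq_iff)
    with cross_a_a1 show False ..
  qed
  define x where "x = - a $ 1 / a $ 2"
  have root: "dot a (nu \<theta>) = 0 \<longleftrightarrow> \<theta> = x" for \<theta>
    using a2 a3 by (simp add: dot_def x_def field_simps) (auto simp: add_eq_0_iff)
  have x: "x \<in> GF (q ^ 3)"
    using a unfolding x_def rational3_iff by (auto intro!: GF_closed GF_minus)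
  define Q where "Q = pt (A *v nu x)"
  define R where "R = pt (curve_basis 4)"
  have "Q \<noteq> T"
  proof
    assume "Q = T"
    then obtain c where "e3 = c *s nu x" "c \<noteq> 0"
      using pt_A_eqD[of "nu x" e3] by (auto simp: Q_def T)
    then have "c *s nu x = e3" by simp
    then show False
      using \<open>c \<noteq> 0\<close> by (auto simp: vec3_eq_iff)
  qed
  moreover have "{\<theta> \<in> GF (q ^ 3). dot a (nu \<theta>) = 0} = {x}"
    using x by (auto simp: root)
  then have "conic_plus q C \<inter> linf = {T, Q}"
    unfolding conic_plus_linf Q_def T using a3 by auto
  moreover have "nrc_basis (GF q) 4 curve_basis"
    using nrc_basis_curve_basis by (simp add: curve_deg)
  moreover have b4: "curve_basis 4 \<noteq> 0" "curve_basis 4 \<in> W6"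
  proof -
    have "curve_basis 4 \<noteq> 0"
    proof
      assume "curve_basis 4 = 0"
      then have "(\<Sum>i\<le>curve_deg. (if i = 4 then 1 else 0) *s curve_basis i) = 0"
        by (intro sum.neutral) auto
      then have "(if (4 :: nat) = 4 then 1 else 0 :: 'a) = 0"
        by (rule curve_basis_independent') (simp add: curve_deg)
      then show False by simp
    qed
    then show "curve_basis 4 \<noteq> 0" "curve_basis 4 \<in> W6"
      unfolding curve_basis_4[OF a3] Phi_in_W6 using a3 a3_eq_0 by simp_all
  qed
  have RPG: "R \<in> PG (GF m)" if "fexp m" for m
    unfolding R_def PG_iff using b4(1) rational_mono[OF that curve_basis_rational] by blast
  have "W6 \<subseteq> W7"
    by (auto simp: W6_def Phi_in_W7)
  then have RW: "R \<subseteq> W6" "R \<subseteq> W7"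
    unfolding R_def using b4 pt_subset_iff subspace_W6 subspace_W7 by blast+
  have R: "R \<in> bb_element q J \<Sigma>6 T"
  proof -
    have "R \<in> element (GF q) e3"
      unfolding element_iff R_def using b4(1) curve_basis_rational[of 4] unfolding curve_basis_4[OF a3] by blast
    moreover have "R \<in> pspan (GF q) \<Sigma>6"
      unfolding pspan_S6 using RPG RW by simp
    ultimately show ?thesis
      unfolding T by (simp add: bb_element_eq)
  qed
  moreover have "bb_set q J \<Sigma>6 C = bb_element q J \<Sigma>6 T \<union> nrc (GF q) 4 curve_basis"
  proof -
    have "bb_set q J \<Sigma>6 C = (\<Union>\<theta>\<in>GF q. bb_element q J \<Sigma>6 (pt (A *v nu \<theta>))) \<union> bb_element q J \<Sigma>6 T"
      unfolding bb_set_def C image_std_conic T by auto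
    also have "(\<Union>\<theta>\<in>GF q. bb_element q J \<Sigma>6 (pt (A *v nu \<theta>))) =
        (\<Union>\<theta>\<in>GF q. element (GF q) (nu \<theta>)) \<inter> pspan (GF q) \<Sigma>6"
      by (auto simp: bb_element_eq)
    also have "\<dots> = nrc_point curve_deg curve_basis ` GF q"
      by (rule affine_points_section) simp
    \<comment> \<open>The parameter at infinity adds only \<open>R\<close>, which the spread plane
      of \<open>T\<close> already contains.\<close>
    finally show ?thesis
      using R unfolding nrc_def curve_deg R_def by blast
  qed
  moreover have "nrc (GF (q ^ 3)) 4 curve_basis \<inter> pspan (GF (q ^ 3)) Sigma_inf =
      {R, mat_image J Q, frob q (mat_image J Q), frob (q ^ 2) (mat_image J Q)}"
  proof -
    have "nrc (GF (q ^ 3)) 4 curve_basis \<inter> pspan (GF (q ^ 3)) Sigma_inf =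
        (nrc_point curve_deg curve_basis ` GF (q ^ 3) \<inter> pspan (GF (q ^ 3)) Sigma_inf) \<union> {R}"
      using RPG[of "q ^ 3"] RW(1) unfolding nrc_def curve_deg R_def[symmetric] pspan_Sigma_inf by auto
    also have "nrc_point curve_deg curve_basis ` GF (q ^ 3) \<inter> pspan (GF (q ^ 3)) Sigma_inf =
        (\<Union>\<theta>\<in>{x}. {pt (H *v nu \<theta>), frob q (pt (H *v nu \<theta>)), frob (q ^ 2) (pt (H *v nu \<theta>))})"
      by (rule affine_points_infinity) (use x root in auto)
    finally show ?thesis
      unfolding Q_def J_pt by auto
  qed
  ultimately show ?thesis by blast
qed

text \<open>Now f0 is a genuine quadratic over \<open>GF (q ^ 3)\<close>. Its roots either both lie
  in that field, possibly equal, or both lie outside it and are swapped by the power q^3; these are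
  the two alternatives of the final disjunction.\<close>

lemma point_off_conic:
  assumes a3: "a $ 3 \<noteq> 0"
  shows "\<exists>P Q b.
          conic_plusplus q C \<inter> pspan (GF (q ^ 6)) linf = {P, Q} \<and>
          nrc_basis (GF q) 6 b \<and>
          bb_set q J \<Sigma>6 C = nrc (GF q) 6 b \<and>
          bb_variety_star q J B \<Sigma>6 C = nrc (GF (q ^ 3)) 6 b \<and>
          bb_variety_starstar q J B \<Sigma>6 C = nrc (GF (q ^ 6)) 6 b \<and>
          (\<forall>h \<in> rational (GF q). Sigma_inf = {X \<in> \<Sigma>6. X \<subseteq> hyperplane h} \<longrightarrow>
             nrc_section 6 b h =
               {#mat_image J P, frob q (mat_image J P), frob (q ^ 2) (mat_image J P),
                 mat_image J Q, frob q (mat_image J Q), frob (q ^ 2) (mat_image J Q)#}) \<and>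
          (mat_image J P \<in> G \<and> mat_image J Q \<in> G \<and>
             conic_plus q C \<inter> linf = {P, Q} \<and>
             nrc (GF (q ^ 3)) 6 b \<inter> pspan (GF (q ^ 3)) Sigma_inf =
               {mat_image J P, frob q (mat_image J P), frob (q ^ 2) (mat_image J P),
                mat_image J Q, frob q (mat_image J Q), frob (q ^ 2) (mat_image J Q)}
           \<or>
           mat_image J P \<in> pspan (GF (q ^ 6)) G - G \<and>
             mat_image J Q \<in> pspan (GF (q ^ 6)) G - G \<and>
             conic_plus q C \<inter> linf = {} \<and>
             mat_image J Q = frob (q ^ 3) (mat_image J P) \<and>
             nrc (GF (q ^ 6)) 6 b \<inter> pspan (GF (q ^ 6)) Sigma_inf =
               {mat_image J P, frob q (mat_image J P), frob (q ^ 2) (mat_image J P),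
                mat_image J Q, frob q (mat_image J Q), frob (q ^ 2) (mat_image J Q)})"
proof -
  have curve_deg: "curve_deg = 6" using a3 by (simp add: curve_deg_def)
  obtain x y where xy: "a $ 3 * (x + y) = - a $ 2" "a $ 3 * (x * y) = a $ 1"
    using quadratic_root[of "a $ 1" "a $ 2" "a $ 3"] a a3 unfolding rational3_iff by blast
  have root: "dot a (nu \<theta>) = 0 \<longleftrightarrow> \<theta> = x \<or> \<theta> = y" for \<theta>
    unfolding poly_form_poly[symmetric] form_poly_factor[OF xy] using a3 by (simp del: mult_pCons_left mult_pCons_right)
  then have roots: "{\<theta>. dot a (nu \<theta>) = 0} = {x, y}" by auto
  define P where "P = pt (A *v nu x)"
  define Q where "Q = pt (A *v nu y)"
  have JPQ: "mat_image J P = pt (H *v nu x)" "mat_image J Q = pt (H *v nu y)"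
    by (simp_all add: P_def Q_def J_pt)
  have inf: "curve_vec e3 \<in> rational (GF m)" if "fexp m" for m
    using rational_mono[OF that curve_basis_rational[of 6]] curve_basis_6[OF a3] by simp
  have nrc_eq: "nrc K 6 curve_basis = nrc_point curve_deg curve_basis ` K \<union> {pt (curve_vec e3)}" for K
    by (simp add: nrc_def curve_deg curve_basis_6[OF a3])
  have curve: "((\<Union>\<theta>\<in>GF m. element (GF m) (nu \<theta>)) \<union> element (GF m) e3) \<inter> pspan (GF m) \<Sigma>6 = nrc (GF m) 6 curve_basis"
    if "fexp m" for m
    unfolding Int_Un_distrib2 affine_points_section[OF that] nrc_eq
    using element_section[OF good_e3[OF a3] inf[OF that]] by simp
  have curve_vec_e3: "curve_vec e3 \<notin> W6"
    using a3 by (simp add: curve_vec_in_W6 a3_eq_0)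
  have infinity: "nrc (GF m) 6 curve_basis \<inter> pspan (GF m) Sigma_inf =
      {mat_image J P, frob q (mat_image J P), frob (q ^ 2) (mat_image J P),
       mat_image J Q, frob q (mat_image J Q), frob (q ^ 2) (mat_image J Q)}"
    if m: "fexp m" and "x \<in> GF m" "y \<in> GF m" for m
  proof -
    have "pt (curve_vec e3) \<notin> pspan (GF m) Sigma_inf"
      unfolding pspan_Sigma_inf using curve_vec_e3 pt_subset_iff[OF subspace_W6] by simp
    then have "nrc (GF m) 6 curve_basis \<inter> pspan (GF m) Sigma_inf = nrc_point curve_deg curve_basis ` GF m \<inter> pspan (GF m) Sigma_inf"
      unfolding nrc_eq by auto
    also have "\<dots> = (\<Union>\<theta>\<in>{x, y}. {pt (H *v nu \<theta>), frob q (pt (H *v nu \<theta>)), frob (q ^ 2) (pt (H *v nu \<theta>))})"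
      by (rule affine_points_infinity[OF m roots]) (use that in simp)
    finally show ?thesis
      unfolding JPQ by auto
  qed
  have "conic_plusplus q C \<inter> pspan (GF (q ^ 6)) linf = {P, Q}"
    unfolding conic_plusplus_linf[OF a3] roots by (simp add: P_def Q_def)
  moreover have "nrc_basis (GF q) 6 curve_basis"
    using nrc_basis_curve_basis by (simp add: curve_deg)
  moreover have "bb_set q J \<Sigma>6 C = nrc (GF q) 6 curve_basis"
  proof -
    have "bb_set q J \<Sigma>6 C = (\<Union>\<theta>\<in>GF q. bb_element q J \<Sigma>6 (pt (A *v nu \<theta>))) \<union> bb_element q J \<Sigma>6 (pt (A *v e3))"
      unfolding bb_set_def C image_std_conic by auto
    also have "\<dots> = ((\<Union>\<theta>\<in>GF q. element (GF q) (nu \<theta>)) \<union> element (GF q) e3) \<inter> pspan (GF q) \<Sigma>6"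
      by (auto simp: bb_element_eq)
    finally show ?thesis
      using curve[of q] by simp
  qed
  moreover have "bb_variety_star q J B \<Sigma>6 C = nrc (GF (q ^ 3)) 6 curve_basis"
    unfolding bb_variety_star_def conic_plus_eq image_std_conic
    using curve[of "q ^ 3"] by (simp add: scroll_plane_eq Un_commute)
  moreover have "bb_variety_starstar q J B \<Sigma>6 C = nrc (GF (q ^ 6)) 6 curve_basis"
    unfolding bb_variety_starstar_def conic_plusplus_eq image_std_conic
    using curve[OF fexp(1), of 6] by (simp add: scroll_plane_eq Un_commute del: GF_q6)
  moreover have "\<forall>h \<in> rational (GF q). Sigma_inf = {X \<in> \<Sigma>6. X \<subseteq> hyperplane h} \<longrightarrow>
             nrc_section 6 curve_basis h =
               {#mat_image J P, frob q (mat_image J P), frob (q ^ 2) (mat_image J P),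
                 mat_image J Q, frob q (mat_image J Q), frob (q ^ 2) (mat_image J Q)#}"
    unfolding JPQ using nrc_section_roots[OF a3 xy] by blast
  moreover have
    "mat_image J P \<in> G \<and> mat_image J Q \<in> G \<and>
             conic_plus q C \<inter> linf = {P, Q} \<and>
             nrc (GF (q ^ 3)) 6 curve_basis \<inter> pspan (GF (q ^ 3)) Sigma_inf =
               {mat_image J P, frob q (mat_image J P), frob (q ^ 2) (mat_image J P),
                mat_image J Q, frob q (mat_image J Q), frob (q ^ 2) (mat_image J Q)}
           \<or>
           mat_image J P \<in> pspan (GF (q ^ 6)) G - G \<and>
             mat_image J Q \<in> pspan (GF (q ^ 6)) G - G \<and>
             conic_plus q C \<inter> linf = {} \<and>
             mat_image J Q = frob (q ^ 3) (mat_image J P) \<and>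
             nrc (GF (q ^ 6)) 6 curve_basis \<inter> pspan (GF (q ^ 6)) Sigma_inf =
               {mat_image J P, frob q (mat_image J P), frob (q ^ 2) (mat_image J P),
                mat_image J Q, frob q (mat_image J Q), frob (q ^ 2) (mat_image J Q)}"
  proof (cases "x \<in> GF (q ^ 3)")
    case True
    have "x + y = - a $ 2 / a $ 3"
      using xy(1) a3 by (simp add: field_simps)
    then have "y = - a $ 2 / a $ 3 - x"
      by (simp add: algebra_simps eq_diff_eq)
    moreover have "a $ 2 \<in> GF (q ^ 3)" "a $ 3 \<in> GF (q ^ 3)"
      using a by (simp_all add: rational3_iff)
    ultimately have y: "y \<in> GF (q ^ 3)"
      using True by (auto intro!: GF_closed GF_minus)
    have "{\<theta> \<in> GF (q ^ 3). dot a (nu \<theta>) = 0} = {x, y}"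
      using True y root by auto
    then have "conic_plus q C \<inter> linf = {P, Q}"
      unfolding conic_plus_linf using a3 by (simp add: P_def Q_def)
    moreover have "mat_image J P \<in> G" "mat_image J Q \<in> G"
      using calculation unfolding G_eq[symmetric] by blast+
    ultimately show ?thesis
      using infinity[OF fexp(1) True y] by (intro disjI1 conjI)
  next
    case False
    \<comment> \<open>The coefficients of f0 are fixed by the power q^3, which therefore permutes
      its roots; a root moved by it must go to the other one.\<close>
    have conj_root: "dot a (nu (\<theta> ^ (q ^ 3))) = 0" if "dot a (nu \<theta>) = 0" for \<theta>
    proof -
      have "dot a (nu (\<theta> ^ (q ^ 3))) = dot a (nu \<theta>) ^ (q ^ 3)"
        using a by (simp add: frob_vec_dot frob_vec_nu rational_iff_frob_vec)
      then show ?thesis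
        using that q_gt_1 by (simp add: power_0_left)
    qed
    have "x ^ (q ^ 3) \<noteq> x"
      using False by (simp add: GF_def)
    then have xq: "x ^ (q ^ 3) = y"
      using conj_root[of x] root by blast
    have "y \<notin> GF (q ^ 3)"
    proof
      assume "y \<in> GF (q ^ 3)"
      then have "y ^ (q ^ 3) = x ^ (q ^ 3)"
        by (simp add: GF_def xq)
      then have "y = x"
        by (simp add: frob_inj)
      with False \<open>y \<in> GF (q ^ 3)\<close> show False by simp
    qed
    have "{\<theta> \<in> GF (q ^ 3). dot a (nu \<theta>) = 0} = {}"
      using False \<open>y \<notin> GF (q ^ 3)\<close> root by auto
    then have 1: "conic_plus q C \<inter> linf = {}"
      unfolding conic_plus_linf using a3 by simp
    have "frob_mat (q ^ 3) H = H"
      by (rule frob_mat_q3_H)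
    then have 2: "mat_image J Q = frob (q ^ 3) (mat_image J P)"
      unfolding JPQ by (simp add: frob_pt frob_vec_mult frob_vec_nu xq)
    have 3: "mat_image J (pt (A *v nu z)) \<in> pspan (GF (q ^ 6)) G - G"
      if z: "dot a (nu z) = 0" "z \<notin> GF (q ^ 3)" for z
    proof
      have "\<Union>G = (\<lambda>v. J *v v) ` \<Union>linf"
        unfolding G_eq[symmetric] mat_image_def by (simp add: image_Union)
      then have "vec.span (\<Union>G) = (\<lambda>v. J *v v) ` vec.span (\<Union>linf)"
        by (simp add: vec.span_image)
      then have "H *v nu z \<in> vec.span (\<Union>G)"
        using z(1) unfolding span_linf HJA matrix_vector_mul_assoc[symmetric] by blast
      moreover have "H *v nu z \<noteq> 0"
        unfolding H_eq_Phi by (simp add: Phi_eq_0_iff)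
      ultimately show "mat_image J (pt (A *v nu z)) \<in> pspan (GF (q ^ 6)) G"
        unfolding J_pt pspan_iff by (intro exI[of _ "H *v nu z"]) (simp add: rational_def)
      show "mat_image J (pt (A *v nu z)) \<notin> G"
      proof
        assume "mat_image J (pt (A *v nu z)) \<in> G"
        then obtain y where y: "pt (H *v nu z) = pt (H *v y)" "y \<in> rational (GF (q ^ 3))"
          unfolding J_pt G_def by blast
        then obtain c where c: "c \<noteq> 0" "H *v y = c *s (H *v nu z)"
          using pt_eq_iff[OF \<open>H *v nu z \<noteq> 0\<close>] by blast
        then have "y = c *s nu z"
          unfolding H_eq_Phi by (simp add: Phi_linear Phi_eq_iff)
        then have "z = y $ 2 / y $ 1"
          using c(1) by simp
        moreover have "y $ 2 / y $ 1 \<in> GF (q ^ 3)"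
          using y(2) by (intro GF_closed) (simp_all add: rational3_iff)
        ultimately show False
          using z(2) by simp
      qed
    qed
    have "mat_image J P \<in> pspan (GF (q ^ 6)) G - G" "mat_image J Q \<in> pspan (GF (q ^ 6)) G - G"
      unfolding P_def Q_def using 3 root False \<open>y \<notin> GF (q ^ 3)\<close> by blast+
    moreover have "x \<in> GF (q ^ 6)" "y \<in> GF (q ^ 6)"
      by simp_all
    note infinity[OF fexp(1) this]
    ultimately show ?thesis
      using 1 2 by (intro disjI2 conjI)
  qed
  ultimately show ?thesis
    by - (intro exI[of _ P] exI[of _ Q] exI[of _ curve_basis] conjI; assumption)
qed

end

section \<open>From the given configuration to the coordinate frame\<close>

lemma (in bose_frame) bb_frame_exists:
  assumes "\<And>\<theta> c. nu \<theta> \<noteq> c *s t" "proj_subspace (GF q) 6 \<Sigma>" "Sigma_inf \<subseteq> \<Sigma>"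
  obtains c where "c \<noteq> 0" "c *s a \<in> rational (GF (q ^ 3))" "bb_frame q H (c *s a) t \<Sigma>"
proof -
  obtain c where c: "c \<in> GF (q ^ 3)" "c \<noteq> 0"
    "vec.span (\<Union>\<Sigma>) = {Phi u0 u1 u2 | u0 u1 u2. dot (c *s a) u0 = dot (frob_vec q (c *s a)) u1
       \<and> dot (frob_vec q (c *s a)) u1 = dot (frob_vec (q ^ 2) (c *s a)) u2}"
    using normalize[OF assms(2,3)] by blast
  interpret s: bose_frame q "TYPE('a)" H "c *s a" t
    using c(1,2) by (rule bose_frame_scale)
  have "vec.span (\<Union>\<Sigma>) = s.W7"
    unfolding s.W7_def s.a1_def s.a2_def by (rule c(3))
  then have "bb_frame q H (c *s a) t \<Sigma>"
    using assms(1,2) by unfold_locales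
  moreover have "c *s a \<in> rational (GF (q ^ 3))"
    by (rule s.a)
  ultimately show thesis
    using that c(2) by blast
qed

text \<open>On \<open>GF q\<close>-vectors Frobenius is trivial, so there
  \<open>B ** frob_mat q A\<close> and \<open>A\<close> give the same points. A frame over
  \<open>GF q\<close> then makes the two matrices proportional, which carries the formula over to
  the whole plane.\<close>

lemma (in frobenius_field) conjugacy_frobenius:
  fixes A B :: "'a ^ 3 ^ 3"
  assumes A: "invertible A" and conj: "conjugacy q (mat_image A ` PG (GF q)) B"
  shows "conj_map q B (pt (A *v y)) = pt (A *v frob_vec q y)"
proof -
  let ?M = "B ** frob_mat q A"
  have conj_map: "conj_map q B (pt (A *v v)) = pt (?M *v frob_vec q v)" for v
    by (simp add: conj_map_def frob_pt frob_vec_mult mat_image_pt matrix_vector_mul_assoc)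
  have fix_pt: "\<exists>c. ?M *v v = c *s (A *v v)" if "v \<in> rational (GF q)" "v \<noteq> 0" for v
  proof -
    have "pt (A *v v) \<in> mat_image A ` PG (GF q)"
      using that unfolding PG_def by (auto simp: mat_image_pt intro!: image_eqI[of _ _ "pt v"])
    then have "conj_map q B (pt (A *v v)) = pt (A *v v)"
      using conj unfolding conjugacy_def by blast
    moreover have "frob_vec q v = v"
      using that(1) by (simp add: rational_iff_frob_vec)
    ultimately have "pt (?M *v v) = pt (A *v v)"
      unfolding conj_map by simp
    then have "?M *v v \<in> pt (A *v v)"
      using vec.span_base[of "?M *v v" "{?M *v v}"] by simp
    then show ?thesis
      by (simp add: vec.span_singleton image_iff)
  qed
  have "\<exists>c. ?M *v axis i 1 = c *s (A *v axis i 1)" for i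
    by (rule fix_pt) (simp_all add: rational_def axis_eq_0_iff, simp add: axis_def)
  moreover have "\<exists>c. ?M *v vector [1, 1, 1] = c *s (A *v vector [1, 1, 1])"
    by (rule fix_pt) (simp_all add: rational3_iff vec3_eq_iff)
  ultimately obtain c where c: "\<And>v. ?M *v v = c *s (A *v v)"
    using frame_scalar[OF A, of ?M] by blast
  have "c \<noteq> 0"
  proof
    assume "c = 0"
    then have "?M *v e3 = 0"
      by (simp add: c)
    then have "B *v (frob_mat q A *v e3) = 0"
      by (simp add: matrix_vector_mul_assoc)
    moreover have "invertible B"
      using conj by (simp add: conjugacy_def)
    ultimately have "frob_mat q A *v e3 = 0"
      using inj_matI[of B "frob_mat q A *v e3" 0] by simp
    then have "frob_vec q (A *v e3) = 0"
      by (simp add: frob_vec_mult flip: rational_iff_frob_vec)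
        (simp add: frob_vec_mult rational_std(1)[unfolded rational_iff_frob_vec])
    then show False
      using inj_matI[OF A, of e3 0] by (simp add: frob_vec_eq_0_iff)
  qed
  then show ?thesis
    unfolding conj_map c by (rule pt_scale)
qed

theorem corollary4p4:
  fixes q :: nat
    and linf \<pi> C :: "('a::{field,finite} ^ 3) set set"
    and T :: "('a ^ 3) set"
    and J :: "'a ^ 3 ^ 9"
    and B :: "'a ^ 3 ^ 3"
    and \<Gamma> g \<Sigma>inf \<Sigma>6 :: "('a ^ 9) set set"
  assumes "primepow q" and "q \<ge> 6" and "CARD('a) = q ^ 6"
    and "proj_subspace (GF (q ^ 3)) 1 linf"
    and "Fq_conic q \<pi> C"
    and "linf \<inter> \<pi> = {T}"
    and "conjugacy q \<pi> B"
    and "bose_plane q J \<Gamma>"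
    and "g = mat_image J ` linf"
    and "\<Sigma>inf = pspan (GF q) (g \<union> frob q ` g \<union> frob (q ^ 2) ` g)"
    and "proj_subspace (GF q) 6 \<Sigma>6" and "\<Sigma>inf \<subseteq> \<Sigma>6"
  shows
    "(T \<in> C \<longrightarrow>
       (\<exists>Q. Q \<noteq> T \<and> conic_plus q C \<inter> linf = {T, Q} \<and>
         (\<exists>b R. nrc_basis (GF q) 4 b \<and>
            bb_set q J \<Sigma>6 C = bb_element q J \<Sigma>6 T \<union> nrc (GF q) 4 b \<and>
            R \<in> bb_element q J \<Sigma>6 T \<and>
            nrc (GF (q ^ 3)) 4 b \<inter> pspan (GF (q ^ 3)) \<Sigma>inf =
              {R, mat_image J Q, frob q (mat_image J Q), frob (q ^ 2) (mat_image J Q)})))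
     \<and>
     (T \<notin> C \<longrightarrow>
       (\<exists>P Q b.
          conic_plusplus q C \<inter> pspan (GF (q ^ 6)) linf = {P, Q} \<and>
          nrc_basis (GF q) 6 b \<and>
          bb_set q J \<Sigma>6 C = nrc (GF q) 6 b \<and>
          bb_variety_star q J B \<Sigma>6 C = nrc (GF (q ^ 3)) 6 b \<and>
          bb_variety_starstar q J B \<Sigma>6 C = nrc (GF (q ^ 6)) 6 b \<and>
          (\<forall>h \<in> rational (GF q). \<Sigma>inf = {X \<in> \<Sigma>6. X \<subseteq> hyperplane h} \<longrightarrow>
             nrc_section 6 b h =
               {#mat_image J P, frob q (mat_image J P), frob (q ^ 2) (mat_image J P),
                 mat_image J Q, frob q (mat_image J Q), frob (q ^ 2) (mat_image J Q)#}) \<and>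
          (mat_image J P \<in> g \<and> mat_image J Q \<in> g \<and>
             conic_plus q C \<inter> linf = {P, Q} \<and>
             nrc (GF (q ^ 3)) 6 b \<inter> pspan (GF (q ^ 3)) \<Sigma>inf =
               {mat_image J P, frob q (mat_image J P), frob (q ^ 2) (mat_image J P),
                mat_image J Q, frob q (mat_image J Q), frob (q ^ 2) (mat_image J Q)}
           \<or>
           mat_image J P \<in> pspan (GF (q ^ 6)) g - g \<and>
             mat_image J Q \<in> pspan (GF (q ^ 6)) g - g \<and>
             conic_plus q C \<inter> linf = {} \<and>
             mat_image J Q = frob (q ^ 3) (mat_image J P) \<and>
             nrc (GF (q ^ 6)) 6 b \<inter> pspan (GF (q ^ 6)) \<Sigma>inf =
               {mat_image J P, frob q (mat_image J P), frob (q ^ 2) (mat_image J P),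
                mat_image J Q, frob q (mat_image J Q), frob (q ^ 2) (mat_image J Q)})))"
proof -
  interpret frobenius_field q "TYPE('a)"
    using assms(1,3) by unfold_locales
  obtain A0 D where A0: "A0 \<in> rational_mat (GF (q ^ 3))" "invertible A0" and D: "nondeg_conic (GF q) D"
    and \<pi>0: "\<pi> = mat_image A0 ` PG (GF q)" and C0: "C = mat_image A0 ` D"
    using \<open>Fq_conic q \<pi> C\<close> unfolding Fq_conic_def by blast
  \<comment> \<open>The centre of the projection is the tangency point if that lies on the conic and
    an arbitrary point of the conic otherwise; this places \<open>T\<close> at parameter infinity in
    the first case.\<close>
  obtain P where P: "P \<in> D" "T \<in> C \<longrightarrow> T = mat_image A0 P"
    using nondeg_conic_nonempty[OF D] unfolding C0 by blast
  obtain N where N: "N \<in> rational_mat (GF q)" "invertible N" "D = mat_image N ` std_conic (GF q)"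
    "P = mat_image N (pt e3)"
    using conic_parametrization[OF D P(1)] .
  define A where "A = A0 ** N"
  have "N \<in> rational_mat (GF (q ^ 3))"
    using N(1) GF_mono[OF _ fexp(1)] by (simp add: rational_mat_def)
  then have A: "A \<in> rational_mat (GF (q ^ 3))" "invertible A"
    unfolding A_def using A0 N(2) by (auto intro: rational_mat_mult invertible_mult)
  have C: "C = mat_image A ` std_conic (GF q)"
    by (simp add: C0 N(3) A_def image_image mat_image_comp)
  have \<pi>: "\<pi> = mat_image A ` PG (GF q)"
    unfolding \<pi>0 A_def using mat_image_PG[OF fexp(2) N(1,2)]
    by (metis (no_types, lifting) image_cong image_image mat_image_comp)
  have TC: "T \<in> C \<longleftrightarrow> T = pt (A *v e3)"
  proof
    assume "T \<in> C"
    then show "T = pt (A *v e3)"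
      using P(2) N(4) by (simp add: A_def mat_image_pt matrix_vector_mul_assoc)
  next
    assume "T = pt (A *v e3)"
    then show "T \<in> C"
      unfolding C image_std_conic by simp
  qed
  obtain a where a: "a \<in> rational (GF (q ^ 3))" and span_linf: "vec.span (\<Union>linf) = {A *v y | y. dot a y = 0}"
    using line_equation[OF assms(4) fexp(1) A] .
  have A_inj: "A *v x = A *v y \<Longrightarrow> x = y" for x y
    using inj_matI[OF A(2)] .
  have linf_iff: "pt (A *v y) \<in> linf \<longleftrightarrow> dot a y = 0" if "y \<in> rational (GF (q ^ 3))" "y \<noteq> 0" for y
  proof -
    have "A *v y \<noteq> 0"
      using that(2) A_inj[of y 0] by auto
    then have "pt (A *v y) \<in> PG (GF (q ^ 3))"
      unfolding PG_iff using rational_mult[OF fexp(1) A(1) that(1)] by blast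
    moreover have "linf = {X \<in> PG (GF (q ^ 3)). X \<subseteq> vec.span (\<Union>linf)}"
      using assms(4) by (auto simp: proj_subspace_def pspan_def)
    ultimately have "pt (A *v y) \<in> linf \<longleftrightarrow> A *v y \<in> vec.span (\<Union>linf)"
      using pt_subset_iff[OF vec.subspace_span, of "A *v y" "\<Union>linf"] by blast
    also have "\<dots> \<longleftrightarrow> dot a y = 0"
      unfolding span_linf using A_inj by blast
    finally show ?thesis .
  qed
  have "T \<in> linf" "T \<in> \<pi>"
    using assms(6) by blast+
  then obtain t where t: "t \<in> rational (GF q)" "t \<noteq> 0" "T = pt (A *v t)"
    unfolding \<pi> PG_def by (auto simp: mat_image_pt)
  have at: "dot a t = 0"
    using \<open>T \<in> linf\<close> linf_iff rational_mono[OF fexp(1) t(1)] t by blast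
  have tangent: "\<exists>c. s = c *s t" if s: "s \<in> rational (GF q)" "dot a s = 0" for s
  proof (cases "s = 0")
    case True
    then show ?thesis by (intro exI[of _ 0]) simp
  next
    case False
    have "pt (A *v s) \<in> linf"
      using linf_iff rational_mono[OF fexp(1) s(1)] s False by blast
    moreover have "pt s \<in> PG (GF q)"
      unfolding PG_iff using s False by blast
    then have "pt (A *v s) \<in> \<pi>"
      unfolding \<pi> mat_image_pt[symmetric] by (rule imageI)
    ultimately have "pt (A *v t) = pt (A *v s)"
      using assms(6) t(3) by blast
    moreover have "A *v t \<noteq> 0"
      using t(2) A_inj[of t 0] by auto
    ultimately obtain c where "A *v s = c *s (A *v t)"
      using pt_eq_iff by blast
    then have "A *v s = A *v (c *s t)"
      by (simp add: vec.scale)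
    then show ?thesis
      using A_inj by blast
  qed
  \<comment> \<open>If \<open>T\<close> were at a finite parameter, that parameter would be a
    quotient of \<open>GF q\<close>-coordinates of \<open>t\<close>. Then \<open>T\<close> would be
    on \<open>C\<close>, hence at parameter infinity by \<open>TC\<close>.\<close>
  have affine: "nu \<theta> \<noteq> c *s t" for \<theta> c
  proof
    assume nu: "nu \<theta> = c *s t"
    then have "c \<noteq> 0" by auto
    then have "T = pt (A *v nu \<theta>)"
      unfolding t(3) nu by (simp add: vec.scale pt_scale)
    have "1 = c * t $ 1" "\<theta> = c * t $ 2"
      using arg_cong[OF nu, of "\<lambda>v. v $ 1"] arg_cong[OF nu, of "\<lambda>v. v $ 2"] by simp_all
    then have t1: "t $ 1 \<noteq> 0" and "\<theta> * t $ 1 = c * t $ 1 * t $ 2"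
      by auto
    then have "\<theta> * t $ 1 = t $ 2"
      using \<open>1 = c * t $ 1\<close> by simp
    with t1 have "\<theta> = t $ 2 / t $ 1"
      by (simp add: nonzero_eq_divide_eq)
    with t1 have "\<theta> \<in> GF q"
      using t(1) by (auto simp: rational3_iff intro: GF_closed)
    then have "T \<in> C"
      unfolding C image_std_conic using \<open>T = pt (A *v nu \<theta>)\<close> by blast
    then have "pt (A *v e3) = pt (A *v nu \<theta>)"
      using TC \<open>T = pt (A *v nu \<theta>)\<close> by simp
    moreover have "A *v e3 \<noteq> 0"
      using A_inj[of e3 0] by auto
    ultimately obtain d where "A *v nu \<theta> = d *s (A *v e3)"
      using pt_eq_iff by blast
    then have "A *v nu \<theta> = A *v (d *s e3)"
      by (simp add: vec.scale)
    then have "nu \<theta> = d *s e3"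
      by (rule A_inj)
    from arg_cong[OF this, of "\<lambda>v. v $ 1"] show False
      by simp
  qed
  define H where "H = J ** A"
  have J: "J \<in> rational_mat (GF (q ^ 3))" "inj (\<lambda>v. J *v v)" and \<Gamma>: "mat_image J ` PG (GF (q ^ 3)) = \<Gamma>"
    and spans: "pspan (GF (q ^ 3)) (\<Gamma> \<union> frob q ` \<Gamma> \<union> frob (q ^ 2) ` \<Gamma>) = PG (GF (q ^ 3))"
    using assms(8) by (simp_all add: bose_plane_def)
  have H_rat: "H \<in> rational_mat (GF (q ^ 3))"
    unfolding H_def using J(1) A(1) by (simp add: rational_mat_mult)
  \<comment> \<open>The sums of the three images form a subspace \<open>R\<close> containing
    \<Gamma> and its conjugates. The axis vectors give points over \<open>GF (q ^ 3)\<close>, so by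
    \<open>spans\<close> they lie in the span of these planes, and \<open>R\<close> is
    everything.\<close>
  have H_surj: "\<exists>u0 u1 u2. x = H *v u0 + frob_mat q H *v u1 + frob_mat (q ^ 2) H *v u2" for x
  proof -
    define R where "R = {H *v u0 + frob_mat q H *v u1 + frob_mat (q ^ 2) H *v u2 | u0 u1 u2. True}"
    have R: "H *v u0 + frob_mat q H *v u1 + frob_mat (q ^ 2) H *v u2 \<in> R" for u0 u1 u2
      unfolding R_def by blast
    have sub: "vec.subspace R"
    proof (rule vec.subspaceI)
      show "0 \<in> R"
        using R[of 0 0 0] by simp
    next
      fix x y assume "x \<in> R" "y \<in> R"
      then obtain u0 u1 u2 v0 v1 v2 where "x = H *v u0 + frob_mat q H *v u1 + frob_mat (q ^ 2) H *v u2"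
        "y = H *v v0 + frob_mat q H *v v1 + frob_mat (q ^ 2) H *v v2"
        unfolding R_def by blast
      then have "x + y = H *v (u0 + v0) + frob_mat q H *v (u1 + v1) + frob_mat (q ^ 2) H *v (u2 + v2)"
        by (simp add: vec.add)
      then show "x + y \<in> R"
        using R by simp
    next
      fix c x assume "x \<in> R"
      then obtain u0 u1 u2 where "x = H *v u0 + frob_mat q H *v u1 + frob_mat (q ^ 2) H *v u2"
        unfolding R_def by blast
      then have "c *s x = H *v (c *s u0) + frob_mat q H *v (c *s u1) + frob_mat (q ^ 2) H *v (c *s u2)"
        by (simp add: vec.scale vec.scale_right_distrib)
      then show "c *s x \<in> R"
        using R by simp
    qed
    have "X \<subseteq> R \<and> frob q X \<subseteq> R \<and> frob (q ^ 2) X \<subseteq> R" if "X \<in> \<Gamma>" for X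
    proof -
      have "\<Gamma> = mat_image H ` PG (GF (q ^ 3))"
        unfolding \<Gamma>[symmetric] H_def using mat_image_PG[OF fexp(1) A]
        by (metis (no_types, lifting) image_cong image_image mat_image_comp)
      then obtain v where X: "X = pt (H *v v)"
        using \<open>X \<in> \<Gamma>\<close> unfolding PG_def by (auto simp: mat_image_pt)
      have "H *v v \<in> R" "frob_mat q H *v frob_vec q v \<in> R" "frob_mat (q ^ 2) H *v frob_vec (q ^ 2) v \<in> R"
        using R[of v 0 0] R[of 0 "frob_vec q v" 0] R[of 0 0 "frob_vec (q ^ 2) v"] by simp_all
      then show ?thesis
        using pt_subset_iff[OF sub] unfolding X by (simp add: frob_pt frob_vec_mult)
    qed
    then have "\<Union>(\<Gamma> \<union> frob q ` \<Gamma> \<union> frob (q ^ 2) ` \<Gamma>) \<subseteq> R"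
      by blast
    then have "vec.span (\<Union>(\<Gamma> \<union> frob q ` \<Gamma> \<union> frob (q ^ 2) ` \<Gamma>)) \<subseteq> R"
      using sub by (rule vec.span_minimal)
    moreover have "axis i 1 \<in> vec.span (\<Union>(\<Gamma> \<union> frob q ` \<Gamma> \<union> frob (q ^ 2) ` \<Gamma>))" for i
    proof -
      have "axis i 1 \<in> rational (GF (q ^ 3) :: 'a set)" "axis i 1 \<noteq> (0 :: 'a ^ 9)"
        by (simp_all add: rational_def axis_eq_0_iff, simp add: axis_def)
      then have "pt (axis i 1) \<in> pspan (GF (q ^ 3)) (\<Gamma> \<union> frob q ` \<Gamma> \<union> frob (q ^ 2) ` \<Gamma>)"
        unfolding spans PG_iff by blast
      then show ?thesis
        using pt_subset_iff[OF vec.subspace_span] unfolding pspan_def by blast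
    qed
    ultimately have "cart_basis \<subseteq> R"
      unfolding cart_basis_def by blast
    then have "vec.span cart_basis \<subseteq> R"
      using sub by (rule vec.span_minimal)
    then have "x \<in> R"
      by auto
    then show ?thesis
      unfolding R_def by blast
  qed
  interpret F: bose_frame q "TYPE('a)" H a t
    using H_rat H_surj a t at tangent by unfold_locales auto
  have linf_eq: "linf = {pt (A *v y) | y. y \<in> rational (GF (q ^ 3)) \<and> y \<noteq> 0 \<and> dot a y = 0}"
  proof (intro equalityI subsetI)
    fix X assume X: "X \<in> linf"
    then obtain v where v: "v \<in> rational (GF (q ^ 3))" "v \<noteq> 0" "X = pt v"
      using assms(4) unfolding proj_subspace_def PG_def by blast
    obtain y where y: "v = A *v y"
      using A(2) by (rule surj_matE)
    have "y \<in> rational (GF (q ^ 3))" "y \<noteq> 0"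
      using v y rational_mult_iff[OF fexp(1) A] by auto
    with X v y linf_iff show "X \<in> {pt (A *v y) | y. y \<in> rational (GF (q ^ 3)) \<and> y \<noteq> 0 \<and> dot a y = 0}"
      by blast
  qed (use linf_iff in blast)
  have J_pt: "mat_image J (pt (A *v y)) = pt (H *v y)" for y
    by (simp add: mat_image_pt H_def matrix_vector_mul_assoc)
  have gG: "g = F.G"
  proof -
    have "mat_image J ` linf = {mat_image J (pt (A *v y)) | y. y \<in> rational (GF (q ^ 3)) \<and> y \<noteq> 0 \<and> dot a y = 0}"
      unfolding linf_eq by blast
    then show ?thesis
      unfolding assms(9) J_pt F.G_def .
  qed
  have Sigma_inf: "\<Sigma>inf = F.Sigma_inf"
    unfolding assms(10) F.Sigma_inf_def gG ..
  \<comment> \<open>The equation of the line at infinity is replaced by the multiple adapted to the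
    given 6-space; \<open>g\<close>, \<Sigma>inf and the position of \<open>t\<close> do not depend
    on the factor.\<close>
  obtain c where c: "c \<noteq> 0" "bb_frame q H (c *s a) t \<Sigma>6"
    by (rule F.bb_frame_exists[OF affine assms(11) assms(12)[unfolded Sigma_inf]])
  interpret K: bb_frame q "TYPE('a)" H "c *s a" t \<Sigma>6
    by (rule c(2))
  interpret K: bb_conic q "TYPE('a)" H "c *s a" t \<Sigma>6 J A B linf C
  proof unfold_locales
    show "vec.span (\<Union>linf) = {A *v y | y. dot (c *s a) y = 0}"
      unfolding span_linf using c(1) by simp
    show "conj_map q B (pt (A *v y)) = pt (A *v frob_vec q y)" for y
      using conjugacy_frobenius[OF A(2)] assms(7) unfolding \<pi> by blast
  qed (use assms(2,4) A C J(2) in \<open>auto simp: H_def\<close>)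
  have g: "g = K.G"
    unfolding assms(9) K.G_eq ..
  have Sigma_inf: "\<Sigma>inf = K.Sigma_inf"
    unfolding assms(10) K.Sigma_inf_def g ..
  \<comment> \<open>If \<open>e3\<close> is at infinity, it is a \<open>GF q\<close>-point of the
    line there, and tangency identifies it with \<open>T\<close>; this matches the degree of f0 with
    the case distinction of the theorem.\<close>
  have a3: "(c *s a) $ 3 = 0 \<longleftrightarrow> T \<in> C"
  proof
    assume "T \<in> C"
    then have "T = pt (A *v e3)"
      by (simp add: TC)
    then have "pt (A *v e3) \<in> linf"
      using \<open>T \<in> linf\<close> by simp
    then have "dot a e3 = 0"
      using linf_iff[of e3] by simp
    then show "(c *s a) $ 3 = 0"
      by (simp add: dot_def)
  next
    assume "(c *s a) $ 3 = 0"
    then have "dot a e3 = 0"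
      using c(1) by (simp add: dot_def)
    then obtain d where d: "e3 = d *s t"
      using tangent[of e3] by auto
    then have "d \<noteq> 0"
      using e3_nonzero by (metis vec.scale_zero_left)
    then have "T = pt (A *v e3)"
      unfolding t(3) d by (simp add: vec.scale pt_scale)
    then show "T \<in> C"
      by (rule TC[THEN iffD2])
  qed
  have cases: "T \<in> C \<Longrightarrow> (c *s a) $ 3 = 0" "T \<in> C \<Longrightarrow> T = pt (A *v e3)" "T \<notin> C \<Longrightarrow> (c *s a) $ 3 \<noteq> 0"
    using a3 TC by blast+
  show ?thesis
    unfolding Sigma_inf g
    by (intro conjI impI, rule K.point_on_conic, erule cases(1), erule cases(2),
        rule K.point_off_conic, erule cases(3))
qed

end
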